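(* Suppose that there are constants $\alpha\in[0,\tfrac12)$, $C\ge1$, $\mathcal{Q}\ge 1$ and non-negative numbers $q_{i,k}$ ($1\le k\le i$) such that $$\sum_{k=1}^i k(i-k+1)q_{i,k}\le \mathcal{Q}\,i\quad\text{for all } i\in\mathbb{N}_+,$$ $$a(i,j;k)\le C(i-k+1)(j+k)q_{i,k}\quad\text{for all integers } 1\le k\le i \text{ and all } j\in\mathbb{N}_+,$$ $$a(i,j;k)\le C(i-k+1)^\alpha(j^\alpha+k^\alpha)q_{i,k}\quad\text{for all integers } 1\le k\le i \text{ and all } j\in\mathbb{N}.$$ Let $T\in(0,+\infty)$ and $c^{\mathrm{in}}\in X_{0,1}^+$. Then the initial value problem for the DGED system with initial condition $c(0)=c^{\mathrm{in}}$ (in either the isolated or the non-isolated case) has a unique (mild) solution on $[0,T]$.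
   Context: Notation: $\mathbb{N}=\{0,1,2,\dots\}$, $\mathbb{N}_+=\mathbb{N}\setminus\{0\}$; $0^0=1$. Rate coefficients: real numbers $a(p,q;k)\ge 0$ are given for all integers $p\ge1$, $q\ge 0$, $1\le k\le p$. Standing assumptions: $a(p,0;p)=0$ for all $p\in\mathbb{N}_+$; $a(k,j;k)=a(j,k;j)$ for all $j,k\in\mathbb{N}_+$; $a(i,0;k)=a(i,0;i-k)$ for all $i\in\mathbb{N}_+$, $1\le k\le i-1$. Discrete generalized exchange-driven (DGED) system: $\dot c_i=\sum_{j=1}^4 Q_{j,i}(c)$, $i\in\mathbb{N}$, where $$Q_{1,i}(c)=\sum_{k=1}^\infty\sum_{j=0}^\infty a(i+k,j;k)c_{i+k}c_j,\qquad Q_{2,i}(c)=-\sum_{k=1}^\infty\sum_{j=k}^\infty a(j,i;k)c_jc_i,$$ $$Q_{3,i}(c)=\sum_{k=1}^i\sum_{j=k}^\infty a(j,i-k;k)c_jc_{i-k},\qquad Q_{4,i}(c)=-\sum_{k=1}^i\sum_{j=0}^\infty a(i,j;k)c_jc_i .$$ In the isolated case these formulas hold for all $i\in\mathbb{N}$, with $Q_{3,0}=Q_{4,0}=0$. In the non-isolated case they hold for $i\in\mathbb{N}_+$, while $Q_{j,0}=0$ for $j=1,2,3,4$ (so $\dot c_0=0$). Spaces: $X_{0,1}=\{c:\mathbb{N}\to\mathbb{R} : \|c\|:=\sum_{i=0}^\infty(1+i)|c_i|<\infty\}$, $X_{0,1}^+=\{c\in X_{0,1}: c_i\ge 0\ \forall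 i\}$. Mild solution: a (mild) solution on $[0,T]$ with initial condition $c^{\mathrm{in}}\in X_{0,1}^+$ is a sequence of nonnegative functions $c=(c_i):[0,T]\to X_{0,1}^+$ such that for each $i\in\mathbb{N}$ and $t\in(0,T]$: (i) $c_i\in C^0([0,T])$; (ii) $Q_{j,i}(c(\cdot))\in L^1(0,t)$ for $j=1,2,3,4$; (iii) $c_i(t)=c^{\mathrm{in}}_i+\int_0^t\sum_{j=1}^4Q_{j,i}(c(s))\,ds$. *)

theory Defs
  imports "HOL-Analysis.Analysis"
begin

text \<open>
  A rate \<open>a p q k\<close> is only meaningful for \<open>p \<ge> 1\<close> and \<open>1 \<le> k \<le> p\<close>; values outside this
  range are unconstrained and never used.
\<close>

type_synonym rates = "nat \<Rightarrow> nat \<Rightarrow> nat \<Rightarrow> real"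

definition rate_coefficients :: "rates \<Rightarrow> bool" where
  "rate_coefficients a \<longleftrightarrow>
     (\<forall>p q k. 1 \<le> k \<and> k \<le> p \<longrightarrow> 0 \<le> a p q k) \<and>
     (\<forall>p\<ge>1. a p 0 p = 0) \<and>
     (\<forall>j\<ge>1. \<forall>k\<ge>1. a k j k = a j k j) \<and>
     (\<forall>i\<ge>1. \<forall>k. 1 \<le> k \<and> k \<le> i - 1 \<longrightarrow> a i 0 k = a i 0 (i - k))"

text \<open>Real powers with the convention \<open>0\<^sup>0 = 1\<close>, which differs from \<open>0 powr 0 = 0\<close>.\<close>

definition rpow :: "real \<Rightarrow> real \<Rightarrow> real" where
  "rpow x \<alpha> = (if x = 0 \<and> \<alpha> = 0 then 1 else x powr \<alpha>)"

definition X01 :: "(nat \<Rightarrow> real) set" where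
  "X01 = {c. summable (\<lambda>i. real (1 + i) * \<bar>c i\<bar>)}"

definition X01_nonneg :: "(nat \<Rightarrow> real) set" where
  "X01_nonneg = {c \<in> X01. \<forall>i. 0 \<le> c i}"

definition Q1 :: "rates \<Rightarrow> nat \<Rightarrow> (nat \<Rightarrow> real) \<Rightarrow> real" where
  "Q1 a i c = (\<Sum>\<^sub>\<infinity>k\<in>{1..}. \<Sum>\<^sub>\<infinity>j\<in>UNIV. a (i + k) j k * c (i + k) * c j)"

definition Q2 :: "rates \<Rightarrow> nat \<Rightarrow> (nat \<Rightarrow> real) \<Rightarrow> real" where
  "Q2 a i c = - (\<Sum>\<^sub>\<infinity>k\<in>{1..}. \<Sum>\<^sub>\<infinity>j\<in>{k..}. a j i k * c j * c i)"

definition Q3 :: "rates \<Rightarrow> nat \<Rightarrow> (nat \<Rightarrow> real) \<Rightarrow> real" where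
  "Q3 a i c = (\<Sum>k=1..i. \<Sum>\<^sub>\<infinity>j\<in>{k..}. a j (i - k) k * c j * c (i - k))"

definition Q4 :: "rates \<Rightarrow> nat \<Rightarrow> (nat \<Rightarrow> real) \<Rightarrow> real" where
  "Q4 a i c = - (\<Sum>k=1..i. \<Sum>\<^sub>\<infinity>j\<in>UNIV. a i j k * c j * c i)"

text \<open>
  Since \<^const>\<open>infsum\<close> is 0 on divergent series, convergence of the inner and outer series in
  \<open>Q1\<close>, ..., \<open>Q4\<close> is recorded separately.  On nonnegative sequences all summands are nonnegative,
  so unconditional summability is ordinary convergence.
\<close>

definition iterated_summable :: "(nat \<Rightarrow> nat \<Rightarrow> real) \<Rightarrow> nat set \<Rightarrow> (nat \<Rightarrow> nat set) \<Rightarrow> bool" where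
  "iterated_summable f K J \<longleftrightarrow>
     (\<forall>k\<in>K. f k summable_on J k) \<and> (\<lambda>k. \<Sum>\<^sub>\<infinity>j\<in>J k. f k j) summable_on K"

datatype dged_case = Isolated | Non_isolated

definition dged_Q :: "dged_case \<Rightarrow> rates \<Rightarrow> nat \<Rightarrow> nat \<Rightarrow> (nat \<Rightarrow> real) \<Rightarrow> real" where
  "dged_Q cs a m i c =
     (if cs = Non_isolated \<and> i = 0 then 0
      else if m = 1 then Q1 a i c
      else if m = 2 then Q2 a i c
      else if m = 3 then Q3 a i c
      else Q4 a i c)"

definition dged_Q_converges :: "dged_case \<Rightarrow> rates \<Rightarrow> nat \<Rightarrow> nat \<Rightarrow> (nat \<Rightarrow> real) \<Rightarrow> bool" where
  "dged_Q_converges cs a m i c \<longleftrightarrow>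
     (if cs = Non_isolated \<and> i = 0 then True
      else if m = 1 then
        iterated_summable (\<lambda>k j. a (i + k) j k * c (i + k) * c j) {1..} (\<lambda>k. UNIV)
      else if m = 2 then
        iterated_summable (\<lambda>k j. a j i k * c j * c i) {1..} (\<lambda>k. {k..})
      else if m = 3 then
        iterated_summable (\<lambda>k j. a j (i - k) k * c j * c (i - k)) {1..i} (\<lambda>k. {k..})
      else
        iterated_summable (\<lambda>k j. a i j k * c j * c i) {1..i} (\<lambda>k. UNIV))"

text \<open>
  The time argument of \<open>c\<close> comes first, so \<open>c t\<close> is the sequence at time \<open>t\<close>; only \<open>0 \<le> t \<le> T\<close>
  matters.  Membership of a \<open>Q\<close> in \<open>L\<^sup>1(0,t)\<close> includes that its defining series converges
  almost everywhere.  The initial value \<open>c 0 = cin\<close> follows from continuity and the integral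
  equation as \<open>t\<close> tends to 0.
\<close>

definition mild_solution ::
  "dged_case \<Rightarrow> rates \<Rightarrow> real \<Rightarrow> (nat \<Rightarrow> real) \<Rightarrow> (real \<Rightarrow> nat \<Rightarrow> real) \<Rightarrow> bool" where
  "mild_solution cs a T cin c \<longleftrightarrow>
     (\<forall>t\<in>{0..T}. c t \<in> X01_nonneg) \<and>
     (\<forall>i. continuous_on {0..T} (\<lambda>t. c t i)) \<and>
     (\<forall>i. \<forall>t\<in>{0<..T}.
        (\<forall>m\<in>{1..4}.
           (AE s in lebesgue. s \<in> {0<..<t} \<longrightarrow> dged_Q_converges cs a m i (c s)) \<and>
           set_integrable lebesgue {0<..<t} (\<lambda>s. dged_Q cs a m i (c s))) \<and>
        c t i = cin i + (LINT s:{0<..<t}|lebesgue. (\<Sum>m=1..4. dged_Q cs a m i (c s))))"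

end

theory Submission
  imports Defs
begin

text \<open>
  With \<open>m = k * (p - k + 1)\<close>, which lies between \<open>p\<close> and \<open>p\<^sup>2\<close>, the rates satisfy
  \<open>a p j k \<le> 2 * C * (1 + j) powr \<alpha> * m powr \<alpha> * q p k\<close>, and the hypothesis on \<open>q\<close> gives
  \<open>\<Sum>k. m powr \<beta> * q p k \<le> \<Q> * p powr \<beta>\<close> for \<open>0 \<le> \<beta> \<le> 1\<close>.  The right-hand side of the system is
  therefore defined on the space with weight \<open>(1 + i) powr (2 * \<alpha>)\<close>, on which sets bounded in
  \<open>X01\<close> have uniformly small tails because \<open>2 * \<alpha> < 1\<close>.

  Two solutions are compared in the norm with weight \<open>(1 + i) powr \<alpha>\<close>.  Testing the weak form with
  this weight times the sign of the difference gives a Gronwall estimate, also in the presence of a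
  small defect.  It yields uniqueness among solutions bounded in \<open>X01\<close>, and it shows that Euler
  polygons of truncated systems, which stay nonnegative and conserve mass exactly, form a Cauchy
  sequence whose limit is a solution.

  Mild solutions are not assumed to be bounded in time.  On an interval where the norm is bounded
  the conserved quantity is constant (test with 1-Lipschitz tents and let them grow); as the norm is
  lower semicontinuous in time, Baire's theorem extends this to the whole interval.
\<close>

section \<open>Derivatives of absolute values, Gronwall and Baire arguments\<close>

text \<open>The vector field loses weight: it maps the \<open>2 * \<alpha>\<close> space into the
  \<open>\<alpha>\<close> space, so a two-sided Lipschitz estimate does not close and a one-sided
  one has to replace it. In a difference of quadratic terms one factor is the difference
  \<open>u\<close>, the other a bounded sum \<open>s\<close>. If \<open>u\<close> sits at the source
  \<open>p\<close>, the outputs summed over \<open>k\<close> are only of order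
  \<open>p powr (2 * \<alpha>)\<close>; but the loss of \<open>u\<close> subtracts
  \<open>wgt \<alpha> p\<close>, and apart from terms in \<open>j\<close> the excess is at most
  \<open>min k (p - k + 1) powr \<alpha>\<close>, comparable to a power of \<open>m / p\<close>,
  which brings the sum back to order \<open>p powr \<alpha>\<close>. If \<open>u\<close> sits at the
  target \<open>j\<close>, its loss reduces \<open>wgt \<alpha> (j + k)\<close> to at most
  \<open>wgt \<alpha> k\<close>, which falls on \<open>p\<close>. Either way the excess weight lands
  on \<open>s\<close>, where \<open>2 * \<alpha> \<le> 1\<close> makes it harmless. Existence needs
  no compactness: truncation level and step size depend only on the prescribed defect and the
  conserved quantity, so one uniform grid reaches time \<open>T\<close>.\<close>

lemma has_integral_sgn_mult_derivative:
  fixes u g :: "real \<Rightarrow> real"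
  assumes "a \<le> b" "finite S" and u: "continuous_on {a..b} u"
    and g: "\<And>t. t \<in> {a<..<b} - S \<Longrightarrow> (u has_real_derivative g t) (at t)"
    and B: "\<And>t. t \<in> {a..b} \<Longrightarrow> \<bar>g t\<bar> \<le> B"
  shows "((\<lambda>t. sgn (u t) * g t) has_integral (\<bar>u b\<bar> - \<bar>u a\<bar>)) {a..b}"
proof -
  define e where "e n = inverse (real (Suc n))" for n
  have e0: "e n > 0" for n by (simp add: e_def)
  have elim: "e \<longlonglongrightarrow> 0" unfolding e_def by (rule LIMSEQ_inverse_real_of_nat)
  \<comment> \<open>A smooth substitute for the absolute value. Its derivative
    \<open>x / N n x\<close> is bounded by 1 and tends to \<open>sgn x\<close> even at 0, so zeros
    of \<open>u\<close> need no separate treatment; \<open>S\<close> is meant for the corners of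
    polygons.\<close>
  define N where "N n x = sqrt (x^2 + (e n)^2)" for n and x :: real
  have pos: "x^2 + (e n)^2 > 0" for n x
    using e0[of n] by (simp add: sum_power2_gt_zero_iff)
  have N0: "N n x > 0" for n x using pos by (simp add: N_def)
  have Nx: "\<bar>x\<bar> \<le> N n x" for n x
    by (simp add: N_def real_le_rsqrt)
  have Nl: "(\<lambda>n. N n x) \<longlonglongrightarrow> \<bar>x\<bar>" for x
  proof -
    have "(\<lambda>n. sqrt (x^2 + (e n)^2)) \<longlonglongrightarrow> sqrt (x^2 + 0^2)"
      by (intro tendsto_intros elim)
    then show ?thesis by (simp add: N_def)
  qed
  show ?thesis
  proof (rule has_integral_dominated_convergence
      [where f = "\<lambda>n t. u t * g t / N n (u t)" and y = "\<lambda>n. N n (u b) - N n (u a)" and h = "\<lambda>_. B"])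
    fix n
    show "((\<lambda>t. u t * g t / N n (u t)) has_integral (N n (u b) - N n (u a))) {a..b}"
    proof (rule fundamental_theorem_of_calculus_interior_strong[OF assms(2,1)])
      show "continuous_on {a..b} (\<lambda>t. N n (u t))"
        unfolding N_def by (intro continuous_intros u)
      fix t assume "t \<in> {a<..<b} - S"
      from g[OF this] have "((\<lambda>t. N n (u t)) has_real_derivative u t * g t / N n (u t)) (at t)"
        unfolding N_def using pos[of "u t" n]
        by (auto intro!: derivative_eq_intros simp: field_simps)
      then show "((\<lambda>t. N n (u t)) has_vector_derivative u t * g t / N n (u t)) (at t)"
        by (simp add: has_real_derivative_iff_has_vector_derivative)
    qed
    show "\<forall>t\<in>{a..b}. norm (u t * g t / N n (u t)) \<le> B"
    proof
      fix t assume t: "t \<in> {a..b}"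
      have "\<bar>u t * g t\<bar> \<le> N n (u t) * B"
        unfolding abs_mult using B[OF t] by (intro mult_mono Nx) (use N0[of n "u t"] in auto)
      then show "norm (u t * g t / N n (u t)) \<le> B"
        using N0[of n "u t"] by (simp add: field_simps)
    qed
  next
    show "\<forall>t\<in>{a..b}. (\<lambda>n. u t * g t / N n (u t)) \<longlonglongrightarrow> sgn (u t) * g t"
    proof
      fix t
      show "(\<lambda>n. u t * g t / N n (u t)) \<longlonglongrightarrow> sgn (u t) * g t"
      proof (cases "u t = 0")
        case False
        then have "(\<lambda>n. u t * g t / N n (u t)) \<longlonglongrightarrow> u t * g t / \<bar>u t\<bar>"
          by (intro tendsto_intros Nl) auto
        then show ?thesis using False by (simp add: sgn_div_norm field_simps)
      qed simp
    qed
    show "(\<lambda>n. N n (u b) - N n (u a)) \<longlonglongrightarrow> \<bar>u b\<bar> - \<bar>u a\<bar>"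
      by (intro tendsto_intros Nl)
  qed (auto intro: integrable_on_const)
qed

lemma gronwall_integral:
  fixes E :: "real \<Rightarrow> real"
  assumes "a \<le> b" and E: "continuous_on {a..b} E" and "0 \<le> K" "0 \<le> e"
    and le: "\<And>t. t \<in> {a..b} \<Longrightarrow> E t \<le> A + integral {a..t} (\<lambda>s. e + K * E s)"
  shows "E b \<le> (A + e * (b - a)) * exp (K * (b - a))"
proof -
  define G where "G t = A + integral {a..t} (\<lambda>s. e + K * E s)" for t
  \<comment> \<open>\<open>E\<close> is only continuous, so the differential argument runs on its
    majorant \<open>G\<close>. Subtracting \<open>e * (t - a)\<close> absorbs the constant term
    because the exponential factor is at most 1.\<close>
  define H where "H t = G t * exp (- K * (t - a)) - e * (t - a)" for t
  have G: "(G has_real_derivative e + K * E t) (at t within {a..b})" if "t \<in> {a..b}" for t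
  proof -
    have "continuous_on {a..b} (\<lambda>s. e + K * E s)" by (intro continuous_intros E)
    from integral_has_vector_derivative[OF this that]
    have "((\<lambda>u. integral {a..u} (\<lambda>s. e + K * E s)) has_real_derivative e + K * E t) (at t within {a..b})"
      by (simp add: has_real_derivative_iff_has_vector_derivative)
    then show ?thesis unfolding G_def by (auto intro!: derivative_eq_intros)
  qed
  have H: "(H has_real_derivative (e + K * E t) * exp (- K * (t - a)) - G t * K * exp (- K * (t - a)) - e)
      (at t within {a..b})" if "t \<in> {a..b}" for t
    unfolding H_def by (rule derivative_eq_intros G that refl)+ (simp add: algebra_simps)
  have neg: "(e + K * E t) * exp (- K * (t - a)) - G t * K * exp (- K * (t - a)) - e \<le> 0"
    if "t \<in> {a..b}" for t
  proof -
    have "K * E t \<le> K * G t" using le[OF that] \<open>0 \<le> K\<close> by (auto simp: G_def intro: mult_left_mono)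
    then have "(e + K * E t - G t * K) * exp (- K * (t - a)) \<le> e * exp (- K * (t - a))"
      by (intro mult_right_mono) (auto simp: mult.commute)
    also have "\<dots> \<le> e * 1"
      using \<open>0 \<le> K\<close> \<open>0 \<le> e\<close> that by (intro mult_left_mono) auto
    finally show ?thesis by (simp add: algebra_simps)
  qed
  have "H b \<le> H a"
  proof (rule DERIV_nonpos_imp_decreasing_open[OF \<open>a \<le> b\<close>])
    show "continuous_on {a..b} H"
      unfolding continuous_on_eq_continuous_within using DERIV_continuous[OF H] by blast
    fix t assume "a < t" "t < b"
    then have "at t within {a..b} = at t" by (simp add: at_within_Icc_at)
    with H[of t] neg[of t] \<open>a < t\<close> \<open>t < b\<close>
    show "\<exists>y. (H has_real_derivative y) (at t) \<and> y \<le> 0" by auto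
  qed
  then have "G b * exp (- K * (b - a)) \<le> A + e * (b - a)"
    by (simp add: H_def G_def)
  then have "G b * exp (- K * (b - a)) * exp (K * (b - a)) \<le> (A + e * (b - a)) * exp (K * (b - a))"
    by (intro mult_right_mono) auto
  then have "G b \<le> (A + e * (b - a)) * exp (K * (b - a))"
    by (simp add: mult.assoc flip: exp_add)
  with le[of b] \<open>a \<le> b\<close> show ?thesis by (simp add: G_def)
qed

lemma locally_bounded_imp_bounded_Icc:
  fixes V :: "real \<Rightarrow> real"
  assumes "a \<le> b"
    and loc: "\<And>x. x \<in> {a..b} \<Longrightarrow> \<exists>d>0. \<exists>M. \<forall>t\<in>{a..b}. \<bar>t - x\<bar> < d \<longrightarrow> V t \<le> M"
  shows "\<exists>M. \<forall>t\<in>{a..b}. V t \<le> M"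
proof -
  \<comment> \<open>Bisection quantifies over all small intervals around a point, also those leaving
    \<open>{a..b}\<close>; hence the intersection.\<close>
  have "\<exists>M. \<forall>t\<in>{a..b}\<inter>{a..b}. V t \<le> M"
    using \<open>a \<le> b\<close>
  proof (induction rule: Bolzano[where P = "\<lambda>x y. \<exists>M. \<forall>t\<in>{x..y}\<inter>{a..b}. V t \<le> M"])
    case (trans x y z)
    then obtain M M' where "\<forall>t\<in>{x..y}\<inter>{a..b}. V t \<le> M" "\<forall>t\<in>{y..z}\<inter>{a..b}. V t \<le> M'" by auto
    then have "\<forall>t\<in>{x..z}\<inter>{a..b}. V t \<le> max M M'"
      by (metis IntD1 IntD2 IntI atLeastAtMost_iff le_max_iff_disj linear)
    then show ?case ..
  next
    case (local x)
    then obtain d M where d: "d > 0" "\<forall>t\<in>{a..b}. \<bar>t - x\<bar> < d \<longrightarrow> V t \<le> M" using loc[of x] by auto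
    show ?case
    proof (intro exI conjI allI impI)
      fix y z assume "y \<le> x \<and> x \<le> z \<and> z - y < d"
      then show "\<forall>t\<in>{y..z} \<inter> {a..b}. V t \<le> M" using d by auto
    qed (fact d)
  qed
  then show ?thesis by simp
qed

text \<open>
  Baire's theorem, applied to the closed set of times near which \<open>V\<close> is unbounded, gives an open
  interval on which \<open>V\<close> is bounded along that set; constancy on the complementary intervals then
  propagates the bound to the whole interval.
\<close>

lemma lsc_conserved_imp_constant:
  fixes V :: "real \<Rightarrow> real"
  assumes "a \<le> b"
    and lsc: "\<And>M. closed {t \<in> {a..b}. V t \<le> M}"
    and cons: "\<And>s t M. a \<le> s \<Longrightarrow> s \<le> t \<Longrightarrow> t \<le> b \<Longrightarrow> (\<And>r. r \<in> {s..t} \<Longrightarrow> V r \<le> M) \<Longrightarrow> V s = V t"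
    and t: "t \<in> {a..b}"
  shows "V t = V a"
proof -
  define good where "good x \<longleftrightarrow> (\<exists>d>0. \<exists>M. \<forall>t\<in>{a..b}. \<bar>t - x\<bar> < d \<longrightarrow> V t \<le> M)" for x
  define B where "B = {x\<in>{a..b}. \<not> good x}"
  have "open {x. good x}"
  proof (rule openI)
    fix x assume "x \<in> {x. good x}"
    then obtain d M where d: "d > 0" "\<forall>t\<in>{a..b}. \<bar>t - x\<bar> < d \<longrightarrow> V t \<le> M" by (auto simp: good_def)
    have "ball x (d/2) \<subseteq> {x. good x}"
    proof
      fix y assume "y \<in> ball x (d/2)"
      then have y: "\<bar>y - x\<bar> < d/2" by (auto simp: dist_real_def abs_minus_commute)
      have "V t \<le> M" if "t \<in> {a..b}" "\<bar>t - y\<bar> < d/2" for t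
      proof -
        have "\<bar>t - x\<bar> < d" using y that by linarith
        with d that show ?thesis by blast
      qed
      then show "y \<in> {x. good x}" using d(1) unfolding good_def
        by (intro CollectI exI[of _ "d/2"] conjI exI[of _ M]) auto
    qed
    then show "\<exists>e>0. ball x e \<subseteq> {x. good x}" using d(1) by (auto intro!: exI[of _ "d/2"])
  qed
  then have "closed ({a..b} \<inter> - {x. good x})" by (intro closed_Int) (auto simp: closed_def)
  moreover have "{a..b} \<inter> - {x. good x} = B" by (auto simp: B_def)
  ultimately have clB: "closed B" by simp
  have bdd: "\<exists>M. \<forall>r\<in>{s..u}. V r \<le> M" if "a \<le> s" "s \<le> u" "u \<le> b" "\<And>r. r \<in> {s..u} \<Longrightarrow> good r" for s u
  proof (rule locally_bounded_imp_bounded_Icc[OF \<open>s \<le> u\<close>])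
    fix x assume "x \<in> {s..u}"
    with that(4) obtain d M where "d > 0" "\<forall>t\<in>{a..b}. \<bar>t - x\<bar> < d \<longrightarrow> V t \<le> M"
      unfolding good_def by blast
    then show "\<exists>d>0. \<exists>M. \<forall>t\<in>{s..u}. \<bar>t - x\<bar> < d \<longrightarrow> V t \<le> M"
      using that(1,3) by (intro exI[of _ d] conjI exI[of _ M]) auto
  qed
  have "B = {}"
  proof (rule ccontr)
    assume ne: "B \<noteq> {}"
    \<comment> \<open>Relatively open subsets of \<open>B\<close> with empty intersection: by Baire
      one of them is not dense, so \<open>V\<close> is at most \<open>n\<close> on \<open>B\<close>
      near some point \<open>x\<close> of \<open>B\<close>.\<close>
    define \<G> where "\<G> = range (\<lambda>n::nat. B - {t\<in>{a..b}. V t \<le> real n})"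
    have "\<exists>n::nat. \<not> B \<subseteq> closure (B - {t\<in>{a..b}. V t \<le> real n})"
    proof (rule ccontr)
      assume no: "\<not> ?thesis"
      have "B \<subseteq> closure (\<Inter>\<G>)"
      proof (rule Baire[OF clB])
        show "countable \<G>" by (simp add: \<G>_def)
        fix X assume "X \<in> \<G>"
        then obtain n where X: "X = B - {t\<in>{a..b}. V t \<le> real n}" by (auto simp: \<G>_def)
        have "openin (top_of_set B) (B - {t\<in>{a..b}. V t \<le> real n})"
          using lsc[of "real n"] unfolding Diff_eq by (intro openin_open_Int) (simp only: open_Compl)
        then show "openin (top_of_set B) X \<and> B \<subseteq> closure X" using no X by auto
      qed
      moreover have "\<Inter>\<G> = {}"
      proof -
        { fix x assume x: "x \<in> \<Inter>\<G>"
          obtain n :: nat where "V x \<le> real n" using real_arch_simple by blast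
          moreover have "x \<in> B - {t\<in>{a..b}. V t \<le> real n}" using x by (auto simp: \<G>_def)
          ultimately have False by (auto simp: B_def) }
        then show ?thesis by auto
      qed
      ultimately show False using ne by simp
    qed
    then obtain n :: nat and x where x: "x \<in> B" "x \<notin> closure (B - {t\<in>{a..b}. V t \<le> real n})" by auto
    from x(2) obtain d where d: "d > 0" "\<And>y. y \<in> B - {t\<in>{a..b}. V t \<le> real n} \<Longrightarrow> \<not> dist y x < d"
      unfolding closure_approachable by auto
    have dB: "V y \<le> real n" if "y \<in> B" "\<bar>y - x\<bar> < d" for y
      using d(2)[of y] that by (auto simp: B_def dist_real_def)
    have xab: "x \<in> {a..b}" using x by (auto simp: B_def)
    \<comment> \<open>A base point independent of \<open>t\<close>, so that
      \<open>max (real n) (V l)\<close> serves for all \<open>t\<close> near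
      \<open>x\<close>.\<close>
    define l where "l = max a (x - d/2)"
    have "good x" unfolding good_def
    proof (intro exI conjI ballI impI)
      show "d/2 > 0" using d by simp
      fix t assume t: "t \<in> {a..b}" "\<bar>t - x\<bar> < d/2"
      have lt: "l \<le> t" "a \<le> l" using t unfolding l_def abs_less_iff atLeastAtMost_iff by linarith+
      \<comment> \<open>Its supremum \<open>s\<close> is the last point of \<open>B\<close> up to
        \<open>t\<close>, or \<open>l\<close> if there is none: \<open>V s\<close> is under control,
        and every time after \<open>s\<close> up to \<open>t\<close> is good.\<close>
      define S where "S = insert l (B \<inter> {l..t})"
      have S: "closed S" "S \<noteq> {}" "bdd_above S"
        using clB lt by (auto simp: S_def intro!: closed_insert closed_Int bdd_aboveI[of _ t])
      define s where "s = Sup S"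
      have sS: "s \<in> S" unfolding s_def by (rule closed_contains_Sup[OF S(2,3,1)])
      then have s: "l \<le> s" "s \<le> t" using lt by (auto simp: S_def)
      have Vs: "V s \<le> max (real n) (V l)"
      proof (cases "s = l")
        case False
        then have "s \<in> B" "l \<le> s" "s \<le> t" using sS by (auto simp: S_def)
        moreover have "x - d/2 \<le> l" by (simp add: l_def)
        ultimately have "\<bar>s - x\<bar> < d" using t d(1) by linarith
        with dB[of s] \<open>s \<in> B\<close> show ?thesis by simp
      qed simp
      have gd: "good r" if "s < r" "r \<le> t" for r
      proof (rule ccontr)
        assume "\<not> good r"
        then have "r \<in> S" using that s t lt by (auto simp: S_def B_def)
        then have "r \<le> s" unfolding s_def using S by (intro cSup_upper)
        with that show False by simp
      qed
      have eq: "V r = V t" if "s < r" "r \<le> t" for r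
      proof -
        have r: "a \<le> r" "r \<le> t" "t \<le> b" using that s lt t by auto
        have "\<exists>M. \<forall>u\<in>{r..t}. V u \<le> M" using that by (intro bdd r gd) auto
        then show ?thesis using cons[OF r] by blast
      qed
      \<comment> \<open>On \<open>{s..t}\<close> the function takes at most the two values
        \<open>V s\<close> and \<open>V t\<close>, so it is bounded there although \<open>s\<close>
        itself may be bad.\<close>
      have "V s = V t"
      proof (rule cons[of _ _ "max (V s) (V t)"])
        fix r assume "r \<in> {s..t}"
        then show "V r \<le> max (V s) (V t)" using eq[of r] by (cases "r = s") auto
      qed (use s lt t in auto)
      with Vs show "V t \<le> max (real n) (V l)" by simp
    qed
    with x(1) show False by (simp add: B_def)
  qed
  then have "\<And>x. x \<in> {a..b} \<Longrightarrow> good x" by (auto simp: B_def)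
  then obtain M where "\<forall>r\<in>{a..t}. V r \<le> M" using bdd[of a t] t by auto
  then show ?thesis using cons[of a t M] t by auto
qed

section \<open>Dominated convergence for unconditional sums\<close>

lemma summable_on_dominated:
  fixes f :: "'a \<Rightarrow> real"
  assumes "M summable_on A" and "\<And>x. x \<in> A \<Longrightarrow> \<bar>f x\<bar> \<le> M x"
  shows "f summable_on A"
  using summable_on_comparison_test[OF assms(1), of "\<lambda>x. \<bar>f x\<bar>"] assms(2)
  by (simp add: summable_on_iff_abs_summable_on_real[of f])

lemma tendsto_infsum_dominated:
  fixes f :: "'b \<Rightarrow> 'a \<Rightarrow> real"
  assumes lim: "\<And>x. x \<in> A \<Longrightarrow> ((\<lambda>n. f n x) \<longlongrightarrow> g x) F"
    and le: "\<And>n x. x \<in> A \<Longrightarrow> \<bar>f n x\<bar> \<le> M x" and M: "M summable_on A"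
  shows "((\<lambda>n. infsum (f n) A) \<longlongrightarrow> infsum g A) F"
proof (cases "F = bot")
  case False
  have M0: "0 \<le> M x" if "x \<in> A" for x using le[OF that] abs_ge_zero order.trans by blast
  have gM: "\<bar>g x\<bar> \<le> M x" if "x \<in> A" for x
    using tendsto_rabs[OF lim[OF that]] le[OF that] by (intro tendsto_upperbound[OF _ _ False]) auto
  have fs: "f n summable_on A" for n
    using le by (intro summable_on_dominated[OF M]) auto
  have gs: "g summable_on A"
    using gM by (intro summable_on_dominated[OF M]) auto
  show ?thesis
  proof (rule tendstoI)
    fix e :: real assume e: "e > 0"
    \<comment> \<open>Outside \<open>X\<close> the majorant, and with it every \<open>f n\<close>
      and \<open>g\<close>, sums to at most \<open>e/4\<close>; the two tails leave
      \<open>e/2\<close> for the finite sum.\<close>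
    obtain X where X: "finite X" "X \<subseteq> A" "dist (sum M X) (infsum M A) \<le> e/4"
      using infsum_finite_approximation[OF M, of "e/4"] e by auto
    have split: "infsum h A = sum h X + infsum h (A - X)" if "h summable_on A" for h :: "'a \<Rightarrow> real"
    proof -
      have "infsum h (X \<union> (A - X)) = infsum h X + infsum h (A - X)"
        using that X by (intro infsum_Un_disjoint summable_on_subset[OF that]) auto
      then show ?thesis using X by (simp add: Un_absorb1)
    qed
    have tailM: "infsum M (A - X) \<le> e/4"
      using X(3) split[OF M] by (simp add: dist_real_def)
    have tail: "\<bar>infsum h (A - X)\<bar> \<le> e/4" if h: "\<And>x. x \<in> A \<Longrightarrow> \<bar>h x\<bar> \<le> M x" for h
    proof -
      have "norm (infsum h (A - X)) \<le> infsum M (A - X)"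
      proof (rule norm_infsum_le)
        have "M summable_on A - X" using M by (rule summable_on_subset) auto
        then show "(M has_sum infsum M (A - X)) (A - X)" by simp
        have "h summable_on A - X"
          using h by (intro summable_on_dominated[OF \<open>M summable_on A - X\<close>]) auto
        then show "(h has_sum infsum h (A - X)) (A - X)" by simp
      qed (use h in auto)
      with tailM show ?thesis by simp
    qed
    have "((\<lambda>n. sum (f n) X) \<longlongrightarrow> sum g X) F"
      using X lim by (intro tendsto_sum) auto
    then have "\<forall>\<^sub>F n in F. dist (sum (f n) X) (sum g X) < e/2"
      using e by (intro tendstoD) auto
    then show "\<forall>\<^sub>F n in F. dist (infsum (f n) A) (infsum g A) < e"
    proof eventually_elim
      case (elim n)
      have "\<bar>infsum (f n) (A - X)\<bar> \<le> e/4" "\<bar>infsum g (A - X)\<bar> \<le> e/4"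
        using le gM by (blast intro: tail)+
      with elim show ?case
        unfolding split[OF fs] split[OF gs] dist_real_def by linarith
    qed
  qed
qed simp

section \<open>Weighted sequence spaces\<close>

text \<open>The shift by one keeps the weight at least 1 at size 0 for nonnegative exponents, and
  \<open>wgt 1\<close> is the weight of \<open>X01\<close>.\<close>

definition wgt :: "real \<Rightarrow> nat \<Rightarrow> real" where
  "wgt \<beta> i = (1 + real i) powr \<beta>"

lemma wgt_nonneg: "0 \<le> wgt \<beta> i"
  by (simp add: wgt_def)

lemma wgt_ge_one: "0 \<le> \<beta> \<Longrightarrow> 1 \<le> wgt \<beta> i"
  by (simp add: wgt_def ge_one_powr_ge_zero)

lemma wgt_one: "wgt 1 i = 1 + real i"
  by (simp add: wgt_def)

lemma wgt_mono: "\<beta> \<le> \<gamma> \<Longrightarrow> wgt \<beta> i \<le> wgt \<gamma> i"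
  by (simp add: wgt_def powr_mono)

lemma wgt_mono_arg: "0 \<le> \<beta> \<Longrightarrow> i \<le> j \<Longrightarrow> wgt \<beta> i \<le> wgt \<beta> j"
  by (simp add: wgt_def powr_mono2)

lemma wgt_mult: "wgt \<beta> i * wgt \<gamma> i = wgt (\<beta> + \<gamma>) i"
  by (simp add: wgt_def powr_add)

text \<open>Split off one factor \<open>x + y\<close>; the remaining exponent
  \<open>\<beta> - 1\<close> is nonpositive, so replacing \<open>x + y\<close> by either summand
  only increases the power.\<close>

lemma powr_subadditive:
  fixes x y \<beta> :: real
  assumes "0 < x" "0 < y" "0 \<le> \<beta>" "\<beta> \<le> 1"
  shows "(x + y) powr \<beta> \<le> x powr \<beta> + y powr \<beta>"
proof -
  have *: "z * (x + y) powr (\<beta> - 1) \<le> z powr \<beta>" if "0 < z" "z \<le> x + y" for z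
  proof -
    have "z * (x + y) powr (\<beta> - 1) \<le> z * z powr (\<beta> - 1)"
      using that assms by (intro mult_left_mono powr_mono2') auto
    also have "\<dots> = z powr \<beta>" using that by (simp add: powr_mult_base)
    finally show ?thesis .
  qed
  have "(x + y) powr \<beta> = x * (x + y) powr (\<beta> - 1) + y * (x + y) powr (\<beta> - 1)"
    using assms powr_mult_base[of "x + y" "\<beta> - 1"] by (simp add: algebra_simps)
  also have "\<dots> \<le> x powr \<beta> + y powr \<beta>"
    using assms by (intro add_mono *) auto
  finally show ?thesis .
qed

section \<open>Sums over reactions\<close>

definition Rx :: "((nat \<times> nat) \<times> nat) set" where
  "Rx = (SIGMA pj:UNIV. {1..fst pj})"

lemma Rx_iff: "((p, j), k) \<in> Rx \<longleftrightarrow> 1 \<le> k \<and> k \<le> p"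
  by (simp add: Rx_def)

text \<open>Kernel bounds come as finite sums over \<open>k\<close> dominated by a product of a
  function of \<open>p\<close> and one of \<open>j\<close>. The nesting of the triple makes
  \<open>k\<close> the fibre variable, so that Tonelli applies directly.\<close>

lemma summable_on_Rx:
  fixes f :: "(nat \<times> nat) \<times> nat \<Rightarrow> real" and X Y :: "nat \<Rightarrow> real"
  assumes f0: "\<And>p j k. 1 \<le> k \<Longrightarrow> k \<le> p \<Longrightarrow> 0 \<le> f ((p, j), k)"
    and le: "\<And>p j. (\<Sum>k=1..p. f ((p, j), k)) \<le> X p * Y j"
    and X: "X summable_on UNIV" "\<And>p. 0 \<le> X p" and Y: "Y summable_on UNIV" "\<And>j. 0 \<le> Y j"
  shows "f summable_on Rx" "infsum f Rx \<le> infsum X UNIV * infsum Y UNIV"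
proof -
  have inner: "((\<lambda>j. X p * Y j) has_sum (X p * infsum Y UNIV)) UNIV" for p
    using Y by (intro has_sum_cmult_right) auto
  have XYs: "(\<lambda>(p, j). X p * Y j) summable_on (UNIV \<times> UNIV)"
  proof (rule summable_on_SigmaI)
    show "((\<lambda>j. (case (p, j) of (p, j) \<Rightarrow> X p * Y j)) has_sum (X p * infsum Y UNIV)) UNIV" for p
      using inner by simp
    show "(\<lambda>p. X p * infsum Y UNIV) summable_on UNIV"
      using X by (intro summable_on_cmult_left)
  qed (use X Y in auto)
  have XY: "((\<lambda>(p, j). X p * Y j) has_sum (infsum X UNIV * infsum Y UNIV)) (UNIV \<times> UNIV)"
  proof (rule has_sum_SigmaI[OF _ _ XYs])
    show "((\<lambda>j. (case (p, j) of (p, j) \<Rightarrow> X p * Y j)) has_sum (X p * infsum Y UNIV)) UNIV" for p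
      using inner by simp
    show "((\<lambda>p. X p * infsum Y UNIV) has_sum (infsum X UNIV * infsum Y UNIV)) UNIV"
      using X by (intro has_sum_cmult_left) auto
  qed
  define S where "S pj = (\<Sum>k=1..fst pj. f (pj, k))" for pj
  have SXY: "S pj \<le> (case pj of (p, j) \<Rightarrow> X p * Y j)" for pj
    using le by (cases pj) (auto simp: S_def)
  have fin: "((\<lambda>k. f (pj, k)) has_sum S pj) {1..fst pj}" for pj
    unfolding S_def by (intro has_sum_finite) auto
  have Ss: "S summable_on UNIV"
  proof (rule summable_on_comparison_test)
    show "(\<lambda>(p, j). X p * Y j) summable_on UNIV" using XYs by simp
    show "0 \<le> S pj" for pj
      unfolding S_def using f0[of _ "fst pj" "snd pj"] by (auto intro!: sum_nonneg)
  qed (rule SXY)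
  show fs: "f summable_on Rx"
    unfolding Rx_def using f0 by (intro summable_on_SigmaI[OF fin Ss]) auto
  have "infsum f Rx = infsum S UNIV"
    using has_sum_Sigma'[OF has_sum_infsum[OF fs[unfolded Rx_def]] fin]
    by (simp add: Rx_def infsumI)
  also have "\<dots> \<le> infsum (\<lambda>(p, j). X p * Y j) UNIV"
    using XYs SXY by (intro infsum_mono Ss) auto
  also have "\<dots> = infsum X UNIV * infsum Y UNIV"
    using XY by (simp add: infsumI)
  finally show "infsum f Rx \<le> infsum X UNIV * infsum Y UNIV" .
qed

text \<open>Bridge between the iterated series defining the collision terms and sums over sets of
  reactions.\<close>

lemma iterated_summable_Sigma:
  assumes "(\<lambda>(k, j). f k j) summable_on (Sigma K J)"
  shows "iterated_summable f K J"
    and "(\<Sum>\<^sub>\<infinity>k\<in>K. \<Sum>\<^sub>\<infinity>j\<in>J k. f k j) = (\<Sum>\<^sub>\<infinity>(k, j)\<in>Sigma K J. f k j)"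
proof -
  have "((\<lambda>k. \<Sum>\<^sub>\<infinity>j\<in>J k. f k j) has_sum (\<Sum>\<^sub>\<infinity>(k, j)\<in>Sigma K J. f k j)) K"
  proof (rule has_sum_Sigma'[OF has_sum_infsum[OF assms]])
    fix k assume "k \<in> K"
    then have "f k summable_on J k" using assms by (intro summable_on_SigmaD1[where A=K and B=J])
    then show "((\<lambda>j. case (k, j) of (k, j) \<Rightarrow> f k j) has_sum (\<Sum>\<^sub>\<infinity>j\<in>J k. f k j)) (J k)" by simp
  qed
  then show "iterated_summable f K J"
    "(\<Sum>\<^sub>\<infinity>k\<in>K. \<Sum>\<^sub>\<infinity>j\<in>J k. f k j) = (\<Sum>\<^sub>\<infinity>(k, j)\<in>Sigma K J. f k j)"
    unfolding iterated_summable_def using summable_on_SigmaD1[OF assms]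
    by (auto simp: infsumI dest: has_sum_imp_summable)
qed

section \<open>Weighted norms and their tails\<close>

definition wnorm :: "real \<Rightarrow> (nat \<Rightarrow> real) \<Rightarrow> real" where
  "wnorm \<beta> x = (\<Sum>\<^sub>\<infinity>i. wgt \<beta> i * \<bar>x i\<bar>)"

text \<open>\<open>wnorm\<close> takes the value 0 on divergent series, so finiteness has to be
  carried as a separate predicate.\<close>

definition wsummable :: "real \<Rightarrow> (nat \<Rightarrow> real) \<Rightarrow> bool" where
  "wsummable \<beta> x \<longleftrightarrow> (\<lambda>i. wgt \<beta> i * \<bar>x i\<bar>) summable_on UNIV"

lemma wnorm_nonneg: "0 \<le> wnorm \<beta> x"
  unfolding wnorm_def by (intro infsum_nonneg mult_nonneg_nonneg wgt_nonneg) auto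

lemma wsummable_mono: "wsummable \<gamma> x \<Longrightarrow> \<beta> \<le> \<gamma> \<Longrightarrow> wsummable \<beta> x"
  unfolding wsummable_def
  by (erule summable_on_dominated) (auto simp: wgt_nonneg abs_mult intro!: mult_right_mono wgt_mono)

lemma wnorm_mono: "wsummable \<gamma> x \<Longrightarrow> \<beta> \<le> \<gamma> \<Longrightarrow> wnorm \<beta> x \<le> wnorm \<gamma> x"
  using wsummable_mono[of \<gamma> x \<beta>] unfolding wnorm_def wsummable_def
  by (intro infsum_mono mult_right_mono wgt_mono) auto

lemma wsummable_add:
  assumes "wsummable \<beta> x" "wsummable \<beta> y"
  shows "wsummable \<beta> (\<lambda>i. x i + y i)" "wnorm \<beta> (\<lambda>i. x i + y i) \<le> wnorm \<beta> x + wnorm \<beta> y"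
proof -
  have le: "wgt \<beta> i * \<bar>x i + y i\<bar> \<le> wgt \<beta> i * \<bar>x i\<bar> + wgt \<beta> i * \<bar>y i\<bar>" for i
    unfolding distrib_left[symmetric] by (intro mult_left_mono wgt_nonneg abs_triangle_ineq)
  have s: "(\<lambda>i. wgt \<beta> i * \<bar>x i\<bar> + wgt \<beta> i * \<bar>y i\<bar>) summable_on UNIV"
    using assms unfolding wsummable_def by (intro summable_on_add)
  show 1: "wsummable \<beta> (\<lambda>i. x i + y i)"
    unfolding wsummable_def using le by (intro summable_on_dominated[OF s]) (auto simp: wgt_nonneg abs_mult)
  show "wnorm \<beta> (\<lambda>i. x i + y i) \<le> wnorm \<beta> x + wnorm \<beta> y"
    unfolding wnorm_def using assms 1 s le
    by (subst infsum_add[symmetric]) (auto simp: wsummable_def intro!: infsum_mono)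
qed

lemma wsummable_cmult:
  assumes "wsummable \<beta> x"
  shows "wsummable \<beta> (\<lambda>i. r * x i)" "wnorm \<beta> (\<lambda>i. r * x i) = \<bar>r\<bar> * wnorm \<beta> x"
proof -
  have eq: "wgt \<beta> i * \<bar>r * x i\<bar> = \<bar>r\<bar> * (wgt \<beta> i * \<bar>x i\<bar>)" for i by (simp add: abs_mult)
  show "wsummable \<beta> (\<lambda>i. r * x i)" "wnorm \<beta> (\<lambda>i. r * x i) = \<bar>r\<bar> * wnorm \<beta> x"
    using assms unfolding wsummable_def wnorm_def eq
    by (auto intro: summable_on_cmult_right infsum_cmult_right)
qed

lemma wsummable_diff:
  assumes "wsummable \<beta> x" "wsummable \<beta> y"
  shows "wsummable \<beta> (\<lambda>i. x i - y i)" "wnorm \<beta> (\<lambda>i. x i - y i) \<le> wnorm \<beta> x + wnorm \<beta> y"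
  using wsummable_add[OF assms(1) wsummable_cmult(1)[OF assms(2), of "-1"]]
    wsummable_cmult(2)[OF assms(2), of "-1"] by auto

lemma wnorm_dominated:
  assumes "wsummable \<beta> y" "\<And>i. \<bar>x i\<bar> \<le> \<bar>y i\<bar>"
  shows "wsummable \<beta> x" "wnorm \<beta> x \<le> wnorm \<beta> y"
proof -
  have le: "wgt \<beta> i * \<bar>x i\<bar> \<le> wgt \<beta> i * \<bar>y i\<bar>" for i
    using assms by (intro mult_left_mono wgt_nonneg)
  show 1: "wsummable \<beta> x"
    using assms(1) le unfolding wsummable_def
    by (elim summable_on_dominated) (auto simp: wgt_nonneg abs_mult)
  show "wnorm \<beta> x \<le> wnorm \<beta> y"
    using 1 assms(1) le unfolding wsummable_def wnorm_def by (intro infsum_mono)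
qed

lemma component_le_wnorm:
  assumes "wsummable \<beta> x" "0 \<le> \<beta>"
  shows "\<bar>x i\<bar> \<le> wnorm \<beta> x"
proof -
  have "\<bar>x i\<bar> \<le> wgt \<beta> i * \<bar>x i\<bar>" using wgt_ge_one[OF assms(2), of i] by (simp add: mult_le_cancel_right1)
  also have "\<dots> = (\<Sum>i\<in>{i}. wgt \<beta> i * \<bar>x i\<bar>)" by simp
  also have "\<dots> \<le> wnorm \<beta> x"
    unfolding wnorm_def using assms(1)
    by (intro finite_sum_le_infsum) (auto simp: wsummable_def wgt_nonneg)
  finally show ?thesis .
qed

text \<open>Trades weight for smallness: \<open>wgt \<beta>\<close> is \<open>wgt 1\<close> times
  \<open>wgt (\<beta> - 1)\<close>, and the latter decreases in the index.\<close>

lemma wnorm_tail: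
  assumes "wsummable 1 x" "\<beta> < 1" "\<And>i. i < n \<Longrightarrow> x i = 0"
  shows "wnorm \<beta> x \<le> wgt (\<beta> - 1) n * wnorm 1 x"
proof -
  have "wgt \<beta> i * \<bar>x i\<bar> \<le> wgt (\<beta> - 1) n * (wgt 1 i * \<bar>x i\<bar>)" for i
  proof (cases "i < n")
    case False
    then have "wgt (\<beta> - 1) i \<le> wgt (\<beta> - 1) n"
      unfolding wgt_def using assms(2) by (intro powr_mono2') auto
    then have "wgt (\<beta> - 1) i * (wgt 1 i * \<bar>x i\<bar>) \<le> wgt (\<beta> - 1) n * (wgt 1 i * \<bar>x i\<bar>)"
      by (intro mult_right_mono) (auto simp: wgt_nonneg)
    moreover have "wgt (\<beta> - 1) i * (wgt 1 i * \<bar>x i\<bar>) = wgt \<beta> i * \<bar>x i\<bar>"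
      using wgt_mult[of "\<beta> - 1" i 1] by (simp flip: mult.assoc)
    ultimately show ?thesis by simp
  qed (use assms in auto)
  then have "wnorm \<beta> x \<le> (\<Sum>\<^sub>\<infinity>i. wgt (\<beta> - 1) n * (wgt 1 i * \<bar>x i\<bar>))"
    unfolding wnorm_def using assms wsummable_mono[OF assms(1), of \<beta>]
    by (intro infsum_mono) (auto simp: wsummable_def intro!: summable_on_cmult_right)
  then show ?thesis
    unfolding wnorm_def using assms(1) by (simp add: infsum_cmult_right wsummable_def)
qed

lemma wgt_neg_tendsto: "\<beta> < 0 \<Longrightarrow> wgt \<beta> \<longlonglongrightarrow> 0"
  unfolding wgt_def
  by (rule tendsto_neg_powr)
    (auto intro!: filterlim_tendsto_add_at_top[OF tendsto_const] filterlim_real_sequentially)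

text \<open>A bound in \<open>X01\<close> turns componentwise convergence into norm convergence for
  every weight below 1: finitely many components converge, and the tails are uniformly small by
  \<open>wnorm_tail\<close>.\<close>

lemma wnorm_tendsto:
  assumes lim: "\<And>i. ((\<lambda>n. x n i) \<longlongrightarrow> y i) F"
    and x: "\<forall>\<^sub>F n in F. wsummable 1 (x n) \<and> wnorm 1 (x n) \<le> R"
    and y: "wsummable 1 y" and \<beta>: "\<beta> < 1"
  shows "((\<lambda>n. wnorm \<beta> (\<lambda>i. x n i - y i)) \<longlongrightarrow> 0) F"
proof (rule tendstoI)
  fix e :: real assume e: "e > 0"
  define M where "M = \<bar>R\<bar> + wnorm 1 y + 1"
  have M: "M > 0" using wnorm_nonneg[of 1 y] by (simp add: M_def)
  have "\<forall>\<^sub>F n in sequentially. wgt (\<beta> - 1) n < e / (2 * M)"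
    using order_tendstoD(2)[OF wgt_neg_tendsto[of "\<beta> - 1"], of "e / (2 * M)"] e M \<beta> by auto
  then obtain N where N: "wgt (\<beta> - 1) N < e / (2 * M)"
    by (auto simp: eventually_sequentially)
  have "((\<lambda>n. \<Sum>i<N. wgt \<beta> i * \<bar>x n i - y i\<bar>) \<longlongrightarrow> (\<Sum>i<N. wgt \<beta> i * \<bar>y i - y i\<bar>)) F"
    by (intro tendsto_intros lim)
  then have "\<forall>\<^sub>F n in F. (\<Sum>i<N. wgt \<beta> i * \<bar>x n i - y i\<bar>) < e / 2"
    using e by (intro order_tendstoD) auto
  then show "\<forall>\<^sub>F n in F. dist (wnorm \<beta> (\<lambda>i. x n i - y i)) 0 < e"
    using x
  proof eventually_elim
    case (elim n)
    define u where "u i = x n i - y i" for i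
    define v where "v i = (if i < N then 0 else u i)" for i
    have u: "wsummable 1 u" "wnorm 1 u \<le> M"
      using wsummable_diff[of 1 "x n" y] elim y by (auto simp: u_def[abs_def] M_def)
    have v: "wsummable 1 v" "wnorm 1 v \<le> wnorm 1 u"
      using wnorm_dominated[OF u(1), of v] by (auto simp: v_def)
    have us: "(\<lambda>i. wgt \<beta> i * \<bar>u i\<bar>) summable_on UNIV"
      using wsummable_mono[OF u(1), of \<beta>] \<beta> by (simp add: wsummable_def)
    have "wnorm \<beta> u = infsum (\<lambda>i. wgt \<beta> i * \<bar>u i\<bar>) ({..<N} \<union> - {..<N})"
      by (simp only: wnorm_def Compl_partition)
    also have "\<dots> = (\<Sum>i<N. wgt \<beta> i * \<bar>u i\<bar>) + infsum (\<lambda>i. wgt \<beta> i * \<bar>u i\<bar>) (- {..<N})"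
      using us by (subst infsum_Un_disjoint) (auto intro: summable_on_subset)
    also have "infsum (\<lambda>i. wgt \<beta> i * \<bar>u i\<bar>) (- {..<N}) = wnorm \<beta> v"
      unfolding wnorm_def by (intro infsum_cong_neutral) (auto simp: v_def)
    also have "wnorm \<beta> v \<le> wgt (\<beta> - 1) N * wnorm 1 v"
      using \<beta> by (intro wnorm_tail[OF v(1)]) (auto simp: v_def)
    also have "\<dots> \<le> e / (2 * M) * M"
      using N v u M e by (intro mult_mono) (auto simp: wnorm_nonneg)
    also have "\<dots> = e / 2" using M by simp
    finally have "wnorm \<beta> u < e"
      using elim(1) unfolding u_def[symmetric] by linarith
    then show ?case using wnorm_nonneg[of \<beta> u] by (simp add: u_def[abs_def])
  qed
qed

section \<open>Kernel bounds\<close>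

text \<open>The rate bound is put in product form so that \<open>k\<close> enters only through
  \<open>q\<close> and the product \<open>k * (p - k + 1)\<close>, the same product that appears in
  the summation condition on \<open>q\<close>.\<close>

locale dged_kernel =
  fixes a :: rates and q :: "nat \<Rightarrow> nat \<Rightarrow> real" and \<alpha> D \<Q> :: real and cs :: dged_case
  assumes a_nonneg: "1 \<le> k \<Longrightarrow> k \<le> p \<Longrightarrow> 0 \<le> a p j k"
    and \<alpha>: "0 \<le> \<alpha>" "\<alpha> < 1 / 2"
    and D: "0 \<le> D" and \<Q>: "0 \<le> \<Q>"
    and q_nonneg: "1 \<le> k \<Longrightarrow> k \<le> p \<Longrightarrow> 0 \<le> q p k"
    and q_sum: "1 \<le> p \<Longrightarrow> (\<Sum>k=1..p. real k * real (p - k + 1) * q p k) \<le> \<Q> * real p"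
    and a_le: "1 \<le> k \<Longrightarrow> k \<le> p \<Longrightarrow>
      a p j k \<le> D * wgt \<alpha> j * (real k * real (p - k + 1)) powr \<alpha> * q p k"
begin

definition m :: "nat \<Rightarrow> nat \<Rightarrow> real" where
  "m p k = real k * real (p - k + 1)"

text \<open>The 5 is dictated by \<open>kernel_all\<close>, where splitting
  \<open>wgt \<alpha> (j + k)\<close> leaves five single weights; the other kernel bounds need at
  most 4.\<close>

definition K :: real where "K = 5 * D * \<Q>"

lemma K_nonneg: "0 \<le> K" using D \<Q> by (simp add: K_def)

text \<open>\<open>m p k\<close> is a product of two numbers \<open>x, y \<ge> 1\<close> with
  \<open>x + y = p + 1\<close>. The lower bound is \<open>(x - 1) * (y - 1) \<ge> 0\<close>; the
  larger factor is at least \<open>p / 2\<close>, which bounds the smaller one by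
  \<open>2 * m p k / p\<close>.\<close>

lemma m_bounds:
  assumes "1 \<le> k" "k \<le> p"
  shows "real p \<le> m p k" "m p k \<le> real p * real p" "real k \<le> m p k"
    "min (real k) (real (p - k + 1)) \<le> 2 * m p k / real p"
proof -
  define x y where "x = real k" and "y = real (p - k + 1)"
  have xy: "1 \<le> x" "1 \<le> y" "x \<le> p" "y \<le> p" and p: "real p = x + y - 1" and m: "m p k = x * y"
    using assms by (auto simp: x_def y_def m_def)
  have 1: "(x - 1) * (y - 1) \<ge> 0" using xy by simp
  then show "real p \<le> m p k" by (simp add: p m algebra_simps)
  show "m p k \<le> real p * real p" unfolding m using xy by (intro mult_mono) auto
  have "x * 1 \<le> x * y" using xy by (intro mult_left_mono) auto
  then show "real k \<le> m p k" unfolding m by (simp only: x_def mult_1_right)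
  have "min x y * real p \<le> 2 * (x * y)"
  proof (cases "x \<le> y")
    case True
    then have "x * real p \<le> x * (2 * y)" using xy p by (intro mult_left_mono) auto
    with True show ?thesis by simp
  next
    case False
    then have "y * real p \<le> y * (2 * x)" using xy p by (intro mult_left_mono) auto
    with False show ?thesis by (simp add: mult_ac)
  qed
  then show "min (real k) (real (p - k + 1)) \<le> 2 * m p k / real p"
    using assms unfolding m by (simp add: x_def y_def field_simps)
qed

lemma m_pos: "1 \<le> k \<Longrightarrow> k \<le> p \<Longrightarrow> 0 < m p k"
  by (simp add: m_def)

lemma sum_m_q: "(\<Sum>k=1..p. m p k * q p k) \<le> \<Q> * real p"
  using q_sum[of p] by (cases "p = 0") (auto simp: m_def)

text \<open>For exponents up to 1, \<open>m p k powr (\<beta> - 1)\<close> is largest where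
  \<open>m p k\<close> is smallest, and \<open>m p k \<ge> p\<close>.\<close>

lemma sum_m_powr_q:
  assumes "0 \<le> \<beta>" "\<beta> \<le> 1"
  shows "(\<Sum>k=1..p. m p k powr \<beta> * q p k) \<le> \<Q> * real p powr \<beta>"
proof (cases "p = 0")
  case False
  then have p: "0 < real p" by simp
  have "(\<Sum>k=1..p. m p k powr \<beta> * q p k) \<le> (\<Sum>k=1..p. real p powr (\<beta> - 1) * (m p k * q p k))"
  proof (rule sum_mono)
    fix k assume k: "k \<in> {1..p}"
    have "m p k powr \<beta> = m p k * m p k powr (\<beta> - 1)"
      using m_pos[of k p] k powr_mult_base[of "m p k" "\<beta> - 1"] by simp
    also have "\<dots> \<le> m p k * real p powr (\<beta> - 1)"
      using m_pos[of k p] m_bounds(1)[of k p] k p assms by (intro mult_left_mono powr_mono2') auto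
    finally show "m p k powr \<beta> * q p k \<le> real p powr (\<beta> - 1) * (m p k * q p k)"
      using q_nonneg[of k p] k by (auto simp: mult_ac dest: mult_left_mono)
  qed
  also have "\<dots> \<le> real p powr (\<beta> - 1) * (\<Q> * real p)"
    unfolding sum_distrib_left[symmetric] by (intro mult_left_mono sum_m_q) auto
  also have "\<dots> = \<Q> * real p powr \<beta>"
    using p powr_mult_base[of "real p" "\<beta> - 1"] by (simp add: mult_ac)
  finally show ?thesis .
qed simp

text \<open>Above exponent 1 the surplus power has to be paid with the upper bound
  \<open>m p k \<le> p * p\<close>, whence \<open>2 * \<alpha>\<close>.\<close>

lemma sum_m_powr_q':
  shows "(\<Sum>k=1..p. m p k powr (1 + \<alpha>) * q p k) \<le> \<Q> * real p * real p powr (2 * \<alpha>)"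
proof -
  have "(\<Sum>k=1..p. m p k powr (1 + \<alpha>) * q p k) \<le> (\<Sum>k=1..p. real p powr (2 * \<alpha>) * (m p k * q p k))"
  proof (rule sum_mono)
    fix k assume k: "k \<in> {1..p}"
    have "m p k powr (1 + \<alpha>) = m p k * m p k powr \<alpha>"
      using m_pos[of k p] k powr_mult_base[of "m p k" "\<alpha>"] by simp
    also have "\<dots> \<le> m p k * (real p * real p) powr \<alpha>"
      using m_pos[of k p] m_bounds(2)[of k p] k \<alpha> by (intro mult_left_mono powr_mono2) auto
    also have "(real p * real p) powr \<alpha> = real p powr (2 * \<alpha>)"
      by (simp only: powr_mult mult_2 powr_add)
    finally show "m p k powr (1 + \<alpha>) * q p k \<le> real p powr (2 * \<alpha>) * (m p k * q p k)"
      using q_nonneg[of k p] k by (auto simp: mult_ac dest: mult_left_mono)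
  qed
  also have "\<dots> \<le> real p powr (2 * \<alpha>) * (\<Q> * real p)"
    unfolding sum_distrib_left[symmetric] by (intro mult_left_mono sum_m_q) auto
  finally show ?thesis by (simp add: mult_ac)
qed

lemma powr_le_wgt: "0 \<le> \<beta> \<Longrightarrow> real p powr \<beta> \<le> wgt \<beta> p"
  by (simp add: wgt_def powr_mono2)

lemma wgt_add_le: "1 \<le> k \<Longrightarrow> wgt \<alpha> (j + k) \<le> wgt \<alpha> j + real k powr \<alpha>"
  using powr_subadditive[of "1 + real j" "real k" \<alpha>] \<alpha> by (simp add: wgt_def add.assoc)

lemma sum_a_le:
  assumes "\<And>k. 1 \<le> k \<Longrightarrow> k \<le> p \<Longrightarrow> 0 \<le> w k"
    and "\<And>k. 1 \<le> k \<Longrightarrow> k \<le> p \<Longrightarrow> w k \<le> v k"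
  shows "(\<Sum>k=1..p. a p j k * w k) \<le> D * wgt \<alpha> j * (\<Sum>k=1..p. v k * m p k powr \<alpha> * q p k)"
proof -
  have "(\<Sum>k=1..p. a p j k * w k) \<le> (\<Sum>k=1..p. D * wgt \<alpha> j * (v k * m p k powr \<alpha> * q p k))"
  proof (rule sum_mono)
    fix k assume k: "k \<in> {1..p}"
    have "a p j k * w k \<le> (D * wgt \<alpha> j * m p k powr \<alpha> * q p k) * v k"
      using k a_le[of k p j] assms[of k] a_nonneg[of k p j] q_nonneg[of k p] D
      by (intro mult_mono) (auto simp: m_def wgt_nonneg intro!: mult_nonneg_nonneg)
    then show "a p j k * w k \<le> D * wgt \<alpha> j * (v k * m p k powr \<alpha> * q p k)"
      by (simp add: mult_ac)
  qed
  then show ?thesis by (simp add: sum_distrib_left)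
qed

text \<open>The absolute value of \<open>v\<close> covers \<open>p = 0\<close>, where the
  assumptions say nothing about \<open>v\<close>.\<close>

lemma sum_a_le_const:
  assumes "\<And>k. 1 \<le> k \<Longrightarrow> k \<le> p \<Longrightarrow> 0 \<le> w k"
    and "\<And>k. 1 \<le> k \<Longrightarrow> k \<le> p \<Longrightarrow> w k \<le> v"
  shows "(\<Sum>k=1..p. a p j k * w k) \<le> D * \<Q> * wgt \<alpha> j * wgt \<alpha> p * \<bar>v\<bar>"
proof -
  have "(\<Sum>k=1..p. a p j k * w k) \<le> D * wgt \<alpha> j * (\<Sum>k=1..p. \<bar>v\<bar> * m p k powr \<alpha> * q p k)"
    using assms by (intro sum_a_le) (auto intro: order.trans[OF _ abs_ge_self])
  also have "(\<Sum>k=1..p. \<bar>v\<bar> * m p k powr \<alpha> * q p k) = \<bar>v\<bar> * (\<Sum>k=1..p. m p k powr \<alpha> * q p k)"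
    by (simp add: sum_distrib_left mult.assoc)
  also have "\<dots> \<le> \<bar>v\<bar> * (\<Q> * wgt \<alpha> p)"
    using \<alpha> \<Q> by (intro mult_left_mono order.trans[OF sum_m_powr_q] powr_le_wgt) auto
  finally have "(\<Sum>k=1..p. a p j k * w k) \<le> D * wgt \<alpha> j * (\<bar>v\<bar> * (\<Q> * wgt \<alpha> p))"
    using D by (simp add: wgt_nonneg mult_left_mono)
  then show ?thesis by (simp only: mult_ac)
qed

section \<open>Kernel bounds summed over the transferred amount\<close>

lemma wgt_two: "wgt (2 * \<alpha>) i = wgt \<alpha> i * wgt \<alpha> i"
  by (simp add: wgt_mult)

lemma wgt_gain_le:
  assumes "1 \<le> k" "k \<le> p"
  shows "real k powr \<alpha> \<le> wgt \<alpha> p" "wgt \<alpha> (p - k) \<le> wgt \<alpha> p"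
  using assms \<alpha> by (auto simp: wgt_def intro!: powr_mono2)

text \<open>The bound without any cancellation. It charges \<open>2 * \<alpha>\<close> to both
  partners and so fixes the space on which the collision terms are defined.\<close>

lemma kernel_all:
  "(\<Sum>k=1..p. a p j k * (wgt \<alpha> (p - k) + wgt \<alpha> p + wgt \<alpha> (j + k) + wgt \<alpha> j))
    \<le> K * wgt (2 * \<alpha>) p * wgt (2 * \<alpha>) j"
proof -
  define v where "v = 5 * (wgt \<alpha> p * wgt \<alpha> j)"
  have v0: "v \<ge> 0" by (simp add: v_def wgt_nonneg)
  have "(\<Sum>k=1..p. a p j k * (wgt \<alpha> (p - k) + wgt \<alpha> p + wgt \<alpha> (j + k) + wgt \<alpha> j))
     \<le> D * \<Q> * wgt \<alpha> j * wgt \<alpha> p * \<bar>v\<bar>"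
  proof (rule sum_a_le_const)
    fix k assume k: "1 \<le> k" "k \<le> p"
    have ge: "1 \<le> wgt \<alpha> p" "1 \<le> wgt \<alpha> j" using \<alpha> by (auto intro: wgt_ge_one)
    have "wgt \<alpha> p \<le> wgt \<alpha> p * wgt \<alpha> j" "wgt \<alpha> j \<le> wgt \<alpha> p * wgt \<alpha> j"
      using ge by (auto simp: mult_le_cancel_left1 mult_le_cancel_right1)
    then show "wgt \<alpha> (p - k) + wgt \<alpha> p + wgt \<alpha> (j + k) + wgt \<alpha> j \<le> v"
      using wgt_gain_le[OF k] wgt_add_le[OF k(1), of j] by (simp add: v_def)
  qed (simp add: wgt_nonneg)
  also have "\<bar>v\<bar> = 5 * (wgt \<alpha> p * wgt \<alpha> j)" using v0 by (simp add: v_def)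
  also have "D * \<Q> * wgt \<alpha> j * wgt \<alpha> p * (5 * (wgt \<alpha> p * wgt \<alpha> j)) = K * wgt (2 * \<alpha>) p * wgt (2 * \<alpha>) j"
    by (simp only: K_def wgt_two) (simp only: mult_ac)
  finally show ?thesis .
qed

text \<open>Used when the difference of two solutions sits at the target \<open>j\<close>: its loss
  has already reduced \<open>wgt \<alpha> (j + k)\<close> to \<open>wgt \<alpha> k\<close>, so all
  three weights are at most \<open>wgt \<alpha> p\<close> and none falls on
  \<open>j\<close>.\<close>

lemma kernel_source:
  "(\<Sum>k=1..p. a p j k * (wgt \<alpha> (p - k) + wgt \<alpha> p + wgt \<alpha> k))
    \<le> K * wgt (2 * \<alpha>) p * wgt \<alpha> j"
proof -
  have "(\<Sum>k=1..p. a p j k * (wgt \<alpha> (p - k) + wgt \<alpha> p + wgt \<alpha> k))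
     \<le> D * \<Q> * wgt \<alpha> j * wgt \<alpha> p * \<bar>3 * wgt \<alpha> p\<bar>"
  proof (rule sum_a_le_const)
    fix k assume k: "1 \<le> k" "k \<le> p"
    show "0 \<le> wgt \<alpha> (p - k) + wgt \<alpha> p + wgt \<alpha> k"
      by (intro add_nonneg_nonneg wgt_nonneg)
    show "wgt \<alpha> (p - k) + wgt \<alpha> p + wgt \<alpha> k \<le> 3 * wgt \<alpha> p"
      using wgt_gain_le(2)[OF k] wgt_mono_arg[OF \<alpha>(1) k(2)] by linarith
  qed
  also have "\<dots> = 3 * (D * \<Q> * wgt (2 * \<alpha>) p * wgt \<alpha> j)" by (simp add: wgt_nonneg wgt_two abs_mult)
  also have "\<dots> \<le> 5 * (D * \<Q> * wgt (2 * \<alpha>) p * wgt \<alpha> j)"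
    using D \<Q> by (intro mult_right_mono) (auto simp: wgt_nonneg)
  finally show ?thesis by (simp add: K_def mult_ac)
qed

text \<open>Nonnegativity is subadditivity of the power. For the upper bound,
  \<open>wgt \<alpha> (p - k) + k powr \<alpha> - wgt \<alpha> p\<close> is at most either of its
  two positive terms, because the other one is at most \<open>wgt \<alpha> p\<close>; the smaller of
  the two is then compared with \<open>m p k / p\<close>.\<close>

lemma gain_excess_bounds:
  assumes "1 \<le> k" "k \<le> p"
  shows "0 \<le> wgt \<alpha> (p - k) - wgt \<alpha> p + wgt \<alpha> (j + k) + wgt \<alpha> j"
    and "wgt \<alpha> (p - k) - wgt \<alpha> p + wgt \<alpha> (j + k) + wgt \<alpha> j
      \<le> 2 * wgt \<alpha> j + 2 * m p k powr \<alpha> * real p powr (- \<alpha>)"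
proof -
  have "wgt \<alpha> p \<le> wgt \<alpha> (p - k) + real k powr \<alpha>"
    using wgt_add_le[of k "p - k"] assms by simp
  moreover have "real k powr \<alpha> \<le> wgt \<alpha> (j + k)"
    using \<alpha> by (auto simp: wgt_def intro!: powr_mono2)
  ultimately show "0 \<le> wgt \<alpha> (p - k) - wgt \<alpha> p + wgt \<alpha> (j + k) + wgt \<alpha> j"
    using wgt_nonneg[of \<alpha> j] by linarith
  have "wgt \<alpha> (p - k) + real k powr \<alpha> - wgt \<alpha> p \<le> min (real k) (real (p - k + 1)) powr \<alpha>"
    using wgt_gain_le[OF assms] by (auto simp: min_def wgt_def algebra_simps)
  also have "\<dots> \<le> (2 * m p k / real p) powr \<alpha>"
    using m_bounds(4)[OF assms] assms \<alpha> by (intro powr_mono2) auto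
  also have "\<dots> = 2 powr \<alpha> * (m p k powr \<alpha> * real p powr (- \<alpha>))"
    using m_pos[OF assms] by (simp add: powr_mult powr_divide powr_minus_divide)
  also have "\<dots> \<le> 2 powr 1 * (m p k powr \<alpha> * real p powr (- \<alpha>))"
    using \<alpha> by (intro mult_right_mono powr_mono) auto
  finally show "wgt \<alpha> (p - k) - wgt \<alpha> p + wgt \<alpha> (j + k) + wgt \<alpha> j
      \<le> 2 * wgt \<alpha> j + 2 * m p k powr \<alpha> * real p powr (- \<alpha>)"
    using wgt_add_le[OF assms(1), of j] by simp
qed

text \<open>Used when the difference sits at the source \<open>p\<close>, where its loss gives the
  weight \<open>wgt \<alpha> p\<close> a negative sign. The excess contributes
  \<open>p powr (- \<alpha>)\<close> times a sum with \<open>m p k powr (2 * \<alpha>)\<close>,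
  hence only \<open>p powr \<alpha>\<close>; that sum is controlled because
  \<open>2 * \<alpha> \<le> 1\<close>.\<close>

lemma kernel_target:
  "(\<Sum>k=1..p. a p j k * (wgt \<alpha> (p - k) - wgt \<alpha> p + wgt \<alpha> (j + k) + wgt \<alpha> j))
    \<le> K * wgt \<alpha> p * wgt (2 * \<alpha>) j"
proof (cases "p = 0")
  case True
  then show ?thesis using K_nonneg by (simp add: wgt_nonneg)
next
  case False
  then have p: "0 < real p" by simp
  have "(\<Sum>k=1..p. a p j k * (wgt \<alpha> (p - k) - wgt \<alpha> p + wgt \<alpha> (j + k) + wgt \<alpha> j))
    \<le> D * wgt \<alpha> j * (\<Sum>k=1..p. (2 * wgt \<alpha> j + 2 * m p k powr \<alpha> * real p powr (- \<alpha>)) * m p k powr \<alpha> * q p k)"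
    by (intro sum_a_le gain_excess_bounds)
  also have "(\<Sum>k=1..p. (2 * wgt \<alpha> j + 2 * m p k powr \<alpha> * real p powr (- \<alpha>)) * m p k powr \<alpha> * q p k)
    = 2 * wgt \<alpha> j * (\<Sum>k=1..p. m p k powr \<alpha> * q p k)
      + 2 * real p powr (- \<alpha>) * (\<Sum>k=1..p. m p k powr (2 * \<alpha>) * q p k)"
    unfolding sum_distrib_left sum.distrib[symmetric] mult_2 powr_add
    by (intro sum.cong) (auto simp: algebra_simps)
  also have "\<dots> \<le> 2 * wgt \<alpha> j * (\<Q> * real p powr \<alpha>) + 2 * real p powr (- \<alpha>) * (\<Q> * real p powr (2 * \<alpha>))"
    using \<alpha> by (intro add_mono mult_left_mono sum_m_powr_q) (auto simp: wgt_nonneg)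
  also have "\<dots> = \<Q> * real p powr \<alpha> * (2 * wgt \<alpha> j + 2)"
    using p by (simp add: algebra_simps flip: powr_add)
  also have "\<dots> \<le> \<Q> * wgt \<alpha> p * (5 * wgt \<alpha> j)"
    using \<Q> \<alpha> wgt_ge_one[of \<alpha> j] by (intro mult_mono powr_le_wgt) (auto simp: wgt_nonneg)
  finally have "(\<Sum>k=1..p. a p j k * (wgt \<alpha> (p - k) - wgt \<alpha> p + wgt \<alpha> (j + k) + wgt \<alpha> j))
      \<le> D * wgt \<alpha> j * (\<Q> * wgt \<alpha> p * (5 * wgt \<alpha> j))"
    using D by (simp add: mult_left_mono wgt_nonneg)
  also have "\<dots> = K * wgt \<alpha> p * wgt (2 * \<alpha>) j"
    by (simp only: K_def wgt_two) (simp only: mult_ac)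
  finally show ?thesis .
qed

text \<open>Bounds the flux of a Lipschitz test function by \<open>X01\<close> norms alone. The
  minimum is at most \<open>min k (p - k + 1) + min k j\<close>; the first part is of order
  \<open>m p k / p\<close>, the second is interpolated between \<open>m p k\<close> and
  \<open>1 + j\<close>.\<close>

lemma kernel_mass:
  "(\<Sum>k=1..p. a p j k * min (real k) (real (p - k + j))) \<le> K * wgt 1 p * wgt 1 j"
proof (cases "p = 0")
  case True
  then show ?thesis using K_nonneg by (simp add: wgt_nonneg)
next
  case False
  then have p: "0 < real p" by simp
  have "(\<Sum>k=1..p. a p j k * min (real k) (real (p - k + j)))
    \<le> D * wgt \<alpha> j * (\<Sum>k=1..p. (2 * m p k / real p + m p k powr \<alpha> * wgt (1 - \<alpha>) j) * m p k powr \<alpha> * q p k)"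
  proof (rule sum_a_le)
    fix k assume k: "1 \<le> k" "k \<le> p"
    \<comment> \<open>Exponents \<open>\<alpha>\<close> and \<open>1 - \<alpha>\<close> are
      distributed so that \<open>j\<close>, together with the factor \<open>wgt \<alpha> j\<close>
      from the rate, ends up with weight exactly 1.\<close>
    have "min (real k) (real j) \<le> m p k powr \<alpha> * wgt (1 - \<alpha>) j"
    proof -
      have "min (real k) (real j) \<le> min (real k) (1 + real j)" by auto
      also have "\<dots> = min (real k) (1 + real j) powr \<alpha> * min (real k) (1 + real j) powr (1 - \<alpha>)"
        using k by (simp add: powr_add[symmetric])
      also have "\<dots> \<le> m p k powr \<alpha> * wgt (1 - \<alpha>) j"
        unfolding wgt_def using k \<alpha> m_bounds(3)[OF k] by (intro mult_mono powr_mono2) auto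
      finally show ?thesis .
    qed
    then show "min (real k) (real (p - k + j)) \<le> 2 * m p k / real p + m p k powr \<alpha> * wgt (1 - \<alpha>) j"
      using m_bounds(4)[OF k] by linarith
  qed auto
  also have "(\<Sum>k=1..p. (2 * m p k / real p + m p k powr \<alpha> * wgt (1 - \<alpha>) j) * m p k powr \<alpha> * q p k)
    = 2 / real p * (\<Sum>k=1..p. m p k powr (1 + \<alpha>) * q p k)
      + wgt (1 - \<alpha>) j * (\<Sum>k=1..p. m p k powr (2 * \<alpha>) * q p k)"
    unfolding sum_distrib_left sum.distrib[symmetric]
  proof (intro sum.cong refl)
    fix k assume "k \<in> {1..p}"
    then have "0 < m p k" using m_pos[of k p] by simp
    then have e: "m p k powr (1 + \<alpha>) = m p k * m p k powr \<alpha>" "m p k powr (2 * \<alpha>) = m p k powr \<alpha> * m p k powr \<alpha>"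
      by (simp_all only: powr_add mult_2) simp
    show "(2 * m p k / real p + m p k powr \<alpha> * wgt (1 - \<alpha>) j) * m p k powr \<alpha> * q p k
      = 2 / real p * (m p k powr (1 + \<alpha>) * q p k) + wgt (1 - \<alpha>) j * (m p k powr (2 * \<alpha>) * q p k)"
      unfolding e by (simp add: field_simps)
  qed
  also have "\<dots> \<le> 2 / real p * (\<Q> * real p * real p powr (2 * \<alpha>)) + wgt (1 - \<alpha>) j * (\<Q> * real p powr (2 * \<alpha>))"
    using \<alpha> by (intro add_mono mult_left_mono sum_m_powr_q sum_m_powr_q') (auto simp: wgt_nonneg)
  also have "\<dots> = \<Q> * real p powr (2 * \<alpha>) * (2 + wgt (1 - \<alpha>) j)"
    using p by (simp add: algebra_simps)
  also have "\<dots> \<le> \<Q> * wgt 1 p * (5 * wgt (1 - \<alpha>) j)"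
    using \<Q> \<alpha> wgt_ge_one[of "1 - \<alpha>" j] order.trans[OF powr_le_wgt[of "2 * \<alpha>" p] wgt_mono[of "2 * \<alpha>" 1 p]]
    by (intro mult_mono) (auto simp: wgt_nonneg)
  finally have "(\<Sum>k=1..p. a p j k * min (real k) (real (p - k + j)))
      \<le> D * wgt \<alpha> j * (\<Q> * wgt 1 p * (5 * wgt (1 - \<alpha>) j))"
    using D by (simp add: mult_left_mono wgt_nonneg)
  also have "\<dots> = K * wgt 1 p * (wgt \<alpha> j * wgt (1 - \<alpha>) j)"
    by (simp add: K_def mult_ac)
  finally show ?thesis by (simp add: wgt_mult)
qed

section \<open>The vector field and its weak form\<close>

text \<open>
  A reaction \<open>((p, j), k)\<close> moves \<open>k\<close> units from a cluster of size \<open>p\<close> to one of size \<open>j\<close>;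
  \<open>out n\<close> is the size whose population the \<open>n\<close>-th collision term \<open>Qn\<close> changes.
\<close>

definition out :: "nat \<Rightarrow> (nat \<times> nat) \<times> nat \<Rightarrow> nat" where
  "out n r = (case r of ((p, j), k) \<Rightarrow>
     if n = 1 then p - k else if n = 2 then j else if n = 3 then j + k else p)"

definition amp :: "(nat \<Rightarrow> real) \<Rightarrow> (nat \<Rightarrow> real) \<Rightarrow> (nat \<times> nat) \<times> nat \<Rightarrow> real" where
  "amp x y r = (case r of ((p, j), k) \<Rightarrow> a p j k * (x p * y j))"

text \<open>Kept bilinear although only the diagonal occurs in the system: differences are
  polarised, and a loss term can be tested against a point mass.\<close>

definition push :: "nat \<Rightarrow> (nat \<Rightarrow> real) \<Rightarrow> (nat \<Rightarrow> real) \<Rightarrow> nat \<Rightarrow> real" where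
  "push n x y i = (\<Sum>\<^sub>\<infinity>r\<in>{r\<in>Rx. out n r = i}. amp x y r)"

text \<open>The fibres of \<open>out n\<close> partition the reactions, so a weighted sum over sizes
  is a sum over \<open>Rx\<close> with the weight evaluated at the output.\<close>

lemma push_weighted_has_sum:
  assumes w: "(\<lambda>r. \<psi> (out n r) * amp x y r) summable_on Rx" and s: "amp x y summable_on Rx"
  shows "((\<lambda>i. \<psi> i * push n x y i) has_sum (\<Sum>\<^sub>\<infinity>r\<in>Rx. \<psi> (out n r) * amp x y r)) UNIV"
proof -
  let ?S = "Sigma UNIV (\<lambda>i. {r\<in>Rx. out n r = i})"
  have "((\<lambda>(i, r). \<psi> i * amp x y r) has_sum (\<Sum>\<^sub>\<infinity>r\<in>Rx. \<psi> (out n r) * amp x y r)) ?S"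
  proof (subst has_sum_reindex_bij_witness[where i = "\<lambda>r. (out n r, r)" and j = snd and T = Rx
        and h = "\<lambda>r. \<psi> (out n r) * amp x y r" and s' = "\<Sum>\<^sub>\<infinity>r\<in>Rx. \<psi> (out n r) * amp x y r"])
    show "((\<lambda>r. \<psi> (out n r) * amp x y r) has_sum (\<Sum>\<^sub>\<infinity>r\<in>Rx. \<psi> (out n r) * amp x y r)) Rx"
      using w by simp
  qed auto
  then show ?thesis
  proof (rule has_sum_Sigma')
    fix i
    have "amp x y summable_on {r\<in>Rx. out n r = i}" using s by (rule summable_on_subset) auto
    then show "((\<lambda>r. case (i, r) of (i, r) \<Rightarrow> \<psi> i * amp x y r) has_sum (\<psi> i * push n x y i))
        {r\<in>Rx. out n r = i}"
      unfolding push_def by (auto intro: has_sum_cmult_right)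
  qed
qed

lemma wgt_out_le:
  "wgt \<alpha> (out n ((p, j), k)) \<le> wgt \<alpha> (p - k) + wgt \<alpha> p + wgt \<alpha> (j + k) + wgt \<alpha> j"
  using wgt_nonneg[of \<alpha>] by (auto simp: out_def intro: add_increasing add_increasing2 add_nonneg_nonneg)

lemma amp_all_summable:
  assumes x: "wsummable (2 * \<alpha>) x" and y: "wsummable (2 * \<alpha>) y"
  defines "f \<equiv> \<lambda>((p, j), k). a p j k * (wgt \<alpha> (p - k) + wgt \<alpha> p + wgt \<alpha> (j + k) + wgt \<alpha> j) * (\<bar>x p\<bar> * \<bar>y j\<bar>)"
  shows "f summable_on Rx" "infsum f Rx \<le> K * wnorm (2 * \<alpha>) x * wnorm (2 * \<alpha>) y"
proof -
  have s: "(\<Sum>k=1..p. f ((p, j), k)) \<le> (K * (wgt (2 * \<alpha>) p * \<bar>x p\<bar>)) * (wgt (2 * \<alpha>) j * \<bar>y j\<bar>)" for p j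
  proof -
    have "(\<Sum>k=1..p. f ((p, j), k)) =
      (\<Sum>k=1..p. a p j k * (wgt \<alpha> (p - k) + wgt \<alpha> p + wgt \<alpha> (j + k) + wgt \<alpha> j)) * (\<bar>x p\<bar> * \<bar>y j\<bar>)"
      by (simp add: f_def sum_distrib_right)
    also have "\<dots> \<le> (K * wgt (2 * \<alpha>) p * wgt (2 * \<alpha>) j) * (\<bar>x p\<bar> * \<bar>y j\<bar>)"
      by (intro mult_right_mono kernel_all) auto
    finally show ?thesis by (simp only: mult_ac)
  qed
  have f0: "1 \<le> k \<Longrightarrow> k \<le> p \<Longrightarrow> 0 \<le> f ((p, j), k)" for p j k
    unfolding f_def by (auto intro!: mult_nonneg_nonneg add_nonneg_nonneg a_nonneg wgt_nonneg)
  note * = summable_on_Rx[of f, OF f0 s]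
  show "f summable_on Rx"
    using x y K_nonneg by (intro *) (auto simp: wsummable_def wgt_nonneg intro: summable_on_cmult_right)
  have "infsum f Rx \<le> infsum (\<lambda>p. K * (wgt (2 * \<alpha>) p * \<bar>x p\<bar>)) UNIV * infsum (\<lambda>j. wgt (2 * \<alpha>) j * \<bar>y j\<bar>) UNIV"
    using x y K_nonneg by (intro *) (auto simp: wsummable_def wgt_nonneg intro: summable_on_cmult_right)
  then show "infsum f Rx \<le> K * wnorm (2 * \<alpha>) x * wnorm (2 * \<alpha>) y"
    using x by (simp add: wnorm_def wsummable_def infsum_cmult_right)
qed

lemma amp_wgt_summable:
  assumes x: "wsummable (2 * \<alpha>) x" and y: "wsummable (2 * \<alpha>) y"
  shows "(\<lambda>r. wgt \<alpha> (out n r) * \<bar>amp x y r\<bar>) summable_on Rx"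
    "(\<Sum>\<^sub>\<infinity>r\<in>Rx. wgt \<alpha> (out n r) * \<bar>amp x y r\<bar>) \<le> K * wnorm (2 * \<alpha>) x * wnorm (2 * \<alpha>) y"
proof -
  define f where "f = (\<lambda>((p, j), k). a p j k * (wgt \<alpha> (p - k) + wgt \<alpha> p + wgt \<alpha> (j + k) + wgt \<alpha> j) * (\<bar>x p\<bar> * \<bar>y j\<bar>))"
  have le: "wgt \<alpha> (out n r) * \<bar>amp x y r\<bar> \<le> f r" if "r \<in> Rx" for r
  proof -
    obtain p j k where r: "r = ((p, j), k)" by (metis surj_pair)
    have k: "1 \<le> k" "k \<le> p" using that by (auto simp: r Rx_iff)
    have "wgt \<alpha> (out n r) * \<bar>amp x y r\<bar> = wgt \<alpha> (out n r) * (a p j k * (\<bar>x p\<bar> * \<bar>y j\<bar>))"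
      using a_nonneg[OF k] by (simp add: r amp_def abs_mult)
    also have "\<dots> \<le> (wgt \<alpha> (p - k) + wgt \<alpha> p + wgt \<alpha> (j + k) + wgt \<alpha> j) * (a p j k * (\<bar>x p\<bar> * \<bar>y j\<bar>))"
      unfolding r using a_nonneg[OF k] by (intro mult_right_mono wgt_out_le) auto
    finally show ?thesis by (simp add: f_def r mult_ac)
  qed
  note * = amp_all_summable[OF x y, folded f_def]
  show s: "(\<lambda>r. wgt \<alpha> (out n r) * \<bar>amp x y r\<bar>) summable_on Rx"
    using le by (intro summable_on_comparison_test[OF *(1)]) (auto simp: wgt_nonneg)
  show "(\<Sum>\<^sub>\<infinity>r\<in>Rx. wgt \<alpha> (out n r) * \<bar>amp x y r\<bar>) \<le> K * wnorm (2 * \<alpha>) x * wnorm (2 * \<alpha>) y"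
    using infsum_mono[OF s *(1) le] *(2) by linarith
qed

lemma amp_test_summable:
  assumes "wsummable (2 * \<alpha>) x" "wsummable (2 * \<alpha>) y" "\<And>i. \<bar>\<psi> i\<bar> \<le> wgt \<alpha> i"
  shows "(\<lambda>r. \<psi> (out n r) * amp x y r) summable_on Rx"
  using assms by (intro summable_on_dominated[OF amp_wgt_summable(1)[of x y n]])
    (auto simp: abs_mult intro!: mult_right_mono)

lemma amp_summable:
  assumes "wsummable (2 * \<alpha>) x" "wsummable (2 * \<alpha>) y"
  shows "amp x y summable_on Rx"
  using amp_test_summable[OF assms, of "\<lambda>_. 1" 1] \<alpha> by (simp add: wgt_ge_one)

lemma push_has_sum:
  assumes "wsummable (2 * \<alpha>) x" "wsummable (2 * \<alpha>) y" "\<And>i. \<bar>\<psi> i\<bar> \<le> wgt \<alpha> i"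
  shows "((\<lambda>i. \<psi> i * push n x y i) has_sum (\<Sum>\<^sub>\<infinity>r\<in>Rx. \<psi> (out n r) * amp x y r)) UNIV"
  using assms by (intro push_weighted_has_sum amp_test_summable amp_summable)

lemma push_wnorm_le:
  assumes x: "wsummable (2 * \<alpha>) x" and y: "wsummable (2 * \<alpha>) y"
  shows "wsummable \<alpha> (push n x y)" "wnorm \<alpha> (push n x y) \<le> K * wnorm (2 * \<alpha>) x * wnorm (2 * \<alpha>) y"
proof -
  \<comment> \<open>The test function that attains the norm of \<open>push n x y\<close>.\<close>
  define \<psi> where "\<psi> i = wgt \<alpha> i * sgn (push n x y i)" for i
  have psi: "\<bar>\<psi> i\<bar> \<le> wgt \<alpha> i" for i
    by (auto simp: \<psi>_def abs_mult wgt_nonneg abs_sgn_eq)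
  have eq: "\<psi> i * push n x y i = wgt \<alpha> i * \<bar>push n x y i\<bar>" for i
    by (simp add: \<psi>_def abs_sgn mult_ac)
  note hs = push_has_sum[OF x y psi, where n = n, unfolded eq]
  then show "wsummable \<alpha> (push n x y)" by (auto simp: wsummable_def dest: has_sum_imp_summable)
  have "wnorm \<alpha> (push n x y) = (\<Sum>\<^sub>\<infinity>r\<in>Rx. \<psi> (out n r) * amp x y r)"
    unfolding wnorm_def using hs by (rule infsumI)
  also have "\<dots> \<le> (\<Sum>\<^sub>\<infinity>r\<in>Rx. wgt \<alpha> (out n r) * \<bar>amp x y r\<bar>)"
  proof (intro infsum_mono amp_test_summable x y psi amp_wgt_summable)
    fix r
    have "\<psi> (out n r) * amp x y r \<le> \<bar>\<psi> (out n r)\<bar> * \<bar>amp x y r\<bar>"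
      by (metis abs_ge_self abs_mult)
    also have "\<dots> \<le> wgt \<alpha> (out n r) * \<bar>amp x y r\<bar>" by (intro mult_right_mono psi) auto
    finally show "\<psi> (out n r) * amp x y r \<le> wgt \<alpha> (out n r) * \<bar>amp x y r\<bar>" .
  qed
  also have "\<dots> \<le> K * wnorm (2 * \<alpha>) x * wnorm (2 * \<alpha>) y"
    by (rule amp_wgt_summable[OF x y])
  finally show "wnorm \<alpha> (push n x y) \<le> K * wnorm (2 * \<alpha>) x * wnorm (2 * \<alpha>) y" .
qed

lemma amp_diff:
  "amp x x r - amp y y r = amp (\<lambda>i. x i - y i) x r + amp y (\<lambda>i. x i - y i) r"
  by (auto simp: amp_def algebra_simps split: prod.splits)

lemma push_diff:
  assumes x: "wsummable (2 * \<alpha>) x" and y: "wsummable (2 * \<alpha>) y"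
  shows "push n x x i - push n y y i = push n (\<lambda>i. x i - y i) x i + push n y (\<lambda>i. x i - y i) i"
proof -
  note u = wsummable_diff(1)[OF x y]
  have s: "wsummable (2 * \<alpha>) x' \<Longrightarrow> wsummable (2 * \<alpha>) y' \<Longrightarrow> amp x' y' summable_on {r \<in> Rx. out n r = i}" for x' y'
    by (rule summable_on_subset[OF amp_summable]) auto
  have "push n x x i - push n y y i = (\<Sum>\<^sub>\<infinity>r\<in>{r\<in>Rx. out n r = i}. amp x x r - amp y y r)"
    unfolding push_def using s[OF x x] s[OF y y]
    by (simp add: infsum_add[of _ _ "\<lambda>r. - amp y y r", simplified] summable_on_uminus infsum_uminus)
  also have "\<dots> = push n (\<lambda>i. x i - y i) x i + push n y (\<lambda>i. x i - y i) i"
    unfolding push_def amp_diff by (intro infsum_add s x y u)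
  finally show ?thesis .
qed

lemma push_lipschitz:
  fixes n :: nat
  assumes x: "wsummable (2 * \<alpha>) x" and y: "wsummable (2 * \<alpha>) y"
  defines "d \<equiv> \<lambda>i. push n x x i - push n y y i"
  shows "wsummable \<alpha> d"
    "wnorm \<alpha> d \<le> K * (wnorm (2 * \<alpha>) x + wnorm (2 * \<alpha>) y) * wnorm (2 * \<alpha>) (\<lambda>i. x i - y i)"
proof -
  note u = wsummable_diff(1)[OF x y]
  have d: "d = (\<lambda>i. push n (\<lambda>i. x i - y i) x i + push n y (\<lambda>i. x i - y i) i)"
    unfolding d_def by (intro ext push_diff x y)
  show "wsummable \<alpha> d" unfolding d by (intro wsummable_add push_wnorm_le x y u)
  have "wnorm \<alpha> d \<le> wnorm \<alpha> (push n (\<lambda>i. x i - y i) x) + wnorm \<alpha> (push n y (\<lambda>i. x i - y i))"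
    unfolding d by (intro wsummable_add push_wnorm_le x y u)
  also have "\<dots> \<le> K * wnorm (2 * \<alpha>) (\<lambda>i. x i - y i) * wnorm (2 * \<alpha>) x + K * wnorm (2 * \<alpha>) y * wnorm (2 * \<alpha>) (\<lambda>i. x i - y i)"
    by (intro add_mono push_wnorm_le x y u)
  finally show "wnorm \<alpha> d \<le> K * (wnorm (2 * \<alpha>) x + wnorm (2 * \<alpha>) y) * wnorm (2 * \<alpha>) (\<lambda>i. x i - y i)"
    by (simp add: algebra_simps)
qed

text \<open>The Lipschitz bound lives in weight \<open>2 * \<alpha> < 1\<close>, where componentwise
  convergence with an \<open>X01\<close> bound suffices. The filter is arbitrary because the lemma
  serves both sequences of polygons and continuity in time.\<close>

lemma push_tendsto:
  assumes lim: "\<And>i. ((\<lambda>n. x n i) \<longlongrightarrow> y i) F"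
    and x: "\<forall>\<^sub>F n in F. wsummable 1 (x n) \<and> wnorm 1 (x n) \<le> R"
    and y: "wsummable 1 y"
  shows "((\<lambda>n. push l (x n) (x n) i) \<longlongrightarrow> push l y y i) F"
proof -
  have a1: "2 * \<alpha> < 1" "2 * \<alpha> \<le> 1" using \<alpha> by auto
  have "((\<lambda>n. K * (\<bar>R\<bar> + wnorm 1 y) * wnorm (2 * \<alpha>) (\<lambda>i. x n i - y i)) \<longlongrightarrow> K * (\<bar>R\<bar> + wnorm 1 y) * 0) F"
    by (intro tendsto_intros wnorm_tendsto[OF lim x y a1(1)])
  then have 0: "((\<lambda>n. K * (\<bar>R\<bar> + wnorm 1 y) * wnorm (2 * \<alpha>) (\<lambda>i. x n i - y i)) \<longlongrightarrow> 0) F" by simp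
  have "((\<lambda>n. push l (x n) (x n) i - push l y y i) \<longlongrightarrow> 0) F"
  proof (rule tendsto_0_le[where K=1, OF 0])
    show "\<forall>\<^sub>F n in F. norm (push l (x n) (x n) i - push l y y i)
        \<le> norm (K * (\<bar>R\<bar> + wnorm 1 y) * wnorm (2 * \<alpha>) (\<lambda>i. x n i - y i)) * 1"
      using x
    proof eventually_elim
      case (elim n)
      then have xs: "wsummable (2 * \<alpha>) (x n)" and ys: "wsummable (2 * \<alpha>) y"
        using y a1 by (auto intro: wsummable_mono)
      have "\<bar>push l (x n) (x n) i - push l y y i\<bar> \<le> wnorm \<alpha> (\<lambda>i. push l (x n) (x n) i - push l y y i)"
        using \<alpha> by (intro component_le_wnorm push_lipschitz xs ys)
      also have "\<dots> \<le> K * (wnorm (2 * \<alpha>) (x n) + wnorm (2 * \<alpha>) y) * wnorm (2 * \<alpha>) (\<lambda>i. x n i - y i)"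
        by (intro push_lipschitz xs ys)
      also have "\<dots> \<le> K * (\<bar>R\<bar> + wnorm 1 y) * wnorm (2 * \<alpha>) (\<lambda>i. x n i - y i)"
        using elim y a1 wnorm_mono[of 1 "x n" "2 * \<alpha>"] wnorm_mono[of 1 y "2 * \<alpha>"] K_nonneg
        by (intro mult_right_mono mult_left_mono wnorm_nonneg) auto
      finally show ?case using K_nonneg wnorm_nonneg by simp
    qed
  qed
  then show ?thesis by (simp add: LIM_zero_iff)
qed

text \<open>Treats both cases at once: the factor freezes the empty clusters in the non-isolated
  case and passes onto the test function in the weak form.\<close>

definition \<sigma> :: "nat \<Rightarrow> real" where
  "\<sigma> i = (if cs = Non_isolated \<and> i = 0 then 0 else 1)"

lemma \<sigma>_bounds: "0 \<le> \<sigma> i" "\<sigma> i \<le> 1" "1 \<le> i \<Longrightarrow> \<sigma> i = 1"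
  by (auto simp: \<sigma>_def)

definition F :: "(nat \<Rightarrow> real) \<Rightarrow> nat \<Rightarrow> real" where
  "F x i = \<sigma> i * (push 1 x x i - push 2 x x i + push 3 x x i - push 4 x x i)"

lemma F_tendsto:
  assumes "\<And>i. ((\<lambda>n. x n i) \<longlongrightarrow> y i) F'"
    and "\<forall>\<^sub>F n in F'. wsummable 1 (x n) \<and> wnorm 1 (x n) \<le> R" and "wsummable 1 y"
  shows "((\<lambda>n. F (x n) i) \<longlongrightarrow> F y i) F'"
  unfolding F_def by (intro tendsto_intros push_tendsto[OF assms])

lemma F_lipschitz:
  assumes x: "wsummable (2 * \<alpha>) x" and y: "wsummable (2 * \<alpha>) y"
  defines "d \<equiv> \<lambda>i. F x i - F y i"
  shows "wsummable \<alpha> d"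
    "wnorm \<alpha> d \<le> 4 * K * (wnorm (2 * \<alpha>) x + wnorm (2 * \<alpha>) y) * wnorm (2 * \<alpha>) (\<lambda>i. x i - y i)"
proof -
  define e where "e n i = push n x x i - push n y y i" for n i
  define M where "M = K * (wnorm (2 * \<alpha>) x + wnorm (2 * \<alpha>) y) * wnorm (2 * \<alpha>) (\<lambda>i. x i - y i)"
  have e: "wsummable \<alpha> (e n)" "wnorm \<alpha> (e n) \<le> M" for n
    unfolding e_def M_def by (intro push_lipschitz x y)+
  have 1: "wsummable \<alpha> (\<lambda>i. e 1 i - e 2 i)" "wnorm \<alpha> (\<lambda>i. e 1 i - e 2 i) \<le> 2 * M"
    using wsummable_diff[OF e(1) e(1), of 1 2] e(2)[of 1] e(2)[of 2] by auto
  have 2: "wsummable \<alpha> (\<lambda>i. e 3 i - e 4 i)" "wnorm \<alpha> (\<lambda>i. e 3 i - e 4 i) \<le> 2 * M"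
    using wsummable_diff[OF e(1) e(1), of 3 4] e(2)[of 3] e(2)[of 4] by auto
  define g where "g i = (e 1 i - e 2 i) + (e 3 i - e 4 i)" for i
  have g: "wsummable \<alpha> g" "wnorm \<alpha> g \<le> 4 * M"
    using wsummable_add[OF 1(1) 2(1)] 1(2) 2(2) unfolding g_def by auto
  have d: "d i = \<sigma> i * g i" for i
    by (simp add: d_def F_def g_def e_def algebra_simps)
  have dg: "\<bar>d i\<bar> \<le> \<bar>g i\<bar>" for i
    by (auto simp: d \<sigma>_def)
  show "wsummable \<alpha> d" by (rule wnorm_dominated[OF g(1) dg])
  have "wnorm \<alpha> d \<le> wnorm \<alpha> g" by (rule wnorm_dominated[OF g(1) dg])
  also note g(2)
  also have "4 * M = 4 * K * (wnorm (2 * \<alpha>) x + wnorm (2 * \<alpha>) y) * wnorm (2 * \<alpha>) (\<lambda>i. x i - y i)"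
    by (simp only: M_def mult.assoc)
  finally show "wnorm \<alpha> d \<le> 4 * K * (wnorm (2 * \<alpha>) x + wnorm (2 * \<alpha>) y) * wnorm (2 * \<alpha>) (\<lambda>i. x i - y i)" .
qed

lemma F_zero: "F (\<lambda>_. 0) i = 0"
  by (simp add: F_def push_def amp_def case_prod_unfold)

lemma F_wnorm_le:
  assumes x: "wsummable (2 * \<alpha>) x"
  shows "wsummable \<alpha> (F x)" "wnorm \<alpha> (F x) \<le> 4 * K * wnorm (2 * \<alpha>) x * wnorm (2 * \<alpha>) x"
  using F_lipschitz[OF x, of "\<lambda>_. 0"] by (auto simp: F_zero wsummable_def wnorm_def)

text \<open>The change of the moment with weight \<open>\<sigma> * \<psi>\<close> in one reaction:
  \<open>p\<close> and \<open>j\<close> disappear, \<open>p - k\<close> and \<open>j + k\<close>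
  appear.\<close>

definition \<Delta> :: "(nat \<Rightarrow> real) \<Rightarrow> (nat \<times> nat) \<times> nat \<Rightarrow> real" where
  "\<Delta> \<psi> r = (case r of ((p, j), k) \<Rightarrow>
     \<sigma> (p - k) * \<psi> (p - k) - \<sigma> j * \<psi> j + \<sigma> (j + k) * \<psi> (j + k) - \<sigma> p * \<psi> p)"

lemma \<Delta>_out:
  "\<Delta> \<psi> r = \<sigma> (out 1 r) * \<psi> (out 1 r) - \<sigma> (out 2 r) * \<psi> (out 2 r)
    + \<sigma> (out 3 r) * \<psi> (out 3 r) - \<sigma> (out 4 r) * \<psi> (out 4 r)"
  by (simp add: \<Delta>_def out_def split: prod.split)

text \<open>Only summability of the four output terms is assumed, so that it covers three
  situations: tests dominated by \<open>wgt \<alpha>\<close>, compactly supported tents, and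
  truncated states with the unbounded weight \<open>wt\<close>.\<close>

lemma F_weak_form:
  assumes s: "amp x x summable_on Rx"
    and w: "\<And>n. (\<lambda>r. \<sigma> (out n r) * \<psi> (out n r) * amp x x r) summable_on Rx"
  shows "((\<lambda>i. \<psi> i * F x i) has_sum (\<Sum>\<^sub>\<infinity>r\<in>Rx. \<Delta> \<psi> r * amp x x r)) UNIV"
    "(\<lambda>r. \<Delta> \<psi> r * amp x x r) summable_on Rx"
proof -
  define I where "I n = (\<Sum>\<^sub>\<infinity>r\<in>Rx. \<sigma> (out n r) * \<psi> (out n r) * amp x x r)" for n
  have hs: "((\<lambda>i. (\<sigma> i * \<psi> i) * push n x x i) has_sum I n) UNIV" for n
    using push_weighted_has_sum[of "\<lambda>i. \<sigma> i * \<psi> i" n x x, OF w s] by (simp add: I_def)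
  have hI: "((\<lambda>r. \<sigma> (out n r) * \<psi> (out n r) * amp x x r) has_sum I n) Rx" for n
    using w[of n] by (simp add: I_def)
  have m1: "(f has_sum s) A \<Longrightarrow> (g has_sum t) A \<Longrightarrow> ((\<lambda>x. f x - g x) has_sum (s - t)) A"
    for f g :: "'x \<Rightarrow> real" and s t A
    using has_sum_add[of f A s "\<lambda>x. - g x" "-t"] by (simp add: has_sum_uminus)
  have 1: "((\<lambda>i. \<psi> i * F x i) has_sum (I 1 - I 2 + (I 3 - I 4))) UNIV"
    using has_sum_add[OF m1[OF hs hs] m1[OF hs hs], of 1 2 3 4]
    by (rule has_sum_cong[THEN iffD1, rotated]) (simp add: F_def algebra_simps)
  have 2: "((\<lambda>r. \<Delta> \<psi> r * amp x x r) has_sum (I 1 - I 2 + (I 3 - I 4))) Rx"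
    using has_sum_add[OF m1[OF hI hI] m1[OF hI hI], of 1 2 3 4]
    by (rule has_sum_cong[THEN iffD1, rotated]) (simp add: \<Delta>_out algebra_simps)
  show "((\<lambda>i. \<psi> i * F x i) has_sum (\<Sum>\<^sub>\<infinity>r\<in>Rx. \<Delta> \<psi> r * amp x x r)) UNIV"
    using 1 2 by (simp add: infsumI)
  show "(\<lambda>r. \<Delta> \<psi> r * amp x x r) summable_on Rx"
    using 2 by (rule has_sum_imp_summable)
qed

lemma F_weak_form':
  assumes x: "wsummable (2 * \<alpha>) x" and psi: "\<And>i. \<bar>\<psi> i\<bar> \<le> wgt \<alpha> i"
  shows "((\<lambda>i. \<psi> i * F x i) has_sum (\<Sum>\<^sub>\<infinity>r\<in>Rx. \<Delta> \<psi> r * amp x x r)) UNIV"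
    "(\<lambda>r. \<Delta> \<psi> r * amp x x r) summable_on Rx"
proof -
  have "\<bar>\<sigma> i * \<psi> i\<bar> \<le> wgt \<alpha> i" for i
    using psi[of i] wgt_nonneg[of \<alpha> i] by (auto simp: \<sigma>_def)
  then have w: "(\<lambda>r. \<sigma> (out n r) * \<psi> (out n r) * amp x x r) summable_on Rx" for n
    using amp_test_summable[OF x x, of "\<lambda>i. \<sigma> i * \<psi> i" n] by simp
  show "((\<lambda>i. \<psi> i * F x i) has_sum (\<Sum>\<^sub>\<infinity>r\<in>Rx. \<Delta> \<psi> r * amp x x r)) UNIV"
    "(\<lambda>r. \<Delta> \<psi> r * amp x x r) summable_on Rx"
    by (rule F_weak_form[OF amp_summable[OF x x] w])+
qed

text \<open>
  Testing with \<open>\<phi> sgn u\<close>, the losses of \<open>u\<close> enter with a favourable sign; this cancels the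
  contributions of order \<open>p powr (2 * \<alpha>)\<close> that the weight \<open>\<phi> = wgt \<alpha>\<close> could not absorb.
\<close>

lemma F_contraction_estimate:
  assumes c: "wsummable 1 c" "\<And>i. 0 \<le> c i" and d: "wsummable 1 d" "\<And>i. 0 \<le> d i"
    and R: "wnorm 1 c \<le> R" "wnorm 1 d \<le> R"
  defines "u \<equiv> \<lambda>i. c i - d i"
  shows "(\<Sum>\<^sub>\<infinity>i. wgt \<alpha> i * sgn (u i) * (F c i - F d i)) \<le> 2 * K * R * wnorm \<alpha> u"
proof -
  have a1: "2 * \<alpha> \<le> 1" "\<alpha> \<le> 1" using \<alpha> by auto
  have c2: "wsummable (2 * \<alpha>) c" and d2: "wsummable (2 * \<alpha>) d"
    using c d a1 by (auto intro: wsummable_mono)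
  define \<psi> where "\<psi> i = wgt \<alpha> i * sgn (u i)" for i
  have psi: "\<bar>\<psi> i\<bar> \<le> wgt \<alpha> i" for i
    by (auto simp: \<psi>_def abs_mult wgt_nonneg abs_sgn_eq)
  \<comment> \<open>Symmetric polarisation: \<open>c p * c j - d p * d j\<close> equals
    \<open>(u p * s j + s p * u j) / 2\<close>, with \<open>s\<close> nonnegative.\<close>
  define s where "s i = c i + d i" for i
  have s0: "0 \<le> s i" for i using c d by (simp add: s_def)
  have us: "wsummable \<alpha> u" using c d a1 by (auto simp: u_def intro: wsummable_diff wsummable_mono)
  have ss: "wsummable (2 * \<alpha>) s" using c2 d2 by (auto simp: s_def[abs_def] intro: wsummable_add)
  have sR: "wnorm (2 * \<alpha>) s \<le> 2 * R"
    using wsummable_add(2)[OF c2 d2] wnorm_mono[OF c(1) a1(1)] wnorm_mono[OF d(1) a1(1)] R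
    by (simp add: s_def[abs_def])
  have us': "(\<lambda>i. K / 2 * (wgt \<alpha> i * \<bar>u i\<bar>)) summable_on UNIV"
    using us unfolding wsummable_def by (rule summable_on_cmult_right)
  have ss': "(\<lambda>i. wgt (2 * \<alpha>) i * \<bar>s i\<bar>) summable_on UNIV"
    using ss unfolding wsummable_def .
  \<comment> \<open>\<open>A\<close> majorises the half with \<open>u\<close> at the source and
    \<open>B\<close> the half with \<open>u\<close> at the target; their weights are those of
    \<open>kernel_target\<close> and \<open>kernel_source\<close>.\<close>
  define A where "A = (\<lambda>((p, j), k). a p j k * (wgt \<alpha> (p - k) - wgt \<alpha> p + wgt \<alpha> (j + k) + wgt \<alpha> j) * (\<bar>u p\<bar> * s j) / 2)"
  define B where "B = (\<lambda>((p, j), k). a p j k * (wgt \<alpha> (p - k) + wgt \<alpha> p + wgt \<alpha> k) * (s p * \<bar>u j\<bar>) / 2)"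
  have A: "A summable_on Rx" "infsum A Rx \<le> infsum (\<lambda>p. K / 2 * (wgt \<alpha> p * \<bar>u p\<bar>)) UNIV * infsum (\<lambda>j. wgt (2 * \<alpha>) j * \<bar>s j\<bar>) UNIV"
  proof -
    have f0: "1 \<le> k \<Longrightarrow> k \<le> p \<Longrightarrow> 0 \<le> A ((p, j), k)" for p j k
      unfolding A_def using s0 by (auto intro!: mult_nonneg_nonneg a_nonneg gain_excess_bounds)
    have le: "(\<Sum>k=1..p. A ((p, j), k)) \<le> (K / 2 * (wgt \<alpha> p * \<bar>u p\<bar>)) * (wgt (2 * \<alpha>) j * \<bar>s j\<bar>)" for p j
    proof -
      have "(\<Sum>k=1..p. A ((p, j), k)) =
        (\<Sum>k=1..p. a p j k * (wgt \<alpha> (p - k) - wgt \<alpha> p + wgt \<alpha> (j + k) + wgt \<alpha> j)) * (\<bar>u p\<bar> * s j / 2)"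
        by (simp add: A_def sum_distrib_right)
      also have "\<dots> \<le> (K * wgt \<alpha> p * wgt (2 * \<alpha>) j) * (\<bar>u p\<bar> * s j / 2)"
        using s0 by (intro mult_right_mono kernel_target) auto
      finally show ?thesis using s0[of j] by (simp add: mult_ac)
    qed
    note * = summable_on_Rx[of A, OF f0 le]
    show "A summable_on Rx" "infsum A Rx \<le> infsum (\<lambda>p. K / 2 * (wgt \<alpha> p * \<bar>u p\<bar>)) UNIV * infsum (\<lambda>j. wgt (2 * \<alpha>) j * \<bar>s j\<bar>) UNIV"
      by (rule *[OF _ _ us' _ ss']; use K_nonneg in \<open>simp add: wgt_nonneg\<close>)+
  qed
  have B: "B summable_on Rx" "infsum B Rx \<le> infsum (\<lambda>p. wgt (2 * \<alpha>) p * \<bar>s p\<bar>) UNIV * infsum (\<lambda>j. K / 2 * (wgt \<alpha> j * \<bar>u j\<bar>)) UNIV"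
  proof -
    have f0: "1 \<le> k \<Longrightarrow> k \<le> p \<Longrightarrow> 0 \<le> B ((p, j), k)" for p j k
      unfolding B_def using s0 by (auto intro!: mult_nonneg_nonneg add_nonneg_nonneg wgt_nonneg a_nonneg)
    have le: "(\<Sum>k=1..p. B ((p, j), k)) \<le> (wgt (2 * \<alpha>) p * \<bar>s p\<bar>) * (K / 2 * (wgt \<alpha> j * \<bar>u j\<bar>))" for p j
    proof -
      have "(\<Sum>k=1..p. B ((p, j), k)) =
        (\<Sum>k=1..p. a p j k * (wgt \<alpha> (p - k) + wgt \<alpha> p + wgt \<alpha> k)) * (s p * \<bar>u j\<bar> / 2)"
        by (simp add: B_def sum_distrib_right)
      also have "\<dots> \<le> (K * wgt (2 * \<alpha>) p * wgt \<alpha> j) * (s p * \<bar>u j\<bar> / 2)"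
        using s0 by (intro mult_right_mono kernel_source) auto
      finally show ?thesis using s0[of p] by (simp add: mult_ac)
    qed
    note * = summable_on_Rx[of B, OF f0 le]
    show "B summable_on Rx" "infsum B Rx \<le> infsum (\<lambda>p. wgt (2 * \<alpha>) p * \<bar>s p\<bar>) UNIV * infsum (\<lambda>j. K / 2 * (wgt \<alpha> j * \<bar>u j\<bar>)) UNIV"
      by (rule *[OF _ _ ss' _ us']; use K_nonneg in \<open>simp add: wgt_nonneg\<close>)+
  qed
  have AB: "infsum A Rx \<le> K * R * wnorm \<alpha> u" "infsum B Rx \<le> K * R * wnorm \<alpha> u"
  proof -
    have e: "infsum (\<lambda>p. K / 2 * (wgt \<alpha> p * \<bar>u p\<bar>)) UNIV = K / 2 * wnorm \<alpha> u"
      using us unfolding wsummable_def wnorm_def by (intro infsum_cmult_right)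
    have "infsum (\<lambda>j. wgt (2 * \<alpha>) j * \<bar>s j\<bar>) UNIV \<le> 2 * R" using sR by (simp add: wnorm_def)
    then have "K / 2 * wnorm \<alpha> u * infsum (\<lambda>j. wgt (2 * \<alpha>) j * \<bar>s j\<bar>) UNIV \<le> K / 2 * wnorm \<alpha> u * (2 * R)"
      using K_nonneg by (intro mult_left_mono) (auto simp: wnorm_nonneg)
    then show "infsum A Rx \<le> K * R * wnorm \<alpha> u" "infsum B Rx \<le> K * R * wnorm \<alpha> u"
      using A(2) B(2) unfolding e by (simp_all add: mult_ac)
  qed
  have le: "\<Delta> \<psi> r * amp c c r - \<Delta> \<psi> r * amp d d r \<le> A r + B r" if "r \<in> Rx" for r
  proof -
    obtain p j k where r: "r = ((p, j), k)" by (metis surj_pair)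
    have k: "1 \<le> k" "k \<le> p" using that by (auto simp: r Rx_iff)
    have z: "c p * c j - d p * d j = (u p * s j + s p * u j) / 2"
      by (simp add: u_def s_def field_simps)
    have w0: "0 \<le> wgt \<alpha> i" for i by (rule wgt_nonneg)
    have ab: "\<sigma> i * \<psi> i * x \<le> wgt \<alpha> i * \<bar>x\<bar>" "- (\<sigma> i * \<psi> i * x) \<le> wgt \<alpha> i * \<bar>x\<bar>" for i x
    proof -
      have "\<bar>\<sigma> i * \<psi> i * x\<bar> \<le> wgt \<alpha> i * \<bar>x\<bar>"
        using psi[of i] w0[of i] by (auto simp: \<sigma>_def abs_mult intro!: mult_right_mono)
      then show "\<sigma> i * \<psi> i * x \<le> wgt \<alpha> i * \<bar>x\<bar>" "- (\<sigma> i * \<psi> i * x) \<le> wgt \<alpha> i * \<bar>x\<bar>" by auto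
    qed
    have sp: "\<psi> i * u i = wgt \<alpha> i * \<bar>u i\<bar>" for i by (simp add: \<psi>_def abs_sgn mult_ac)
    have 1: "\<Delta> \<psi> r * u p \<le> (wgt \<alpha> (p - k) - wgt \<alpha> p + wgt \<alpha> (j + k) + wgt \<alpha> j) * \<bar>u p\<bar>"
    proof -
      \<comment> \<open>The source has \<open>p \<ge> 1\<close>, so its loss is present in both
        cases of the system.\<close>
      have "\<sigma> p * \<psi> p * u p = wgt \<alpha> p * \<bar>u p\<bar>" using \<sigma>_bounds(3)[of p] k sp[of p] by simp
      with ab(1)[of "p - k" "u p"] ab(1)[of "j + k" "u p"] ab(2)[of j "u p"] show ?thesis
        by (simp add: \<Delta>_def r algebra_simps)
    qed
    have 2: "\<Delta> \<psi> r * u j \<le> (wgt \<alpha> (p - k) + wgt \<alpha> p + wgt \<alpha> k) * \<bar>u j\<bar>"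
    proof -
      \<comment> \<open>The loss at a frozen target is missing, but then \<open>j = 0\<close> and
        \<open>wgt \<alpha> (j + k)\<close> is already \<open>wgt \<alpha> k\<close>. This is why
        \<open>kernel_source\<close> carries \<open>wgt \<alpha> k\<close> instead of
        \<open>k powr \<alpha>\<close>.\<close>
      have "- (\<sigma> j * \<psi> j * u j) + wgt \<alpha> (j + k) * \<bar>u j\<bar> \<le> wgt \<alpha> k * \<bar>u j\<bar>"
      proof (cases "\<sigma> j = 0")
        case True
        then have "j = 0" by (auto simp: \<sigma>_def split: if_splits)
        with True show ?thesis by simp
      next
        case False
        then have "\<sigma> j = 1" by (auto simp: \<sigma>_def split: if_splits)
        then have "- (\<sigma> j * \<psi> j * u j) + wgt \<alpha> (j + k) * \<bar>u j\<bar> = (wgt \<alpha> (j + k) - wgt \<alpha> j) * \<bar>u j\<bar>"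
          using sp[of j] by (simp add: algebra_simps)
        also have "\<dots> \<le> wgt \<alpha> k * \<bar>u j\<bar>"
          using wgt_add_le[OF k(1), of j] \<alpha> powr_mono2[of \<alpha> "real k" "1 + real k"]
          unfolding wgt_def[of \<alpha> k] by (intro mult_right_mono) auto
        finally show ?thesis .
      qed
      with ab(1)[of "p - k" "u j"] ab(1)[of "j + k" "u j"] ab(2)[of p "u j"] show ?thesis
        by (simp add: \<Delta>_def r algebra_simps)
    qed
    have "\<Delta> \<psi> r * amp c c r - \<Delta> \<psi> r * amp d d r = a p j k / 2 * (\<Delta> \<psi> r * u p * s j + \<Delta> \<psi> r * u j * s p)"
    proof -
      have "\<Delta> \<psi> r * amp c c r - \<Delta> \<psi> r * amp d d r = \<Delta> \<psi> r * a p j k * (c p * c j - d p * d j)"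
        by (simp add: r amp_def algebra_simps)
      then show ?thesis unfolding z by (simp add: field_simps)
    qed
    also have "\<dots> \<le> a p j k / 2 * ((wgt \<alpha> (p - k) - wgt \<alpha> p + wgt \<alpha> (j + k) + wgt \<alpha> j) * \<bar>u p\<bar> * s j
        + (wgt \<alpha> (p - k) + wgt \<alpha> p + wgt \<alpha> k) * \<bar>u j\<bar> * s p)"
      using a_nonneg[OF k] by (intro mult_left_mono add_mono mult_right_mono 1 2 s0) auto
    also have "\<dots> = A r + B r" by (simp add: A_def B_def r field_simps)
    finally show ?thesis .
  qed
  note wc = F_weak_form'[OF c2 psi] and wd = F_weak_form'[OF d2 psi]
  have "(\<Sum>\<^sub>\<infinity>i. wgt \<alpha> i * sgn (u i) * (F c i - F d i)) = (\<Sum>\<^sub>\<infinity>i. \<psi> i * F c i + (- (\<psi> i * F d i)))"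
    by (simp add: \<psi>_def algebra_simps)
  also have "\<dots> = (\<Sum>\<^sub>\<infinity>i. \<psi> i * F c i) + (\<Sum>\<^sub>\<infinity>i. - (\<psi> i * F d i))"
    using wc(1) wd(1) by (intro infsum_add) (auto simp: summable_on_uminus dest: has_sum_imp_summable)
  also have "\<dots> = (\<Sum>\<^sub>\<infinity>r\<in>Rx. \<Delta> \<psi> r * amp c c r) + (\<Sum>\<^sub>\<infinity>r\<in>Rx. - (\<Delta> \<psi> r * amp d d r))"
    using wc(1) wd(1) by (simp add: infsumI infsum_uminus)
  also have "\<dots> = (\<Sum>\<^sub>\<infinity>r\<in>Rx. \<Delta> \<psi> r * amp c c r + (- (\<Delta> \<psi> r * amp d d r)))"
    using wc(2) wd(2) by (intro infsum_add[symmetric]) (auto simp: summable_on_uminus)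
  also have "\<dots> \<le> (\<Sum>\<^sub>\<infinity>r\<in>Rx. A r + B r)"
    using wc(2) wd(2) A(1) B(1) le
    by (intro infsum_mono summable_on_add) (auto simp: summable_on_uminus)
  also have "\<dots> = infsum A Rx + infsum B Rx" by (intro infsum_add A B)
  also have "\<dots> \<le> 2 * K * R * wnorm \<alpha> u" using AB by linarith
  finally show ?thesis .
qed

section \<open>Identification with the collision terms of the system\<close>

lemma iterated_sum_eq_push:
  assumes s: "amp c c summable_on Rx"
    and g: "bij_betw (\<lambda>(k, j). g k j) (Sigma I J) {r\<in>Rx. out n r = i}"
    and f: "\<And>k j. k \<in> I \<Longrightarrow> j \<in> J k \<Longrightarrow> f k j = amp c c (g k j)"
  shows "iterated_summable f I J" "(\<Sum>\<^sub>\<infinity>k\<in>I. \<Sum>\<^sub>\<infinity>j\<in>J k. f k j) = push n c c i"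
proof -
  have "amp c c summable_on {r\<in>Rx. out n r = i}" using s by (rule summable_on_subset) auto
  then have "(\<lambda>kj. amp c c (case kj of (k, j) \<Rightarrow> g k j)) summable_on Sigma I J"
    using summable_on_reindex_bij_betw[OF g, of "amp c c"] by simp
  then have 1: "(\<lambda>(k, j). f k j) summable_on Sigma I J"
    by (rule summable_on_cong[THEN iffD1, rotated]) (auto simp: f)
  show "iterated_summable f I J" by (rule iterated_summable_Sigma[OF 1])
  have "(\<Sum>\<^sub>\<infinity>k\<in>I. \<Sum>\<^sub>\<infinity>j\<in>J k. f k j) = infsum (\<lambda>(k, j). f k j) (Sigma I J)"
    by (rule iterated_summable_Sigma[OF 1])
  also have "\<dots> = infsum (\<lambda>kj. amp c c (case kj of (k, j) \<Rightarrow> g k j)) (Sigma I J)"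
    by (rule infsum_cong) (auto simp: f)
  also have "\<dots> = push n c c i"
    unfolding push_def by (rule infsum_reindex_bij_betw[OF g])
  finally show "(\<Sum>\<^sub>\<infinity>k\<in>I. \<Sum>\<^sub>\<infinity>j\<in>J k. f k j) = push n c c i" .
qed

text \<open>In \<open>Q2\<close> and \<open>Q3\<close> the inner summation index is the source size,
  in \<open>Q1\<close> and \<open>Q4\<close> the target size; the inverse maps read off
  \<open>p\<close> or \<open>j\<close> accordingly.\<close>

lemma collision_bij:
  "bij_betw (\<lambda>(k, j). ((i + k, j), k)) (Sigma {1..} (\<lambda>k. UNIV)) {r\<in>Rx. out 1 r = i}"
  "bij_betw (\<lambda>(k, j). ((j, i), k)) (Sigma {1..} (\<lambda>k. {k..})) {r\<in>Rx. out 2 r = i}"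
  "bij_betw (\<lambda>(k, j). ((j, i - k), k)) (Sigma {1..i} (\<lambda>k. {k..})) {r\<in>Rx. out 3 r = i}"
  "bij_betw (\<lambda>(k, j). ((i, j), k)) (Sigma {1..i} (\<lambda>k. UNIV)) {r\<in>Rx. out 4 r = i}"
proof -
  show "bij_betw (\<lambda>(k, j). ((i + k, j), k)) (Sigma {1..} (\<lambda>k. UNIV)) {r\<in>Rx. out 1 r = i}"
    by (rule bij_betw_byWitness[where f' = "\<lambda>((p, j), k). (k, j)"]) (auto simp: out_def Rx_iff)
  show "bij_betw (\<lambda>(k, j). ((j, i), k)) (Sigma {1..} (\<lambda>k. {k..})) {r\<in>Rx. out 2 r = i}"
    by (rule bij_betw_byWitness[where f' = "\<lambda>((p, j), k). (k, p)"]) (auto simp: out_def Rx_iff)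
  show "bij_betw (\<lambda>(k, j). ((j, i - k), k)) (Sigma {1..i} (\<lambda>k. {k..})) {r\<in>Rx. out 3 r = i}"
    by (rule bij_betw_byWitness[where f' = "\<lambda>((p, j), k). (k, p)"]) (auto simp: out_def Rx_iff)
  show "bij_betw (\<lambda>(k, j). ((i, j), k)) (Sigma {1..i} (\<lambda>k. UNIV)) {r\<in>Rx. out 4 r = i}"
    by (rule bij_betw_byWitness[where f' = "\<lambda>((p, j), k). (k, j)"]) (auto simp: out_def Rx_iff)
qed

lemma
  assumes c: "wsummable (2 * \<alpha>) c"
  shows Q_eq_push: "Q1 a i c = push 1 c c i" "Q2 a i c = - push 2 c c i"
      "Q3 a i c = push 3 c c i" "Q4 a i c = - push 4 c c i"
    and dged_Q_converges: "dged_Q_converges cs a l i c"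
proof -
  note * = iterated_sum_eq_push[OF amp_summable[OF c c]]
  note 1 = *[OF collision_bij(1)[of i], of "\<lambda>k j. a (i + k) j k * c (i + k) * c j"]
  note 2 = *[OF collision_bij(2)[of i], of "\<lambda>k j. a j i k * c j * c i"]
  note 3 = *[OF collision_bij(3)[of i], of "\<lambda>k j. a j (i - k) k * c j * c (i - k)"]
  note 4 = *[OF collision_bij(4)[of i], of "\<lambda>k j. a i j k * c j * c i"]
  show "Q1 a i c = push 1 c c i" using 1(2) by (simp add: Q1_def amp_def)
  show "Q2 a i c = - push 2 c c i" using 2(2) by (simp add: Q2_def amp_def)
  show "Q3 a i c = push 3 c c i" using 3(2) by (simp add: Q3_def amp_def)
  show "Q4 a i c = - push 4 c c i" using 4(2) by (simp add: Q4_def amp_def mult_ac)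
  show "dged_Q_converges cs a l i c"
    using 1(1) 2(1) 3(1) 4(1) by (simp add: dged_Q_converges_def amp_def mult_ac)
qed

lemma dged_Q_eq:
  assumes "wsummable (2 * \<alpha>) c" "l \<in> {1..4}"
  shows "dged_Q cs a l i c = \<sigma> i * (if odd l then push l c c i else - push l c c i)"
proof -
  have "l = 1 \<or> l = 2 \<or> l = 3 \<or> l = 4" using assms(2) by auto
  then show ?thesis using Q_eq_push[OF assms(1), of i] by (auto simp: dged_Q_def \<sigma>_def)
qed

lemma sum_dged_Q_eq:
  assumes "wsummable (2 * \<alpha>) c"
  shows "(\<Sum>l=1..4. dged_Q cs a l i c) = F c i"
proof -
  have "{1..4::nat} = {1, 2, 3, 4}" by auto
  then show ?thesis using dged_Q_eq[OF assms] by (simp add: F_def algebra_simps)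
qed

section \<open>Stability estimate\<close>

definition Bd :: "real \<Rightarrow> (nat \<Rightarrow> real) \<Rightarrow> bool" where
  "Bd R x \<longleftrightarrow> (\<forall>i. 0 \<le> x i) \<and> wsummable 1 x \<and> wnorm 1 x \<le> R"

lemma BdD:
  assumes "Bd R x"
  shows "0 \<le> x i" "wsummable 1 x" "wnorm 1 x \<le> R" "wsummable (2 * \<alpha>) x" "wnorm (2 * \<alpha>) x \<le> R"
    "wsummable \<alpha> x" "0 \<le> R"
proof -
  show x: "0 \<le> x i" "wsummable 1 x" "wnorm 1 x \<le> R" using assms by (auto simp: Bd_def)
  show "wsummable (2 * \<alpha>) x" "wnorm (2 * \<alpha>) x \<le> R" "wsummable \<alpha> x"
    using x \<alpha> wsummable_mono[OF x(2)] wnorm_mono[OF x(2), of "2 * \<alpha>"] by auto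
  show "0 \<le> R" using x(3) wnorm_nonneg[of 1 x] by linarith
qed

lemma F_Bd:
  assumes "Bd R x"
  shows "wsummable \<alpha> (F x)" "wnorm \<alpha> (F x) \<le> 4 * K * R * R"
proof -
  show "wsummable \<alpha> (F x)" by (intro F_wnorm_le BdD[OF assms])
  have "wnorm \<alpha> (F x) \<le> 4 * K * wnorm (2 * \<alpha>) x * wnorm (2 * \<alpha>) x"
    by (intro F_wnorm_le BdD[OF assms])
  also have "\<dots> \<le> 4 * K * R * R"
    using BdD[OF assms] K_nonneg wnorm_nonneg[of "2 * \<alpha>" x] by (intro mult_mono) auto
  finally show "wnorm \<alpha> (F x) \<le> 4 * K * R * R" .
qed

lemma wgt_sum_le_wnorm:
  assumes "wsummable \<beta> x" shows "(\<Sum>i<n. wgt \<beta> i * \<bar>x i\<bar>) \<le> wnorm \<beta> x"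
  using assms unfolding wnorm_def wsummable_def
  by (intro finite_sum_le_infsum) (auto simp: wgt_nonneg)

lemma sgn_weighted_sum:
  assumes "wsummable \<beta> x" "\<And>i. \<bar>s i\<bar> \<le> 1"
  shows "(\<lambda>i. wgt \<beta> i * (s i * x i)) summable_on UNIV"
    "\<bar>\<Sum>\<^sub>\<infinity>i. wgt \<beta> i * (s i * x i)\<bar> \<le> wnorm \<beta> x"
proof -
  have le: "\<bar>wgt \<beta> i * (s i * x i)\<bar> \<le> wgt \<beta> i * \<bar>x i\<bar>" for i
    using mult_right_mono[OF assms(2)[of i], of "\<bar>x i\<bar>"] by (simp add: abs_mult wgt_nonneg mult_left_mono)
  show s: "(\<lambda>i. wgt \<beta> i * (s i * x i)) summable_on UNIV"
    by (rule summable_on_dominated[OF assms(1)[unfolded wsummable_def] le])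
  show "\<bar>\<Sum>\<^sub>\<infinity>i. wgt \<beta> i * (s i * x i)\<bar> \<le> wnorm \<beta> x"
    using norm_infsum_le[OF has_sum_infsum[OF s] has_sum_infsum[OF assms(1)[unfolded wsummable_def]]] le
    by (simp add: wnorm_def)
qed

lemma summable_on_LIMSEQ:
  assumes "(f :: nat \<Rightarrow> real) summable_on UNIV"
  shows "(\<lambda>n. \<Sum>i<n. f i) \<longlonglongrightarrow> infsum f UNIV"
  using has_sum_imp_sums[OF has_sum_infsum[OF assms]] by (simp add: sums_def)

text \<open>The norm of the difference is not differentiated. Each component is integrated with its
  sign, and dominated convergence sums the components, since the derivatives are uniformly bounded
  in the \<open>\<alpha>\<close> norm. The defects \<open>\<epsilon>\<close>,
  \<open>\<epsilon>'\<close> and the exceptional set \<open>S\<close> admit polygons as well as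
  solutions.\<close>

lemma stability:
  fixes c d gc gd :: "real \<Rightarrow> nat \<Rightarrow> real"
  assumes t01: "t0 \<le> t1" and S: "finite S"
    and c: "\<And>t. t \<in> {t0..t1} \<Longrightarrow> Bd R (c t)" "\<And>i. continuous_on {t0..t1} (\<lambda>t. c t i)"
      "\<And>i t. t \<in> {t0<..<t1} - S \<Longrightarrow> ((\<lambda>t. c t i) has_real_derivative gc t i) (at t)"
      "\<And>t. t \<in> {t0..t1} \<Longrightarrow> wsummable \<alpha> (\<lambda>i. gc t i - F (c t) i) \<and> wnorm \<alpha> (\<lambda>i. gc t i - F (c t) i) \<le> \<epsilon>"
    and d: "\<And>t. t \<in> {t0..t1} \<Longrightarrow> Bd R (d t)" "\<And>i. continuous_on {t0..t1} (\<lambda>t. d t i)"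
      "\<And>i t. t \<in> {t0<..<t1} - S \<Longrightarrow> ((\<lambda>t. d t i) has_real_derivative gd t i) (at t)"
      "\<And>t. t \<in> {t0..t1} \<Longrightarrow> wsummable \<alpha> (\<lambda>i. gd t i - F (d t) i) \<and> wnorm \<alpha> (\<lambda>i. gd t i - F (d t) i) \<le> \<epsilon>'"
  shows "wnorm \<alpha> (\<lambda>i. c t1 i - d t1 i)
    \<le> (wnorm \<alpha> (\<lambda>i. c t0 i - d t0 i) + (\<epsilon> + \<epsilon>') * (t1 - t0)) * exp (2 * K * R * (t1 - t0))"
proof -
  define u where "u t i = c t i - d t i" for t i
  define g where "g t i = gc t i - gd t i" for t i
  define E where "E t = wnorm \<alpha> (u t)" for t
  define h where "h t = (\<Sum>\<^sub>\<infinity>i. wgt \<alpha> i * (sgn (u t i) * g t i))" for t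
  \<comment> \<open>Bounds the derivative of the difference: the two defects plus
    \<open>4 * K * R * R\<close> for each vector field.\<close>
  define B where "B = \<epsilon> + \<epsilon>' + 8 * K * R * R"
  have us: "wsummable \<alpha> (u t)" if "t \<in> {t0..t1}" for t
    unfolding u_def by (intro wsummable_diff BdD(6)[OF c(1)] BdD(6)[OF d(1)] that)
  have g: "wsummable \<alpha> (g t)" "wnorm \<alpha> (g t) \<le> B" "h t \<le> \<epsilon> + \<epsilon>' + 2 * K * R * E t"
    if t: "t \<in> {t0..t1}" for t
  proof -
    define x where "x i = gc t i - F (c t) i" for i
    define y where "y i = gd t i - F (d t) i" for i
    define z where "z i = F (c t) i - F (d t) i" for i
    have x: "wsummable \<alpha> x" "wnorm \<alpha> x \<le> \<epsilon>" and y: "wsummable \<alpha> y" "wnorm \<alpha> y \<le> \<epsilon>'"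
      using c(4)[OF t] d(4)[OF t] by (auto simp: x_def[abs_def] y_def[abs_def])
    have z: "wsummable \<alpha> z" "wnorm \<alpha> z \<le> 8 * K * R * R"
      using wsummable_diff[OF F_Bd(1)[OF c(1)[OF t]] F_Bd(1)[OF d(1)[OF t]]]
        F_Bd(2)[OF c(1)[OF t]] F_Bd(2)[OF d(1)[OF t]] by (auto simp: z_def[abs_def])
    have geq: "g t = (\<lambda>i. (x i - y i) + z i)" by (auto simp: g_def x_def y_def z_def)
    note xy = wsummable_diff[OF x(1) y(1)]
    show "wsummable \<alpha> (g t)" "wnorm \<alpha> (g t) \<le> B"
      using wsummable_add[OF xy(1) z(1)] xy(2) x y z unfolding geq B_def by auto
    have sg: "\<bar>sgn (u t i)\<bar> \<le> 1" for i by (auto simp: abs_sgn_eq)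
    note sw = sgn_weighted_sum[where s = "\<lambda>i. sgn (u t i)", OF _ sg]
    have "h t = (\<Sum>\<^sub>\<infinity>i. wgt \<alpha> i * (sgn (u t i) * (x i - y i)) + wgt \<alpha> i * (sgn (u t i) * z i))"
      unfolding h_def geq by (simp add: algebra_simps)
    also have "\<dots> = (\<Sum>\<^sub>\<infinity>i. wgt \<alpha> i * (sgn (u t i) * (x i - y i))) + (\<Sum>\<^sub>\<infinity>i. wgt \<alpha> i * (sgn (u t i) * z i))"
      by (intro infsum_add sw xy z)
    also have "(\<Sum>\<^sub>\<infinity>i. wgt \<alpha> i * (sgn (u t i) * z i)) \<le> 2 * K * R * E t"
      using F_contraction_estimate[OF BdD(2)[OF c(1)[OF t]] BdD(1)[OF c(1)[OF t]] BdD(2)[OF d(1)[OF t]]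
          BdD(1)[OF d(1)[OF t]] BdD(3)[OF c(1)[OF t]] BdD(3)[OF d(1)[OF t]]]
      by (simp add: E_def u_def[abs_def] z_def mult.assoc)
    also have "(\<Sum>\<^sub>\<infinity>i. wgt \<alpha> i * (sgn (u t i) * (x i - y i))) \<le> \<epsilon> + \<epsilon>'"
      using sw(2)[OF xy(1)] xy(2) x(2) y(2) by linarith
    finally show "h t \<le> \<epsilon> + \<epsilon>' + 2 * K * R * E t" by simp
  qed
  have hint: "(h has_integral (E t - E t0)) {t0..t}" if t: "t \<in> {t0..t1}" for t
  proof (rule has_integral_dominated_convergence
      [where f = "\<lambda>n s. \<Sum>i<n. wgt \<alpha> i * (sgn (u s i) * g s i)" and h = "\<lambda>_. B"
        and y = "\<lambda>n. \<Sum>i<n. wgt \<alpha> i * (\<bar>u t i\<bar> - \<bar>u t0 i\<bar>)"])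
    fix n
    have i: "((\<lambda>s. sgn (u s i) * g s i) has_integral (\<bar>u t i\<bar> - \<bar>u t0 i\<bar>)) {t0..t}" for i
    proof (rule has_integral_sgn_mult_derivative[OF _ S])
      show "continuous_on {t0..t} (\<lambda>a. u a i)"
        unfolding u_def using t
        by (intro continuous_on_diff continuous_on_subset[OF c(2)] continuous_on_subset[OF d(2)]) auto
      show "((\<lambda>a. u a i) has_real_derivative g s i) (at s)" if "s \<in> {t0<..<t} - S" for s
        unfolding u_def g_def using that t by (intro DERIV_diff c(3) d(3)) auto
      show "\<bar>g s i\<bar> \<le> B" if "s \<in> {t0..t}" for s
      proof -
        have s: "s \<in> {t0..t1}" using that t by auto
        show ?thesis using component_le_wnorm[OF g(1)[OF s] \<alpha>(1), of i] g(2)[OF s] by linarith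
      qed
    qed (use t in auto)
    show "((\<lambda>s. \<Sum>i<n. wgt \<alpha> i * (sgn (u s i) * g s i)) has_integral
        (\<Sum>i<n. wgt \<alpha> i * (\<bar>u t i\<bar> - \<bar>u t0 i\<bar>))) {t0..t}"
      by (intro has_integral_sum has_integral_mult_right i) auto
    show "\<forall>s\<in>{t0..t}. norm (\<Sum>i<n. wgt \<alpha> i * (sgn (u s i) * g s i)) \<le> B"
    proof
      fix s assume "s \<in> {t0..t}"
      then have s: "s \<in> {t0..t1}" using t by auto
      have "norm (\<Sum>i<n. wgt \<alpha> i * (sgn (u s i) * g s i)) \<le> (\<Sum>i<n. wgt \<alpha> i * \<bar>g s i\<bar>)"
        by (rule sum_norm_le) (auto simp: abs_mult wgt_nonneg abs_sgn_eq intro!: mult_left_mono)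
      also have "\<dots> \<le> B" using wgt_sum_le_wnorm[OF g(1)[OF s], of n] g(2)[OF s] by linarith
      finally show "norm (\<Sum>i<n. wgt \<alpha> i * (sgn (u s i) * g s i)) \<le> B" .
    qed
  next
    show "\<forall>s\<in>{t0..t}. (\<lambda>n. \<Sum>i<n. wgt \<alpha> i * (sgn (u s i) * g s i)) \<longlonglongrightarrow> h s"
      unfolding h_def using t
      by (intro ballI summable_on_LIMSEQ sgn_weighted_sum g) (auto simp: abs_sgn_eq)
    have "(\<lambda>n. (\<Sum>i<n. wgt \<alpha> i * \<bar>u t i\<bar>) - (\<Sum>i<n. wgt \<alpha> i * \<bar>u t0 i\<bar>)) \<longlonglongrightarrow> E t - E t0"
      unfolding E_def wnorm_def using us[of t] us[of t0] t
      by (intro tendsto_diff summable_on_LIMSEQ) (auto simp: wsummable_def)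
    then show "(\<lambda>n. \<Sum>i<n. wgt \<alpha> i * (\<bar>u t i\<bar> - \<bar>u t0 i\<bar>)) \<longlonglongrightarrow> E t - E t0"
      by (simp add: right_diff_distrib sum_subtractf)
  qed auto
  have hi: "h integrable_on {t0..t1}" using hint[of t1] t01 by (auto simp: integrable_on_def)
  have Eh: "E t = E t0 + integral {t0..t} h" if "t \<in> {t0..t1}" for t
    using integral_unique[OF hint[OF that]] by simp
  \<comment> \<open>Continuity of \<open>E\<close>, required by Gronwall, comes from its own
    integral representation.\<close>
  have "continuous_on {t0..t1} (\<lambda>t. E t0 + integral {t0..t} h)"
    by (intro continuous_intros indefinite_integral_continuous_1 hi)
  then have Ec: "continuous_on {t0..t1} E"
    by (rule continuous_on_cong[THEN iffD1, rotated 2]) (rule refl, rule Eh[symmetric])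
  have e0: "0 \<le> \<epsilon> + \<epsilon>'"
    using c(4)[of t0] d(4)[of t0] t01 wnorm_nonneg[of \<alpha> "\<lambda>i. gc t0 i - F (c t0) i"]
      wnorm_nonneg[of \<alpha> "\<lambda>i. gd t0 i - F (d t0) i"] by auto
  have "E t1 \<le> (E t0 + (\<epsilon> + \<epsilon>') * (t1 - t0)) * exp (2 * K * R * (t1 - t0))"
  proof (rule gronwall_integral[OF t01 Ec _ e0])
    show "0 \<le> 2 * K * R" using K_nonneg BdD(7)[OF c(1)[of t0]] t01 by simp
    fix t assume t: "t \<in> {t0..t1}"
    have "continuous_on {t0..t} (\<lambda>s. \<epsilon> + \<epsilon>' + 2 * K * R * E s)"
      using Ec t by (intro continuous_intros) (auto intro: continuous_on_subset)
    then have "integral {t0..t} h \<le> integral {t0..t} (\<lambda>s. \<epsilon> + \<epsilon>' + 2 * K * R * E s)"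
      using t g(3)
      by (intro integral_le has_integral_integrable[OF hint[OF t]] integrable_continuous_interval) auto
    then show "E t \<le> E t0 + integral {t0..t} (\<lambda>s. \<epsilon> + \<epsilon>' + 2 * K * R * E s)"
      using Eh[OF t] by simp
  qed
  then show ?thesis by (simp add: E_def u_def[abs_def])
qed

section \<open>Conservation of mass\<close>

text \<open>
  The conserved weight: mass plus number of clusters in the isolated case; in the non-isolated
  case mass, plus the constant population of the empty clusters.
\<close>

definition wt :: "nat \<Rightarrow> real" where
  "wt i = (if cs = Non_isolated then (if i = 0 then 1 else real i) else 1 + real i)"

lemma wt_bounds: "0 \<le> wt i" "wt i \<le> wgt 1 i" "wgt 1 i \<le> 2 * wt i" "1 \<le> wt i"
  by (auto simp: wt_def wgt_one)

definition W :: "(nat \<Rightarrow> real) \<Rightarrow> real" where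
  "W x = (\<Sum>\<^sub>\<infinity>i. wt i * x i)"

lemma wt_summable:
  assumes "wsummable 1 x" shows "(\<lambda>i. wt i * x i) summable_on UNIV"
  using assms wt_bounds unfolding wsummable_def
  by (elim summable_on_dominated) (auto simp: abs_mult intro!: mult_right_mono)

lemma wnorm_le_W:
  assumes "wsummable 1 x" "\<And>i. 0 \<le> x i"
  shows "wnorm 1 x \<le> 2 * W x"
proof -
  have s: "(\<lambda>i. wt i * x i) summable_on UNIV" using assms(1) by (rule wt_summable)
  have "wnorm 1 x \<le> (\<Sum>\<^sub>\<infinity>i. 2 * (wt i * x i))"
    unfolding wnorm_def
  proof (intro infsum_mono summable_on_cmult_right s)
    show "(\<lambda>i. wgt 1 i * \<bar>x i\<bar>) summable_on UNIV" using assms(1) by (simp add: wsummable_def)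
    show "wgt 1 i * \<bar>x i\<bar> \<le> 2 * (wt i * x i)" for i
      using mult_right_mono[OF wt_bounds(3)[of i] assms(2)[of i]] assms(2)[of i] by (simp add: mult_ac)
  qed
  also have "\<dots> = 2 * W x" unfolding W_def by (intro infsum_cmult_right s)
  finally show ?thesis .
qed

lemma W_nonneg: "(\<And>i. 0 \<le> x i) \<Longrightarrow> 0 \<le> W x"
  unfolding W_def by (intro infsum_nonneg mult_nonneg_nonneg wt_bounds)

lemma \<sigma>_wt: "\<sigma> i * wt i = real i + (if cs = Non_isolated then 0 else 1)"
  by (auto simp: \<sigma>_def wt_def)

lemma \<Delta>_wt: "r \<in> Rx \<Longrightarrow> \<Delta> wt r = 0"
  by (auto simp: \<Delta>_def \<sigma>_wt Rx_def)

text \<open>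
  Compactly supported substitutes for \<open>wt\<close> that are still 1-Lipschitz, which is all that the
  domination of the weak form requires.
\<close>

definition tent :: "nat \<Rightarrow> nat \<Rightarrow> real" where
  "tent n i = (if \<sigma> i = 0 then 1 else max 0 (min (wt i) (real n - real i)))"

lemma \<sigma>_tent: "\<sigma> i * tent n i = max 0 (min (real i + (if cs = Non_isolated then 0 else 1)) (real n - real i))"
  by (auto simp: \<sigma>_def tent_def wt_def)

text \<open>Maxima and minima of functions of slope 0, 1 and -1 are 1-Lipschitz.\<close>

lemma \<sigma>_tent_lipschitz: "\<bar>\<sigma> i * tent n i - \<sigma> j * tent n j\<bar> \<le> \<bar>real i - real j\<bar>"
  unfolding \<sigma>_tent by (auto simp: max_def min_def)

lemma tent_bounds: "0 \<le> tent n i" "tent n i \<le> wt i" "tent n i \<le> 1 + real n"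
  using wt_bounds[of i] by (auto simp: tent_def)

lemma tent_eq_0: "n < i \<Longrightarrow> tent n i = 0"
  by (auto simp: tent_def \<sigma>_def)

lemma tent_eventually: "\<forall>\<^sub>F n in sequentially. tent n i = wt i"
\<comment> \<open>From this index on the descending side \<open>n - i\<close> is at least
  \<open>1 + i\<close>.\<close>
proof (rule eventually_sequentiallyI[of "2 * i + 1"])
  fix n assume "2 * i + 1 \<le> n"
  then have "wt i \<le> real n - real i" by (auto simp: wt_def)
  moreover have "\<sigma> i = 0 \<Longrightarrow> wt i = 1" by (auto simp: \<sigma>_def wt_def split: if_splits)
  ultimately show "tent n i = wt i" using wt_bounds(1)[of i] by (simp add: tent_def)
qed

text \<open>The sizes before and after a reaction can be paired in two ways: \<open>p\<close> with
  \<open>p - k\<close> and \<open>j\<close> with \<open>j + k\<close>, each at distance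
  \<open>k\<close>; or crosswise, each at distance at most \<open>p - k + j\<close>.\<close>

lemma \<Delta>_tent_le:
  assumes "1 \<le> k" "k \<le> p"
  shows "\<bar>\<Delta> (tent n) ((p, j), k)\<bar> \<le> 2 * min (real k) (real (p - k + j))"
proof -
  define A B C D where "A = \<sigma> (p - k) * tent n (p - k)" and "B = \<sigma> j * tent n j"
    and "C = \<sigma> (j + k) * tent n (j + k)" and "D = \<sigma> p * tent n p"
  define y where "y = real (p - k)"
  have p: "real p = y + real k" using assms by (simp add: y_def)
  have y: "0 \<le> y" by (simp add: y_def)
  have 1: "\<bar>A - D\<bar> \<le> real k"
    using \<sigma>_tent_lipschitz[of "p - k" n p] unfolding A_def D_def p y_def[symmetric] by simp
  have 2: "\<bar>C - B\<bar> \<le> real k"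
    using \<sigma>_tent_lipschitz[of "j + k" n j] unfolding C_def B_def by simp
  have "\<bar>y - real j\<bar> \<le> y + real j" using y by (simp add: abs_le_iff)
  then have 3: "\<bar>A - B\<bar> \<le> y + real j"
    using \<sigma>_tent_lipschitz[of "p - k" n j] unfolding A_def B_def y_def[symmetric] by (rule order.trans[rotated])
  have "\<bar>real (j + k) - real p\<bar> \<le> y + real j" unfolding p using y by (simp add: abs_le_iff)
  then have 4: "\<bar>C - D\<bar> \<le> y + real j"
    using \<sigma>_tent_lipschitz[of "j + k" n p] unfolding C_def D_def by (rule order.trans[rotated])
  have "\<bar>(A - D) + (C - B)\<bar> \<le> 2 * real k"
    using abs_triangle_ineq[of "A - D" "C - B"] 1 2 by linarith
  moreover have "\<bar>(A - B) + (C - D)\<bar> \<le> (y + real j) + (y + real j)"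
    by (rule order.trans[OF abs_triangle_ineq add_mono[OF 3 4]])
  ultimately have "\<bar>A - B + C - D\<bar> \<le> 2 * min (real k) (real (p - k + j))"
    by (simp add: min_def y_def algebra_simps)
  then show ?thesis by (simp add: \<Delta>_def A_def B_def C_def D_def)
qed

lemma \<Delta>_tent_tendsto:
  assumes "r \<in> Rx" shows "(\<lambda>n. \<Delta> (tent n) r) \<longlonglongrightarrow> 0"
proof -
  have "(\<lambda>n. tent n i) \<longlonglongrightarrow> wt i" for i
    using tent_eventually[of i] by (rule tendsto_eventually)
  then have "(\<lambda>n. \<Delta> (tent n) r) \<longlonglongrightarrow> \<Delta> wt r"
    unfolding \<Delta>_out by (intro tendsto_intros)
  then show ?thesis using \<Delta>_wt[OF assms] by simp
qed

text \<open>One summable majorant for the fluxes of all tents, independent of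
  \<open>n\<close>.\<close>

lemma mass_dominated:
  assumes "Bd R x"
  defines "M \<equiv> \<lambda>((p, j), k). 2 * (a p j k * min (real k) (real (p - k + j)) * (x p * x j))"
  shows "M summable_on Rx" "infsum M Rx \<le> 2 * K * R * R"
proof -
  note x = BdD[OF assms(1)]
  have f0: "1 \<le> k \<Longrightarrow> k \<le> p \<Longrightarrow> 0 \<le> M ((p, j), k)" for p j k
    unfolding M_def using x(1) by (auto intro!: mult_nonneg_nonneg a_nonneg)
  have le: "(\<Sum>k=1..p. M ((p, j), k)) \<le> (2 * K * (wgt 1 p * \<bar>x p\<bar>)) * (wgt 1 j * \<bar>x j\<bar>)" for p j
  proof -
    have "(\<Sum>k=1..p. M ((p, j), k)) = (\<Sum>k=1..p. a p j k * min (real k) (real (p - k + j))) * (2 * (x p * x j))"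
      unfolding sum_distrib_right by (intro sum.cong refl) (simp only: M_def prod.case mult_ac)
    also have "\<dots> \<le> (K * wgt 1 p * wgt 1 j) * (2 * (x p * x j))"
      using x(1) by (intro mult_right_mono kernel_mass) auto
    finally show ?thesis using x(1) by (simp add: mult_ac)
  qed
  have s: "(\<lambda>p. wgt 1 p * \<bar>x p\<bar>) summable_on UNIV" using x(2) by (simp add: wsummable_def)
  have s': "(\<lambda>p. 2 * K * (wgt 1 p * \<bar>x p\<bar>)) summable_on UNIV" by (intro summable_on_cmult_right s)
  note * = summable_on_Rx[of M, OF f0 le]
  show "M summable_on Rx"
    by (rule *[OF _ _ s' _ s]; use K_nonneg in \<open>simp add: wgt_nonneg\<close>)
  have "infsum M Rx \<le> infsum (\<lambda>p. 2 * K * (wgt 1 p * \<bar>x p\<bar>)) UNIV * infsum (\<lambda>p. wgt 1 p * \<bar>x p\<bar>) UNIV"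
    by (rule *[OF _ _ s' _ s]; use K_nonneg in \<open>simp add: wgt_nonneg\<close>)
  also have "\<dots> = 2 * K * wnorm 1 x * wnorm 1 x"
    unfolding wnorm_def by (subst infsum_cmult_right) (use s in auto)
  also have "\<dots> \<le> 2 * K * R * R"
    using x K_nonneg wnorm_nonneg[of 1 x] by (intro mult_mono) auto
  finally show "infsum M Rx \<le> 2 * K * R * R" .
qed

lemma F_weak_tent:
  assumes x: "Bd R x"
  shows "(\<Sum>i\<le>n. tent n i * F x i) = (\<Sum>\<^sub>\<infinity>r\<in>Rx. \<Delta> (tent n) r * amp x x r)"
proof -
  have s: "amp x x summable_on Rx" by (intro amp_summable BdD[OF x])
  have s': "(\<lambda>r. (1 + real n) * \<bar>amp x x r\<bar>) summable_on Rx"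
    using summable_on_iff_abs_summable_on_real[THEN iffD1, OF s] unfolding real_norm_def
    by (rule summable_on_cmult_right)
  have w: "(\<lambda>r. \<sigma> (out l r) * tent n (out l r) * amp x x r) summable_on Rx" for l
  proof (rule summable_on_dominated[OF s'])
    fix r
    have "\<bar>\<sigma> (out l r) * tent n (out l r)\<bar> \<le> 1 * (1 + real n)"
      unfolding abs_mult using tent_bounds[of n "out l r"] \<sigma>_bounds(1,2)[of "out l r"]
      by (intro mult_mono) auto
    then show "\<bar>\<sigma> (out l r) * tent n (out l r) * amp x x r\<bar> \<le> (1 + real n) * \<bar>amp x x r\<bar>"
      by (subst abs_mult) (intro mult_right_mono, auto)
  qed
  have "((\<lambda>i. tent n i * F x i) has_sum (\<Sum>i\<le>n. tent n i * F x i)) UNIV"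
    by (rule has_sum_finite_neutralI[of "{..n}"]) (auto simp: tent_eq_0)
  then show ?thesis using F_weak_form(1)[OF s w] by (rule has_sum_unique)
qed

text \<open>\<open>F_weak_form'\<close> covers only tests dominated by \<open>wgt \<alpha>\<close>,
  which \<open>wt\<close> is not. Each tent moment is a finite sum and can be integrated in time;
  its flux is dominated and tends to 0 reaction by reaction, so the limit is the integral of
  0.\<close>

lemma W_conserved:
  fixes c :: "real \<Rightarrow> nat \<Rightarrow> real"
  assumes t01: "t0 \<le> t1"
    and c: "\<And>t. t \<in> {t0..t1} \<Longrightarrow> Bd R (c t)" "\<And>i. continuous_on {t0..t1} (\<lambda>t. c t i)"
      "\<And>i t. t \<in> {t0<..<t1} \<Longrightarrow> ((\<lambda>t. c t i) has_real_derivative F (c t) i) (at t)"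
  shows "W (c t1) = W (c t0)"
proof -
  have "((\<lambda>t. 0) has_integral (W (c t1) - W (c t0))) {t0..t1}"
  proof (rule has_integral_dominated_convergence
      [where f = "\<lambda>n t. \<Sum>i\<le>n. tent n i * F (c t) i" and h = "\<lambda>_. 2 * K * R * R"
        and y = "\<lambda>n. \<Sum>i\<le>n. tent n i * (c t1 i - c t0 i)"])
    fix n
    have "((\<lambda>t. F (c t) i) has_integral (c t1 i - c t0 i)) {t0..t1}" for i
      using c(3) by (intro fundamental_theorem_of_calculus_interior[OF t01 c(2)])
        (simp add: has_real_derivative_iff_has_vector_derivative)
    then show "((\<lambda>t. \<Sum>i\<le>n. tent n i * F (c t) i) has_integral (\<Sum>i\<le>n. tent n i * (c t1 i - c t0 i))) {t0..t1}"
      by (intro has_integral_sum has_integral_mult_right) auto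
    have dom: "\<bar>\<Delta> (tent n) r * amp x x r\<bar>
        \<le> (\<lambda>((p, j), k). 2 * (a p j k * min (real k) (real (p - k + j)) * (x p * x j))) r"
      if "r \<in> Rx" "Bd R x" for r x n
    proof -
      obtain p j k where r: "r = ((p, j), k)" by (metis surj_pair)
      have k: "1 \<le> k" "k \<le> p" using that by (auto simp: r Rx_iff)
      have x0: "0 \<le> x i" for i using BdD(1)[OF that(2)] .
      have "\<bar>\<Delta> (tent n) r * amp x x r\<bar> = \<bar>\<Delta> (tent n) r\<bar> * (a p j k * (x p * x j))"
        using a_nonneg[OF k] x0 by (simp add: r amp_def abs_mult)
      also have "\<dots> \<le> 2 * min (real k) (real (p - k + j)) * (a p j k * (x p * x j))"
        unfolding r using a_nonneg[OF k] x0 by (intro mult_right_mono \<Delta>_tent_le k) auto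
      finally show ?thesis by (simp add: r mult_ac)
    qed
    show "\<forall>t\<in>{t0..t1}. norm (\<Sum>i\<le>n. tent n i * F (c t) i) \<le> 2 * K * R * R"
    proof
      fix t assume t: "t \<in> {t0..t1}"
      note M = mass_dominated[OF c(1)[OF t]]
      have "(\<lambda>r. \<Delta> (tent n) r * amp (c t) (c t) r) summable_on Rx"
        using M(1) by (rule summable_on_dominated) (rule dom[OF _ c(1)[OF t]])
      then have "norm (\<Sum>\<^sub>\<infinity>r\<in>Rx. \<Delta> (tent n) r * amp (c t) (c t) r) \<le> infsum
          (\<lambda>((p, j), k). 2 * (a p j k * min (real k) (real (p - k + j)) * (c t p * c t j))) Rx"
        by (rule norm_infsum_le[OF has_sum_infsum has_sum_infsum[OF M(1)]])
          (unfold real_norm_def, rule dom[OF _ c(1)[OF t]])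
      with M(2) show "norm (\<Sum>i\<le>n. tent n i * F (c t) i) \<le> 2 * K * R * R"
        unfolding F_weak_tent[OF c(1)[OF t]] by linarith
    qed
    show "\<forall>t\<in>{t0..t1}. (\<lambda>n. \<Sum>i\<le>n. tent n i * F (c t) i) \<longlonglongrightarrow> 0"
    proof
      fix t assume t: "t \<in> {t0..t1}"
      have "(\<lambda>n. \<Sum>\<^sub>\<infinity>r\<in>Rx. \<Delta> (tent n) r * amp (c t) (c t) r) \<longlonglongrightarrow> infsum (\<lambda>r. 0 :: real) Rx"
        by (rule tendsto_infsum_dominated[OF _ dom[OF _ c(1)[OF t]] mass_dominated(1)[OF c(1)[OF t]]])
          (auto intro: tendsto_mult_left_zero \<Delta>_tent_tendsto)
      then show "(\<lambda>n. \<Sum>i\<le>n. tent n i * F (c t) i) \<longlonglongrightarrow> 0"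
        unfolding F_weak_tent[OF c(1)[OF t]] by simp
    qed
  next
    have lim: "(\<lambda>n. \<Sum>i\<le>n. tent n i * x i) \<longlonglongrightarrow> W x" if x: "Bd R x" for x
    proof -
      have eq: "(\<Sum>i\<le>n. tent n i * x i) = (\<Sum>\<^sub>\<infinity>i. tent n i * x i)" for n
        by (rule infsumI[symmetric, OF has_sum_finite_neutralI[of "{..n}"]]) (auto simp: tent_eq_0)
      have "(\<lambda>n. \<Sum>\<^sub>\<infinity>i. tent n i * x i) \<longlonglongrightarrow> (\<Sum>\<^sub>\<infinity>i. wt i * x i)"
      proof (rule tendsto_infsum_dominated)
        show "(\<lambda>i. wt i * x i) summable_on UNIV" using x by (intro wt_summable BdD)
        show "\<bar>tent n i * x i\<bar> \<le> wt i * x i" for n i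
          using tent_bounds[of n i] BdD(1)[OF x, of i] by (auto simp: abs_mult intro!: mult_right_mono)
        show "(\<lambda>n. tent n i * x i) \<longlonglongrightarrow> wt i * x i" for i
          by (intro tendsto_intros tendsto_eventually tent_eventually)
      qed
      then show ?thesis by (simp add: eq W_def)
    qed
    have "(\<lambda>n. (\<Sum>i\<le>n. tent n i * c t1 i) - (\<Sum>i\<le>n. tent n i * c t0 i)) \<longlonglongrightarrow> W (c t1) - W (c t0)"
      using t01 by (intro tendsto_diff lim c) auto
    then show "(\<lambda>n. \<Sum>i\<le>n. tent n i * (c t1 i - c t0 i)) \<longlonglongrightarrow> W (c t1) - W (c t0)"
      by (simp add: right_diff_distrib sum_subtractf)
  qed auto
  then show ?thesis
    using has_integral_unique[OF has_integral_0] by fastforce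
qed

section \<open>Boundedness and uniqueness of mild solutions\<close>

lemma X01_nonneg_iff: "x \<in> X01_nonneg \<longleftrightarrow> (\<forall>i. 0 \<le> x i) \<and> wsummable 1 x"
  unfolding X01_nonneg_def X01_def wsummable_def
  by (subst summable_on_UNIV_nonneg_real_iff) (auto simp: wgt_one)

lemma F_continuous_on:
  assumes c: "\<And>t. t \<in> A \<Longrightarrow> Bd R (c t)" "\<And>i. continuous_on A (\<lambda>t. c t i)"
  shows "continuous_on A (\<lambda>t. F (c t) i)" "continuous_on A (\<lambda>t. push l (c t) (c t) i)"
proof -
  have ev: "\<forall>\<^sub>F s in at t within A. wsummable 1 (c s) \<and> wnorm 1 (c s) \<le> R" for t
    using BdD(2,3)[OF c(1)] by (auto simp: eventually_at_filter)
  have lim: "((\<lambda>s. c s i) \<longlongrightarrow> c t i) (at t within A)" if "t \<in> A" for t i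
    using c(2)[of i] that by (auto simp: continuous_on_def)
  show "continuous_on A (\<lambda>t. F (c t) i)" "continuous_on A (\<lambda>t. push l (c t) (c t) i)"
    unfolding continuous_on_def
    using F_tendsto[OF lim ev BdD(2)[OF c(1)]] push_tendsto[OF lim ev BdD(2)[OF c(1)]] by auto
qed

text \<open>Passes from Lebesgue integrals over open intervals to gauge integrals over closed ones,
  and includes \<open>t = 0\<close>, which the integral equation of a mild solution does not
  mention.\<close>

lemma
  assumes sol: "mild_solution cs a T cin c" and T: "0 < T"
  defines "g \<equiv> \<lambda>i s. \<Sum>l=1..4. dged_Q cs a l i (c s)"
  shows mild_solution_integrable: "g i integrable_on {0..T}"
    and mild_solution_integral: "t \<in> {0..T} \<Longrightarrow> c t i = cin i + integral {0..t} (g i)"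
proof -
  have pos: "g i integrable_on {0..t} \<and> c t i = cin i + integral {0..t} (g i)" if t: "t \<in> {0<..T}" for t
  proof -
    have Q: "set_integrable lebesgue {0<..<t} (\<lambda>s. dged_Q cs a l i (c s))" if "l \<in> {1..4}" for l
      using sol t that by (auto simp: mild_solution_def)
    have "set_integrable lebesgue {0<..<t} (g i)"
      using Q unfolding g_def set_integrable_def scaleR_sum_right by (intro Bochner_Integration.integrable_sum) auto
    note * = set_lebesgue_integral_eq_integral[OF this]
    have "c t i = cin i + (LINT s:{0<..<t}|lebesgue. g i s)"
      using sol t unfolding mild_solution_def g_def by blast
    then show ?thesis
      using * by (simp add: integrable_on_open_interval_real integral_open_interval_real)
  qed
  show gi: "g i integrable_on {0..T}" using pos[of T] T by auto
  show "c t i = cin i + integral {0..t} (g i)" if t: "t \<in> {0..T}" for t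
  proof (cases "t = 0")
    case True
    \<comment> \<open>At time 0 both sides are right limits of functions that agree at positive
      times.\<close>
    define G where "G s = cin i + integral {0..s} (g i)" for s
    have "continuous_on {0..T} G"
      unfolding G_def by (intro continuous_intros indefinite_integral_continuous_1 gi)
    then have G: "(G \<longlongrightarrow> G 0) (at_right 0)" using T by (rule continuous_on_Icc_at_rightD)
    have "continuous_on {0..T} (\<lambda>t. c t i)" using sol by (simp add: mild_solution_def)
    then have c: "((\<lambda>t. c t i) \<longlongrightarrow> c 0 i) (at_right 0)" using T by (rule continuous_on_Icc_at_rightD)
    have "\<forall>\<^sub>F s in at_right 0. c s i = G s"
      using pos T by (auto simp: eventually_at_right_field G_def intro!: exI[of _ T])
    then have "((\<lambda>t. c t i) \<longlongrightarrow> G 0) (at_right 0)"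
      using G by (simp add: tendsto_cong)
    with c have "c 0 i = G 0" by (intro tendsto_unique[OF _ c]) auto
    then show ?thesis by (simp add: True G_def)
  qed (use pos[of t] t in auto)
qed

lemma mild_solution_has_derivative:
  assumes sol: "mild_solution cs a T cin c" and T: "0 < T" and t01: "0 \<le> t0" "t1 \<le> T"
    and bd: "\<And>t. t \<in> {t0..t1} \<Longrightarrow> Bd R (c t)" and t: "t \<in> {t0<..<t1}"
  shows "((\<lambda>t. c t i) has_real_derivative F (c t) i) (at t)"
proof -
  define g where "g s = (\<Sum>l=1..4. dged_Q cs a l i (c s))" for s
  have g: "g integrable_on {0..T}" "s \<in> {0..T} \<Longrightarrow> c s i = cin i + integral {0..s} g" for s
    using mild_solution_integrable[OF sol T, of i] mild_solution_integral[OF sol T, of s i]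
    by (simp_all add: g_def[abs_def])
  have gF: "g s = F (c s) i" if "s \<in> {t0..t1}" for s
    unfolding g_def by (intro sum_dged_Q_eq BdD[OF bd[OF that]])
  have "continuous_on {t0..t1} (\<lambda>t. c t i)" for i
    using sol t01 by (auto simp: mild_solution_def intro: continuous_on_subset)
  then have "continuous_on {t0..t1} (\<lambda>t. F (c t) i)" by (intro F_continuous_on(1)[OF bd])
  then have cont: "continuous_on {t0..t1} g"
    by (rule continuous_on_cong[THEN iffD1, rotated 2]) (simp_all add: gF)
  have "((\<lambda>s. integral {t0..s} g) has_vector_derivative g t) (at t within {t0..t1})"
    using t by (intro integral_has_vector_derivative[OF cont]) auto
  then have "((\<lambda>s. integral {t0..s} g) has_vector_derivative g t) (at t)"
    using t by (simp add: at_within_Icc_at)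
  \<comment> \<open>Before \<open>t0\<close> only integrability of \<open>g\<close> is known; that
    part of the integral enters as a constant.\<close>
  then have "((\<lambda>s. (cin i + integral {0..t0} g) + integral {t0..s} g) has_vector_derivative 0 + g t) (at t)"
    by (intro has_vector_derivative_add has_vector_derivative_const)
  then have "((\<lambda>s. c s i) has_vector_derivative 0 + g t) (at t)"
  proof (rule has_vector_derivative_transform_within_open[where S = "{t0<..<t1}"])
    fix s assume s: "s \<in> {t0<..<t1}"
    have "integral {0..t0} g + integral {t0..s} g = integral {0..s} g"
      using s t01 by (intro Henstock_Kurzweil_Integration.integral_combine integrable_subinterval_real[OF g(1)]) auto
    then show "cin i + integral {0..t0} g + integral {t0..s} g = c s i"
      using g(2)[of s] s t01 by simp
  qed (use t in auto)
  then show ?thesis using gF[of t] t by (simp add: has_real_derivative_iff_has_vector_derivative)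
qed

text \<open>Makes \<open>W\<close> lower semicontinuous along componentwise continuous paths:
  sublevel sets are intersections of closed conditions on finite sums.\<close>

lemma W_le_iff:
  assumes "wsummable 1 x" "\<And>i. 0 \<le> x i"
  shows "W x \<le> M \<longleftrightarrow> (\<forall>n. (\<Sum>i<n. wt i * x i) \<le> M)"
proof
  have s: "(\<lambda>i. wt i * x i) summable_on UNIV" using assms(1) by (rule wt_summable)
  show "\<forall>n. (\<Sum>i<n. wt i * x i) \<le> M" if "W x \<le> M"
  proof
    fix n
    have "(\<Sum>i<n. wt i * x i) \<le> W x"
      unfolding W_def using s assms(2) wt_bounds by (intro finite_sum_le_infsum) auto
    with that show "(\<Sum>i<n. wt i * x i) \<le> M" by simp
  qed
  show "W x \<le> M" if "\<forall>n. (\<Sum>i<n. wt i * x i) \<le> M"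
    unfolding W_def using that by (intro LIMSEQ_le_const2[OF summable_on_LIMSEQ[OF s]]) auto
qed

lemma Bd_of_W: "wsummable 1 x \<Longrightarrow> (\<And>i. 0 \<le> x i) \<Longrightarrow> W x \<le> M \<Longrightarrow> Bd (2 * M) x"
  using wnorm_le_W[of x] by (force simp: Bd_def)

text \<open>The bound depends on the initial value alone, so any two solutions share the constant
  \<open>R\<close> of the stability estimate. The factor 2 compares \<open>wnorm 1\<close> with
  \<open>W\<close>.\<close>

lemma mild_solution_bounded:
  assumes sol: "mild_solution cs a T cin c" and T: "0 < T" and t: "t \<in> {0..T}"
  shows "Bd (2 * W cin) (c t)"
proof -
  have c: "wsummable 1 (c t)" "0 \<le> c t i" if "t \<in> {0..T}" for t i
    using sol that by (auto simp: mild_solution_def X01_nonneg_iff)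
  have cont: "continuous_on {0..T} (\<lambda>t. c t i)" for i
    using sol by (simp add: mild_solution_def)
  have "W (c t) = W (c 0)"
  proof (rule lsc_conserved_imp_constant[where V = "\<lambda>t. W (c t)", OF _ _ _ t])
    fix M
    have "{t \<in> {0..T}. W (c t) \<le> M} = (\<Inter>n. {t \<in> {0..T}. (\<Sum>i<n. wt i * c t i) \<le> M})"
      using W_le_iff[OF c] by auto
    also have "closed \<dots>"
      by (intro closed_INT ballI continuous_on_closed_Collect_le continuous_intros cont)
    finally show "closed {t \<in> {0..T}. W (c t) \<le> M}" .
  next
    fix s u M
    assume su: "0 \<le> s" "s \<le> u" "u \<le> T" and M: "\<And>r. r \<in> {s..u} \<Longrightarrow> W (c r) \<le> M"
    have bd: "Bd (2 * M) (c r)" if "r \<in> {s..u}" for r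
      using that su by (intro Bd_of_W c M) auto
    have "W (c u) = W (c s)"
      by (rule W_conserved[OF su(2) bd continuous_on_subset[OF cont]
            mild_solution_has_derivative[OF sol T su(1,3) bd]]) (use su in auto)
    then show "W (c s) = W (c u)" by simp
  qed (use T in auto)
  moreover have "c 0 = cin"
    using mild_solution_integral[OF sol T, of 0] T by auto
  ultimately show ?thesis using t by (intro Bd_of_W c) auto
qed

lemma mild_solution_unique:
  assumes c: "mild_solution cs a T cin c" and d: "mild_solution cs a T cin d"
    and T: "0 < T" and t: "t \<in> {0..T}"
  shows "c t = d t"
proof -
  define R where "R = 2 * W cin"
  have bd: "Bd R (c s)" "Bd R (d s)" if "s \<in> {0..t}" for s
    unfolding R_def using mild_solution_bounded[OF c T, of s] mild_solution_bounded[OF d T, of s] that t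
    by auto
  have cont: "continuous_on {0..t} (\<lambda>t. c t i)" "continuous_on {0..t} (\<lambda>t. d t i)" for i
    using c d t by (auto simp: mild_solution_def intro: continuous_on_subset)
  have init: "c 0 = cin" "d 0 = cin"
    using mild_solution_integral[OF c T, of 0] mild_solution_integral[OF d T, of 0] T by auto
  have z: "wsummable \<alpha> (\<lambda>i. x i - x i)" "wnorm \<alpha> (\<lambda>i. x i - x i) = 0" for x :: "nat \<Rightarrow> real"
    by (simp_all add: wsummable_def wnorm_def)
  have "wnorm \<alpha> (\<lambda>i. c t i - d t i) \<le> (wnorm \<alpha> (\<lambda>i. c 0 i - d 0 i) + (0 + 0) * (t - 0)) * exp (2 * K * R * (t - 0))"
    using t bd cont z
    by (intro stability[where S = "{}" and gc = "\<lambda>t. F (c t)" and gd = "\<lambda>t. F (d t)"]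
        mild_solution_has_derivative[OF c T] mild_solution_has_derivative[OF d T]) auto
  then have "wnorm \<alpha> (\<lambda>i. c t i - d t i) \<le> 0" unfolding init z by simp
  moreover have "wsummable \<alpha> (\<lambda>i. c t i - d t i)"
    using t by (intro wsummable_diff BdD(6)[OF bd(1)] BdD(6)[OF bd(2)]) auto
  ultimately have "\<bar>c t i - d t i\<bar> \<le> 0" for i
    using component_le_wnorm[of \<alpha> "\<lambda>i. c t i - d t i" i] \<alpha> by simp
  then show ?thesis by (intro ext) simp
qed

section \<open>Existence by Euler polygons\<close>

definition trunc :: "nat \<Rightarrow> (nat \<Rightarrow> real) \<Rightarrow> nat \<Rightarrow> real" where
  "trunc n x i = (if i \<le> n then x i else 0)"

lemma trunc_Bd: "Bd R x \<Longrightarrow> Bd R (trunc n x)"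
  using wnorm_dominated[of 1 x "trunc n x"] by (simp add: Bd_def trunc_def[abs_def]) force

lemma amp_trunc_eq_0: "((p, j), k) \<in> Rx \<Longrightarrow> p > n \<or> j > n \<Longrightarrow> amp (trunc n x) (trunc n x) ((p, j), k) = 0"
  by (auto simp: amp_def trunc_def)

text \<open>Two clusters of size at most \<open>n\<close> cannot form one larger than
  \<open>2 * n\<close>.\<close>

lemma F_trunc_eq_0:
  assumes "2 * n < i" shows "F (trunc n x) i = 0"
proof -
  have "push l (trunc n x) (trunc n x) i = 0" for l
    unfolding push_def
  proof (rule infsum_0)
    fix r assume r: "r \<in> {r \<in> Rx. out l r = i}"
    obtain p j k where pjk: "r = ((p, j), k)" by (metis surj_pair)
    have "p > n \<or> j > n"
      using r assms by (auto simp: pjk out_def Rx_iff split: if_splits)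
    then show "amp (trunc n x) (trunc n x) r = 0" using r by (auto simp: pjk amp_trunc_eq_0)
  qed
  then show ?thesis by (simp add: F_def)
qed

lemma F_trunc_wsummable: "wsummable \<beta> (F (trunc n x))"
  unfolding wsummable_def
proof (rule finite_nonzero_values_imp_summable_on)
  have "{i \<in> UNIV. wgt \<beta> i * \<bar>F (trunc n x) i\<bar> \<noteq> 0} \<subseteq> {..2 * n}"
    using F_trunc_eq_0[of n _ x] by (force simp: not_less[symmetric])
  then show "finite {i \<in> UNIV. wgt \<beta> i * \<bar>F (trunc n x) i\<bar> \<noteq> 0}"
    by (rule finite_subset) simp
qed

text \<open>Only finitely many reactions act on a truncated state, so \<open>wt\<close> itself is a
  legitimate test function and conservation is exact.\<close>

lemma W_F_trunc: "((\<lambda>i. wt i * F (trunc n x) i) has_sum 0) UNIV"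
proof -
  have fin: "(\<lambda>r. f r * amp (trunc n x) (trunc n x) r) summable_on Rx" for f :: "_ \<Rightarrow> real"
  proof (rule finite_nonzero_values_imp_summable_on)
    have "r \<in> ({..n} \<times> {..n}) \<times> {..n}" if "r \<in> Rx" "f r * amp (trunc n x) (trunc n x) r \<noteq> 0" for r
    proof -
      obtain p j k where r: "r = ((p, j), k)" by (metis surj_pair)
      have "\<not> (p > n \<or> j > n)" using that amp_trunc_eq_0[of p j k n x] by (auto simp: r)
      with that(1) show ?thesis by (auto simp: r Rx_iff)
    qed
    then have "{r \<in> Rx. f r * amp (trunc n x) (trunc n x) r \<noteq> 0} \<subseteq> ({..n} \<times> {..n}) \<times> {..n}" by blast
    then show "finite {r \<in> Rx. f r * amp (trunc n x) (trunc n x) r \<noteq> 0}" by (rule finite_subset) simp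
  qed
  have "((\<lambda>i. wt i * F (trunc n x) i) has_sum (\<Sum>\<^sub>\<infinity>r\<in>Rx. \<Delta> wt r * amp (trunc n x) (trunc n x) r)) UNIV"
    using fin[of "\<lambda>_. 1"] fin by (intro F_weak_form) auto
  also have "(\<Sum>\<^sub>\<infinity>r\<in>Rx. \<Delta> wt r * amp (trunc n x) (trunc n x) r) = 0"
    by (rule infsum_0) (simp add: \<Delta>_wt)
  finally show ?thesis .
qed

text \<open>Loss terms at \<open>i\<close> are linear in \<open>x i\<close>: replacing the factor
  that carries the index \<open>i\<close> by a point mass changes nothing, and the bilinear norm
  bound then applies.\<close>

lemma push_loss_le:
  assumes x: "Bd R x"
  shows "push 2 x x i \<le> K * R * wgt (2 * \<alpha>) i * x i" "push 4 x x i \<le> K * R * wgt (2 * \<alpha>) i * x i"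
proof -
  define y where "y j = (if j = i then x i else 0)" for j
  note xb = BdD[OF x]
  have y: "wsummable (2 * \<alpha>) y" "wnorm (2 * \<alpha>) y = wgt (2 * \<alpha>) i * x i"
  proof -
    have "((\<lambda>j. wgt (2 * \<alpha>) j * \<bar>y j\<bar>) has_sum (wgt (2 * \<alpha>) i * x i)) UNIV"
      by (rule has_sum_finite_neutralI[of "{i}"]) (use xb(1) in \<open>auto simp: y_def\<close>)
    then show "wsummable (2 * \<alpha>) y" "wnorm (2 * \<alpha>) y = wgt (2 * \<alpha>) i * x i"
      by (auto simp: wsummable_def wnorm_def infsumI dest: has_sum_imp_summable)
  qed
  have le: "K * wnorm (2 * \<alpha>) x * wnorm (2 * \<alpha>) y \<le> K * R * wgt (2 * \<alpha>) i * x i"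
    unfolding y(2) using xb K_nonneg
    by (simp add: mult.assoc) (intro mult_left_mono mult_right_mono mult_nonneg_nonneg wgt_nonneg, auto)
  have "push 2 x x i = push 2 x y i"
    unfolding push_def by (intro infsum_cong) (auto simp: amp_def out_def y_def split: prod.splits)
  also have "\<dots> \<le> wnorm \<alpha> (push 2 x y)"
    using component_le_wnorm[OF push_wnorm_le(1)[OF xb(4) y(1)] \<alpha>(1), of 2 i] by linarith
  also have "\<dots> \<le> K * wnorm (2 * \<alpha>) x * wnorm (2 * \<alpha>) y" by (intro push_wnorm_le xb y)
  also note le
  finally show "push 2 x x i \<le> K * R * wgt (2 * \<alpha>) i * x i" .
  have "push 4 x x i = push 4 y x i"
    unfolding push_def by (intro infsum_cong) (auto simp: amp_def out_def y_def split: prod.splits)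
  also have "\<dots> \<le> wnorm \<alpha> (push 4 y x)"
    using component_le_wnorm[OF push_wnorm_le(1)[OF y(1) xb(4)] \<alpha>(1), of 4 i] by linarith
  also have "\<dots> \<le> K * wnorm (2 * \<alpha>) y * wnorm (2 * \<alpha>) x" by (intro push_wnorm_le xb y)
  also have "\<dots> = K * wnorm (2 * \<alpha>) x * wnorm (2 * \<alpha>) y" by (simp add: mult_ac)
  also note le
  finally show "push 4 x x i \<le> K * R * wgt (2 * \<alpha>) i * x i" .
qed

lemma push_nonneg: "(\<And>i. 0 \<le> x i) \<Longrightarrow> 0 \<le> push n x x i"
  unfolding push_def
  by (intro infsum_nonneg) (auto simp: amp_def Rx_def intro!: mult_nonneg_nonneg a_nonneg)

text \<open>An explicit Euler step preserves nonnegativity if the step times the loss rate is at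
  most 1. This rate is unbounded in \<open>i\<close>, which is why the steps use truncated
  states.\<close>

lemma F_lower_bound:
  assumes x: "Bd R x" shows "- (2 * K * R * wgt (2 * \<alpha>) i * x i) \<le> F x i"
proof -
  note xb = BdD[OF x]
  have L: "0 \<le> K * R * wgt (2 * \<alpha>) i * x i"
    using xb K_nonneg by (intro mult_nonneg_nonneg wgt_nonneg) auto
  show ?thesis
  proof (cases "\<sigma> i = 0")
    case True
    then show ?thesis using L by (simp add: F_def mult.assoc)
  next
    case False
    moreover have "\<sigma> i = 0 \<or> \<sigma> i = 1" by (simp add: \<sigma>_def)
    ultimately have "F x i = push 1 x x i - push 2 x x i + push 3 x x i - push 4 x x i"
      by (simp add: F_def)
    moreover have "0 \<le> push 1 x x i" "0 \<le> push 3 x x i" by (intro push_nonneg xb(1))+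
    ultimately show ?thesis using push_loss_le[OF x, of i]
      by linarith
  qed
qed

text \<open>What every point of a polygon satisfies: \<open>v\<close> is the slope there,
  \<open>M\<close> the conserved value, and \<open>\<epsilon>\<close> bounds the deviation of the
  slope from the vector field.\<close>

definition admissible :: "real \<Rightarrow> real \<Rightarrow> (nat \<Rightarrow> real) \<Rightarrow> (nat \<Rightarrow> real) \<Rightarrow> bool" where
  "admissible M \<epsilon> x v \<longleftrightarrow> (\<forall>i. 0 \<le> x i) \<and> wsummable 1 x \<and> W x = M \<and>
     wsummable \<alpha> (\<lambda>i. v i - F x i) \<and> wnorm \<alpha> (\<lambda>i. v i - F x i) \<le> \<epsilon>"

text \<open>The order of quantifiers matters: \<open>n\<close> and \<open>h0\<close> are chosen
  before the state \<open>y\<close>, so a step can be repeated indefinitely. The vector field is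
  evaluated at the truncation, while the part of \<open>y\<close> above \<open>n\<close> is kept.
  The defect compares \<open>F (trunc n y)\<close> with \<open>F\<close> at the advanced point and
  splits into a truncation error and an error linear in the step.\<close>

lemma euler_step:
  assumes M: "0 \<le> M" and \<epsilon>: "0 < \<epsilon>"
  shows "\<exists>n h0. 0 < h0 \<and> (\<forall>y \<tau>. (\<forall>i. 0 \<le> y i) \<longrightarrow> wsummable 1 y \<longrightarrow> W y = M \<longrightarrow> 0 \<le> \<tau> \<longrightarrow> \<tau> \<le> h0 \<longrightarrow>
      admissible M \<epsilon> (\<lambda>i. y i + \<tau> * F (trunc n y) i) (F (trunc n y)))"
proof -
  define R where "R = 2 * M"
  have R: "0 \<le> R" using M by (simp add: R_def)
  have "(\<lambda>n. 8 * K * R * R * wgt (2 * \<alpha> - 1) n) \<longlonglongrightarrow> 8 * K * R * R * 0"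
    using \<alpha> by (intro tendsto_intros wgt_neg_tendsto) auto
  then have "\<forall>\<^sub>F n in sequentially. 8 * K * R * R * wgt (2 * \<alpha> - 1) n < \<epsilon> / 2"
    using \<epsilon> by (intro order_tendstoD) auto
  then obtain n where n: "8 * K * R * R * wgt (2 * \<alpha> - 1) n < \<epsilon> / 2"
    by (auto simp: eventually_sequentially)
  \<comment> \<open>\<open>A\<close> bounds the loss rate of sizes up to \<open>n\<close>.
    \<open>B\<close> is the Lipschitz factor \<open>8 * K * R\<close> times a bound on the
    \<open>2 * \<alpha>\<close> norm of the truncated field. The added 1 allows division.\<close>
  define A where "A = 2 * K * R * wgt (2 * \<alpha>) n + 1"
  define B where "B = 8 * K * R * (wgt \<alpha> (2 * n) * (4 * K * R * R)) + 1"
  have A: "1 \<le> A" using R K_nonneg by (simp add: A_def wgt_nonneg)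
  have B: "1 \<le> B" using R K_nonneg by (simp add: B_def wgt_nonneg)
  define h0 where "h0 = min (1 / A) (\<epsilon> / 2 / B)"
  show ?thesis
  proof (intro exI conjI allI impI)
    show "0 < h0" using A B \<epsilon> by (simp add: h0_def)
    fix y :: "nat \<Rightarrow> real" and \<tau> assume "\<forall>i. 0 \<le> y i" and y': "wsummable 1 y" "W y = M"
      and \<tau>: "0 \<le> \<tau>" "\<tau> \<le> h0"
    then have y: "\<And>i. 0 \<le> y i" "wsummable 1 y" "W y = M" by auto
    define x where "x = trunc n y"
    define z where "z i = y i + \<tau> * F x i" for i
    have yB: "Bd R y" unfolding R_def using y by (intro Bd_of_W) auto
    have xB: "Bd R x" unfolding x_def by (rule trunc_Bd[OF yB])
    have \<tau>A: "\<tau> * A \<le> 1" and \<tau>B: "\<tau> * B \<le> \<epsilon> / 2"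
      using \<tau> A B by (auto simp: h0_def field_simps)
    have z0: "0 \<le> z i" for i
    proof (cases "i \<le> n")
      case True
      have "2 * K * R * wgt (2 * \<alpha>) i \<le> 2 * K * R * wgt (2 * \<alpha>) n"
        using \<alpha> K_nonneg R True by (intro mult_left_mono wgt_mono_arg) auto
      then have "2 * K * R * wgt (2 * \<alpha>) i \<le> A" by (simp add: A_def)
      then have "\<tau> * (2 * K * R * wgt (2 * \<alpha>) i) \<le> 1"
        using \<tau>A \<tau>(1) by (meson mult_left_mono order.trans)
      then have "\<tau> * (2 * K * R * wgt (2 * \<alpha>) i) * y i \<le> 1 * y i" using y(1) by (rule mult_right_mono)
      moreover have "\<tau> * - (2 * K * R * wgt (2 * \<alpha>) i * y i) \<le> \<tau> * F x i"
        using F_lower_bound[OF xB, of i] True \<tau>(1) by (intro mult_left_mono) (auto simp: x_def trunc_def)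
      ultimately show ?thesis by (simp add: z_def mult.assoc)
    next
      case False
      \<comment> \<open>A size above \<open>n\<close> is empty in the truncation and loses
        nothing.\<close>
      then have "0 \<le> F x i" using F_lower_bound[OF xB, of i] by (simp add: x_def trunc_def)
      then show ?thesis using y(1)[of i] \<tau>(1) by (simp add: z_def)
    qed
    have Fs: "wsummable \<beta> (F x)" for \<beta> unfolding x_def by (rule F_trunc_wsummable)
    have zs: "wsummable 1 z" unfolding z_def by (intro wsummable_add wsummable_cmult y Fs)
    have "((\<lambda>i. wt i * y i + \<tau> * (wt i * F x i)) has_sum (M + \<tau> * 0)) UNIV"
    proof (intro has_sum_add has_sum_cmult_right)
      show "((\<lambda>i. wt i * y i) has_sum M) UNIV"
        using has_sum_infsum[OF wt_summable[OF y(2)]] y(3) by (simp add: W_def)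
      show "((\<lambda>i. wt i * F x i) has_sum 0) UNIV" unfolding x_def by (rule W_F_trunc)
    qed
    then have zW: "W z = M" unfolding W_def z_def by (intro infsumI) (simp add: algebra_simps)
    have zB: "Bd R z" unfolding R_def using z0 zs zW by (intro Bd_of_W) auto
    note x' = BdD(4)[OF xB] and y' = BdD(4)[OF yB] and z' = BdD(4)[OF zB]
    have "wnorm (2 * \<alpha>) (\<lambda>i. x i - z i) \<le> wgt (2 * \<alpha> - 1) n * R + \<tau> * (wgt \<alpha> (2 * n) * (4 * K * R * R))"
    proof -
      define v where "v i = x i - y i" for i
      have v: "wsummable 1 v" "wnorm 1 v \<le> R"
      proof -
        have "\<bar>v i\<bar> \<le> \<bar>y i\<bar>" for i by (simp add: v_def x_def trunc_def)
        from wnorm_dominated[OF y(2) this] BdD(3)[OF yB]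
        show "wsummable 1 v" "wnorm 1 v \<le> R" by auto
      qed
      have "wnorm (2 * \<alpha>) v \<le> wgt (2 * \<alpha> - 1) n * wnorm 1 v"
        using \<alpha> by (intro wnorm_tail[OF v(1)]) (auto simp: v_def x_def trunc_def)
      also have "\<dots> \<le> wgt (2 * \<alpha> - 1) n * R" by (intro mult_left_mono v wgt_nonneg)
      finally have 1: "wnorm (2 * \<alpha>) v \<le> wgt (2 * \<alpha> - 1) n * R" .
      \<comment> \<open>The vector field is only controlled in weight \<open>\<alpha>\<close>; its
        support below \<open>2 * n\<close> buys the missing power at a price depending on
        \<open>n\<close>.\<close>
      have "wnorm (2 * \<alpha>) (F x) \<le> wgt \<alpha> (2 * n) * wnorm \<alpha> (F x)"
      proof -
        have "wnorm (2 * \<alpha>) (F x) \<le> (\<Sum>\<^sub>\<infinity>i. wgt \<alpha> (2 * n) * (wgt \<alpha> i * \<bar>F x i\<bar>))"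
          unfolding wnorm_def
        proof (intro infsum_mono summable_on_cmult_right)
          show "wgt (2 * \<alpha>) i * \<bar>F x i\<bar> \<le> wgt \<alpha> (2 * n) * (wgt \<alpha> i * \<bar>F x i\<bar>)" for i
          proof (cases "i \<le> 2 * n")
            case True
            show ?thesis
              unfolding wgt_two mult.assoc using \<alpha> True
              by (intro mult_right_mono wgt_mono_arg mult_nonneg_nonneg wgt_nonneg) auto
          qed (simp add: x_def F_trunc_eq_0)
        qed (use Fs in \<open>auto simp: wsummable_def\<close>)
        also have "\<dots> = wgt \<alpha> (2 * n) * wnorm \<alpha> (F x)"
          unfolding wnorm_def using Fs[of \<alpha>] by (intro infsum_cmult_right) (simp add: wsummable_def)
        finally show ?thesis .
      qed
      also have "\<dots> \<le> wgt \<alpha> (2 * n) * (4 * K * R * R)"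
        by (intro mult_left_mono F_Bd xB wgt_nonneg)
      finally have 2: "\<tau> * wnorm (2 * \<alpha>) (F x) \<le> \<tau> * (wgt \<alpha> (2 * n) * (4 * K * R * R))"
        using \<tau>(1) by (rule mult_left_mono)
      have eq: "(\<lambda>i. x i - z i) = (\<lambda>i. v i - \<tau> * F x i)" by (auto simp: v_def z_def)
      have "wnorm (2 * \<alpha>) (\<lambda>i. x i - z i) \<le> wnorm (2 * \<alpha>) v + wnorm (2 * \<alpha>) (\<lambda>i. \<tau> * F x i)"
        unfolding eq using \<alpha>
        by (intro wsummable_diff wsummable_cmult Fs wsummable_mono[OF v(1)]) auto
      with 1 2 show ?thesis using wsummable_cmult(2)[OF Fs, of "2 * \<alpha>" \<tau>] \<tau>(1) by simp
    qed
    then have "4 * K * (R + R) * wnorm (2 * \<alpha>) (\<lambda>i. x i - z i)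
        \<le> 4 * K * (R + R) * (wgt (2 * \<alpha> - 1) n * R + \<tau> * (wgt \<alpha> (2 * n) * (4 * K * R * R)))"
      using K_nonneg R by (intro mult_left_mono) auto
    also have "\<dots> = 8 * K * R * R * wgt (2 * \<alpha> - 1) n + \<tau> * (B - 1)"
      by (simp add: B_def algebra_simps)
    also have "\<dots> \<le> \<epsilon>" using n \<tau>B \<tau>(1) by (simp add: right_diff_distrib)
    finally have le: "4 * K * (R + R) * wnorm (2 * \<alpha>) (\<lambda>i. x i - z i) \<le> \<epsilon>" .
    have "wnorm \<alpha> (\<lambda>i. F x i - F z i) \<le> 4 * K * (wnorm (2 * \<alpha>) x + wnorm (2 * \<alpha>) z) * wnorm (2 * \<alpha>) (\<lambda>i. x i - z i)"
      by (rule F_lipschitz[OF x' z'])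
    also have "\<dots> \<le> 4 * K * (R + R) * wnorm (2 * \<alpha>) (\<lambda>i. x i - z i)"
      using BdD(5)[OF xB] BdD(5)[OF zB] K_nonneg
      by (intro mult_right_mono mult_left_mono add_mono wnorm_nonneg) auto
    also note le
    finally have "wnorm \<alpha> (\<lambda>i. F x i - F z i) \<le> \<epsilon>" .
    with z0 zs zW F_lipschitz(1)[OF x' z']
    show "admissible M \<epsilon> (\<lambda>i. y i + \<tau> * F (trunc n y) i) (F (trunc n y))"
      unfolding x_def z_def[abs_def] admissible_def by auto
  qed
qed

text \<open>Fatou's lemma on finite partial sums.\<close>

lemma Bd_limit:
  assumes lim: "\<And>i. (\<lambda>n. x n i) \<longlonglongrightarrow> y i" and x: "\<And>n. Bd R (x n)"
  shows "Bd R y"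
proof -
  have le: "(\<Sum>i\<in>X. wgt 1 i * \<bar>y i\<bar>) \<le> R" if "finite X" for X
  proof (rule LIMSEQ_le_const2)
    show "(\<lambda>n. \<Sum>i\<in>X. wgt 1 i * \<bar>x n i\<bar>) \<longlonglongrightarrow> (\<Sum>i\<in>X. wgt 1 i * \<bar>y i\<bar>)"
      by (intro tendsto_intros lim)
    have "(\<Sum>i\<in>X. wgt 1 i * \<bar>x n i\<bar>) \<le> wnorm 1 (x n)" for n
      unfolding wnorm_def using BdD(2)[OF x[of n]] that
      by (intro finite_sum_le_infsum) (auto simp: wsummable_def wgt_nonneg)
    then show "\<exists>N. \<forall>n\<ge>N. (\<Sum>i\<in>X. wgt 1 i * \<bar>x n i\<bar>) \<le> R"
      using BdD(3)[OF x] order.trans by blast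
  qed
  have s: "(\<lambda>i. wgt 1 i * \<bar>y i\<bar>) summable_on UNIV"
  proof (rule nonneg_bounded_partial_sums_imp_summable_on)
    show "\<forall>\<^sub>F X in finite_subsets_at_top UNIV. (\<Sum>i\<in>X. wgt 1 i * \<bar>y i\<bar>) \<le> R"
      using le by (auto intro: eventually_finite_subsets_at_top_weakI)
  qed (auto simp: wgt_nonneg)
  have "0 \<le> y i" for i
    using BdD(1)[OF x] by (intro LIMSEQ_le_const[OF lim]) auto
  moreover have "wnorm 1 y \<le> R"
    unfolding wnorm_def using le by (intro infsum_le_finite_sums s) auto
  ultimately show ?thesis using s by (simp add: Bd_def wsummable_def)
qed

section \<open>Polygons on the whole interval and their limit\<close>

definition approximate_solution ::
  "real \<Rightarrow> (nat \<Rightarrow> real) \<Rightarrow> real \<Rightarrow> (real \<Rightarrow> nat \<Rightarrow> real) \<Rightarrow> (real \<Rightarrow> nat \<Rightarrow> real) \<Rightarrow> real set \<Rightarrow> bool" where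
  "approximate_solution T cin \<epsilon> c g S \<longleftrightarrow> finite S \<and> c 0 = cin \<and>
     (\<forall>t\<in>{0..T}. admissible (W cin) \<epsilon> (c t) (g t)) \<and>
     (\<forall>i. continuous_on {0..T} (\<lambda>t. c t i)) \<and>
     (\<forall>i. \<forall>t\<in>{0<..<T} - S. ((\<lambda>t. c t i) has_real_derivative g t i) (at t))"

lemma approximate_solution_exists:
  assumes cin: "cin \<in> X01_nonneg" and T: "0 < T" and \<epsilon>: "0 < \<epsilon>"
  shows "\<exists>c g S. approximate_solution T cin \<epsilon> c g S"
proof -
  have cin': "\<And>i. 0 \<le> cin i" "wsummable 1 cin" using cin by (auto simp: X01_nonneg_iff)
  obtain n h0 where h0: "0 < h0"
    and step: "\<forall>y \<tau>. (\<forall>i. 0 \<le> y i) \<longrightarrow> wsummable 1 y \<longrightarrow> W y = W cin \<longrightarrow> 0 \<le> \<tau> \<longrightarrow> \<tau> \<le> h0 \<longrightarrow>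
      admissible (W cin) \<epsilon> (\<lambda>i. y i + \<tau> * F (trunc n y) i) (F (trunc n y))"
    using euler_step[OF W_nonneg[of cin, OF cin'(1)] \<epsilon>] by blast
  obtain N :: nat where N: "T / h0 < real N" using reals_Archimedean2 by blast
  then have N0: "0 < real N" using T h0 by (meson divide_pos_pos order.strict_trans)
  \<comment> \<open>A uniform step of length at most \<open>h0\<close> that reaches \<open>T\<close>
    after exactly \<open>N\<close> steps.\<close>
  define h where "h = T / real N"
  have h: "0 < h" "h \<le> h0" "real N * h = T"
    using N N0 T h0 by (auto simp: h_def field_simps)
  have "\<exists>c g S. approximate_solution (real l * h) cin \<epsilon> c g S" for l
  proof (induction l)
    case 0
    \<comment> \<open>With slope \<open>F cin\<close> at the single time 0 the defect
      vanishes.\<close>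
    have "approximate_solution 0 cin \<epsilon> (\<lambda>t. cin) (\<lambda>t. F cin) {}"
      using cin' \<epsilon> by (simp add: approximate_solution_def admissible_def wsummable_def[of \<alpha>] wnorm_def)
    then show ?case by (auto intro!: exI)
  next
    case (Suc l)
    then obtain c g S where "approximate_solution (real l * h) cin \<epsilon> c g S" by blast
    then have S: "finite S" and c0: "c 0 = cin"
      and c: "\<And>t. t \<in> {0..real l * h} \<Longrightarrow> admissible (W cin) \<epsilon> (c t) (g t)"
      and cont: "\<And>i. continuous_on {0..real l * h} (\<lambda>t. c t i)"
      and der: "\<And>t i. t \<in> {0<..<real l * h} - S \<Longrightarrow> ((\<lambda>t. c t i) has_real_derivative g t i) (at t)"
      unfolding approximate_solution_def by auto
    define t0 where "t0 = real l * h"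
    have t0: "0 \<le> t0" "real (Suc l) * h = t0 + h" using h by (auto simp: t0_def algebra_simps)
    define y where "y = c t0"
    \<comment> \<open>The old polygon is prolonged linearly. At the corner \<open>t0\<close> the
      left slope is kept, and \<open>t0\<close> joins the exceptional set.\<close>
    define d where "d t i = (if t \<le> t0 then c t i else y i + (t - t0) * F (trunc n y) i)" for t i
    define k where "k t i = (if t \<le> t0 then g t i else F (trunc n y) i)" for t i
    have "t0 \<in> {0..real l * h}" using t0 by (simp add: t0_def)
    from c[OF this] have y: "\<forall>i. 0 \<le> y i" "wsummable 1 y" "W y = W cin"
      by (auto simp: admissible_def y_def)
    have dlow: "d t = c t" "k t = g t" if "t \<le> t0" for t using that by (auto simp: d_def k_def)
    have dhigh: "d t = (\<lambda>i. y i + (t - t0) * F (trunc n y) i)" "k t = F (trunc n y)" if "t0 < t" for t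
      using that by (auto simp: d_def k_def)
    have "approximate_solution (t0 + h) cin \<epsilon> d k (insert t0 S)"
      unfolding approximate_solution_def
    proof (intro conjI ballI allI)
      show "d 0 = cin" using c0 dlow t0 by simp
      show "finite (insert t0 S)" using S by simp
      fix t assume t: "t \<in> {0..t0 + h}"
      show "admissible (W cin) \<epsilon> (d t) (k t)"
      proof (cases "t \<le> t0")
        case True
        then show ?thesis using c[of t] t by (simp add: dlow t0_def)
      next
        case False
        then have "0 \<le> t - t0" "t - t0 \<le> h0" using t h by auto
        with step y have "admissible (W cin) \<epsilon> (\<lambda>i. y i + (t - t0) * F (trunc n y) i) (F (trunc n y))"
          by blast
        with False show ?thesis by (simp add: dhigh)
      qed
    next
      fix i
      have "continuous_on ({0..t0} \<union> {t0..t0 + h}) (\<lambda>t. d t i)"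
        unfolding d_def
      proof (rule continuous_on_cases)
        show "continuous_on {0..t0} (\<lambda>t. c t i)" using cont by (simp add: t0_def)
        show "continuous_on {t0..t0 + h} (\<lambda>t. y i + (t - t0) * F (trunc n y) i)"
          by (intro continuous_intros)
      qed (auto simp: y_def)
      then show "continuous_on {0..t0 + h} (\<lambda>t. d t i)"
        using t0 h by (simp add: ivl_disj_un_two_touch)
      fix t assume t: "t \<in> {0<..<t0 + h} - insert t0 S"
      show "((\<lambda>t. d t i) has_real_derivative k t i) (at t)"
      proof (cases "t < t0")
        case True
        have "((\<lambda>t. c t i) has_real_derivative g t i) (at t)"
          using t True by (intro der) (auto simp: t0_def)
        then have "((\<lambda>t. d t i) has_real_derivative g t i) (at t)"
          by (rule has_field_derivative_transform_within_open[of _ _ _ "{..<t0}"]) (use True dlow in auto)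
        then show ?thesis using True dlow by simp
      next
        case False
        have "((\<lambda>t. y i + (t - t0) * F (trunc n y) i) has_real_derivative F (trunc n y) i) (at t)"
          by (auto intro!: derivative_eq_intros)
        then have "((\<lambda>t. d t i) has_real_derivative F (trunc n y) i) (at t)"
          by (rule has_field_derivative_transform_within_open[of _ _ _ "{t0<..}"]) (use t False dhigh in auto)
        then show ?thesis using t False dhigh by simp
      qed
    qed
    then show ?case unfolding t0(2) by blast
  qed
  from this[of N] show ?thesis by (simp add: h(3))
qed

lemma mild_solution_exists:
  assumes cin: "cin \<in> X01_nonneg" and T: "0 < T"
  shows "\<exists>c. mild_solution cs a T cin c"
proof -
  define e where "e n = inverse (real (Suc n))" for n
  have e: "0 < e n" "e n \<le> 1" for n by (auto simp: e_def inverse_le_1_iff)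
  have elim: "e \<longlonglongrightarrow> 0" unfolding e_def by (rule LIMSEQ_inverse_real_of_nat)
  have "\<forall>n. \<exists>c g S. approximate_solution T cin (e n) c g S"
    using approximate_solution_exists[OF cin T e(1)] by blast
  then obtain x g S where x: "\<And>n. approximate_solution T cin (e n) (x n) (g n) (S n)"
    by metis
  define R where "R = 2 * W cin"
  have bd: "Bd R (x n t)" if "t \<in> {0..T}" for n t
    unfolding R_def using x[of n] that by (intro Bd_of_W) (auto simp: approximate_solution_def admissible_def)
  have R0: "0 \<le> R" using BdD(7)[OF bd[of 0 0]] T by simp
  have fin: "finite (S n)" and x0: "x n 0 = cin" for n
    using x[of n] by (auto simp: approximate_solution_def)
  have cont: "continuous_on {0..T} (\<lambda>t. x n t i)" for n i
    using x[of n] by (simp add: approximate_solution_def)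
  have der: "((\<lambda>t. x n t i) has_real_derivative g n t i) (at t)" if "t \<in> {0<..<T} - S n" for n t i
    using x[of n] that by (simp add: approximate_solution_def)
  have defect: "wsummable \<alpha> (\<lambda>i. g n t i - F (x n t) i) \<and> wnorm \<alpha> (\<lambda>i. g n t i - F (x n t) i) \<le> e n"
    if "t \<in> {0..T}" for n t
    using x[of n] that by (simp add: approximate_solution_def admissible_def)
  have defect': "\<bar>g n t i - F (x n t) i\<bar> \<le> e n" if "t \<in> {0..T}" for n t i
    using component_le_wnorm[OF conjunct1[OF defect[OF that]] \<alpha>(1), of n i] defect[OF that, of n] by linarith
  define B where "B = T * exp (2 * K * R * T)"
  have B: "0 < B" using T by (simp add: B_def)
  \<comment> \<open>Both polygons start from \<open>cin\<close>, so only their defects enter the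
    stability estimate; the corners of both are exceptional.\<close>
  have diff: "\<bar>x n t i - x l t i\<bar> \<le> (e n + e l) * B" if t: "t \<in> {0..T}" for n l t i
  proof -
    have z: "wnorm \<alpha> (\<lambda>i. cin i - cin i) = 0" by (simp add: wnorm_def)
    have "wnorm \<alpha> (\<lambda>i. x n t i - x l t i)
        \<le> (wnorm \<alpha> (\<lambda>i. x n 0 i - x l 0 i) + (e n + e l) * (t - 0)) * exp (2 * K * R * (t - 0))"
      using t by (intro stability[where S = "S n \<union> S l" and gc = "g n" and gd = "g l"])
        (auto intro!: bd der fin conjunct1[OF defect] conjunct2[OF defect] intro: continuous_on_subset[OF cont])
    also have "\<dots> = ((e n + e l) * t) * exp (2 * K * R * t)" unfolding x0 z by simp
    also have "\<dots> \<le> ((e n + e l) * T) * exp (2 * K * R * T)"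
      using t e[of n] e[of l] K_nonneg R0 by (intro mult_mono) (auto intro!: mult_left_mono)
    finally have "wnorm \<alpha> (\<lambda>i. x n t i - x l t i) \<le> (e n + e l) * B" by (simp add: B_def mult_ac)
    moreover have "\<bar>x n t i - x l t i\<bar> \<le> wnorm \<alpha> (\<lambda>i. x n t i - x l t i)"
      by (intro component_le_wnorm[where x = "\<lambda>i. x n t i - x l t i"] wsummable_diff BdD(6)[OF bd[OF t]] \<alpha>)
    ultimately show ?thesis by linarith
  qed
  have "\<exists>y. uniform_limit {0..T} (\<lambda>n t. x n t i) y sequentially" for i
  proof -
    have "uniformly_Cauchy_on {0..T} (\<lambda>n t. x n t i)"
    proof (rule uniformly_Cauchy_onI)
      fix r :: real assume r: "0 < r"
      then have "\<forall>\<^sub>F n in sequentially. e n < r / (2 * B)"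
        using B by (intro order_tendstoD[OF elim]) auto
      then obtain N where N: "\<And>n. n \<ge> N \<Longrightarrow> e n < r / (2 * B)" by (auto simp: eventually_sequentially)
      have "dist (x n t i) (x l t i) < r" if "t \<in> {0..T}" "n \<ge> N" "l \<ge> N" for n l t
      proof -
        have "e n + e l < r / B" using N[OF that(2)] N[OF that(3)] by (simp add: field_simps)
        then have "(e n + e l) * B < r" using B by (simp add: field_simps)
        with diff[OF that(1), of n i l] show ?thesis by (simp add: dist_real_def)
      qed
      then show "\<exists>M. \<forall>t\<in>{0..T}. \<forall>m\<ge>M. \<forall>n\<ge>M. dist (x m t i) (x n t i) < r" by blast
    qed
    then show ?thesis
      using Cauchy_uniformly_convergent unfolding uniformly_convergent_on_def by blast
  qed
  then obtain y where y: "\<And>i. uniform_limit {0..T} (\<lambda>n t. x n t i) (y i) sequentially" by metis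
  define c where "c t i = y i t" for t i
  have lim: "(\<lambda>n. x n t i) \<longlonglongrightarrow> c t i" if "t \<in> {0..T}" for t i
    unfolding c_def using y that by (rule tendsto_uniform_limitI)
  have ccont: "continuous_on {0..T} (\<lambda>t. c t i)" for i
    unfolding c_def by (rule uniform_limit_theorem[OF _ y]) (auto intro: always_eventually cont)
  have cB: "Bd R (c t)" if "t \<in> {0..T}" for t
    by (rule Bd_limit[where x = "\<lambda>n. x n t", OF lim[OF that] bd[OF that]])
  \<comment> \<open>The slopes converge to the limiting vector field, since they differ from
    \<open>F (x n s)\<close> by at most \<open>e n\<close> and \<open>F\<close> is continuous on
    \<open>X01\<close>-bounded sequences. In the majorant, 1 bounds \<open>e n\<close>.\<close>
  have int: "((\<lambda>s. F (c s) i) has_integral (c t i - cin i)) {0..t}" if t: "t \<in> {0..T}" for t i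
  proof (rule has_integral_dominated_convergence
      [where f = "\<lambda>n s. g n s i" and h = "\<lambda>_. 1 + 4 * K * R * R" and y = "\<lambda>n. x n t i - cin i"])
    show "((\<lambda>s. g n s i) has_integral (x n t i - cin i)) {0..t}" for n
    proof -
      have "((\<lambda>s. g n s i) has_integral (x n t i - x n 0 i)) {0..t}"
      proof (rule fundamental_theorem_of_calculus_interior_strong[OF fin])
        show "((\<lambda>s. x n s i) has_vector_derivative g n s i) (at s)" if "s \<in> {0<..<t} - S n" for s
          using der[of s n i] that t by (simp add: has_real_derivative_iff_has_vector_derivative)
        show "continuous_on {0..t} (\<lambda>s. x n s i)"
          using t by (intro continuous_on_subset[OF cont]) auto
      qed (use t in auto)
      then show ?thesis by (simp add: x0)
    qed
    show "\<forall>s\<in>{0..t}. norm (g n s i) \<le> 1 + 4 * K * R * R" for n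
    proof
      fix s assume "s \<in> {0..t}"
      then have s: "s \<in> {0..T}" using t by auto
      have "\<bar>F (x n s) i\<bar> \<le> 4 * K * R * R"
        using component_le_wnorm[OF F_Bd(1)[OF bd[OF s]] \<alpha>(1), of n i] F_Bd(2)[OF bd[OF s], of n] by linarith
      then show "norm (g n s i) \<le> 1 + 4 * K * R * R"
        using defect'[OF s, of n i] e(2)[of n] unfolding real_norm_def by linarith
    qed
    show "\<forall>s\<in>{0..t}. (\<lambda>n. g n s i) \<longlonglongrightarrow> F (c s) i"
    proof
      fix s assume "s \<in> {0..t}"
      then have s: "s \<in> {0..T}" using t by auto
      have "(\<lambda>n. F (x n s) i) \<longlonglongrightarrow> F (c s) i"
        using BdD(2,3)[OF bd[OF s]] by (intro F_tendsto[where R = R, OF lim[OF s] _ BdD(2)[OF cB[OF s]]]) auto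
      moreover have "(\<lambda>n. g n s i - F (x n s) i) \<longlonglongrightarrow> 0"
        by (rule tendsto_0_le[where K = 1, OF elim]) (use defect'[OF s] e(1) in \<open>auto simp: less_imp_le\<close>)
      ultimately have "(\<lambda>n. F (x n s) i + (g n s i - F (x n s) i)) \<longlonglongrightarrow> F (c s) i + 0"
        by (rule tendsto_add)
      then show "(\<lambda>n. g n s i) \<longlonglongrightarrow> F (c s) i" by simp
    qed
    show "(\<lambda>n. x n t i - cin i) \<longlonglongrightarrow> c t i - cin i" by (intro tendsto_intros lim t)
  qed auto
  have "mild_solution cs a T cin c"
    unfolding mild_solution_def
  proof (intro conjI ballI allI)
    show "c t \<in> X01_nonneg" if "t \<in> {0..T}" for t
      using cB[OF that] by (simp add: X01_nonneg_iff Bd_def)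
    show "continuous_on {0..T} (\<lambda>t. c t i)" for i by (rule ccont)
    fix i t assume t: "t \<in> {0<..T}"
    have c2: "wsummable (2 * \<alpha>) (c s)" if "s \<in> {0<..<t}" for s
      using that t by (intro BdD(4)[OF cB]) auto
    have sub: "{0<..<t} \<subseteq> {0..T}" using t by auto
    have intg: "set_integrable lebesgue {0<..<t} f" if "continuous_on {0..T} f" for f :: "real \<Rightarrow> real"
      by (rule set_integrable_subset[OF absolutely_integrable_continuous_real[OF that] _ sub]) simp
    show "AE s in lebesgue. s \<in> {0<..<t} \<longrightarrow> dged_Q_converges cs a l i (c s)" for l
      by (intro AE_I2 impI dged_Q_converges c2)
    show "set_integrable lebesgue {0<..<t} (\<lambda>s. dged_Q cs a l i (c s))" if l: "l \<in> {1..4}" for l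
    proof -
      have "set_integrable lebesgue {0<..<t}
          (\<lambda>s. \<sigma> i * (if odd l then push l (c s) (c s) i else - push l (c s) (c s) i))"
        by (rule intg) (cases "odd l"; simp; intro continuous_intros F_continuous_on(2)[OF cB ccont]; simp)
      then show ?thesis
        by (rule set_integrable_cong[THEN iffD2, rotated 3]) (auto simp: dged_Q_eq[OF c2 l])
    qed
    have "(LINT s:{0<..<t}|lebesgue. (\<Sum>l=1..4. dged_Q cs a l i (c s))) = (LINT s:{0<..<t}|lebesgue. F (c s) i)"
      by (rule set_lebesgue_integral_cong) (simp, intro allI impI sum_dged_Q_eq c2)
    also have "\<dots> = integral {0..t} (\<lambda>s. F (c s) i)"
      by (subst set_lebesgue_integral_eq_integral[OF intg[OF F_continuous_on(1)[OF cB ccont]]])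
        (simp_all add: integral_open_interval_real)
    also have "\<dots> = c t i - cin i" using int[of t i] t by (simp add: integral_unique)
    finally show "c t i = cin i + (LINT s:{0<..<t}|lebesgue. (\<Sum>l=1..4. dged_Q cs a l i (c s)))" by simp
  qed
  then show ?thesis by blast
qed

end

theorem theorem3p7:
  fixes a :: rates and q :: "nat \<Rightarrow> nat \<Rightarrow> real"
    and \<alpha> C \<Q> T :: real and cin :: "nat \<Rightarrow> real" and cs :: dged_case
  assumes "rate_coefficients a"
    and "0 \<le> \<alpha>" and "\<alpha> < 1 / 2" and "1 \<le> C" and "1 \<le> \<Q>"
    and "\<And>i k. 1 \<le> k \<Longrightarrow> k \<le> i \<Longrightarrow> 0 \<le> q i k"
    and "\<And>i. 1 \<le> i \<Longrightarrow> (\<Sum>k=1..i. real k * real (i - k + 1) * q i k) \<le> \<Q> * real i"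
    and "\<And>i j k. 1 \<le> k \<Longrightarrow> k \<le> i \<Longrightarrow> 1 \<le> j \<Longrightarrow>
           a i j k \<le> C * real (i - k + 1) * real (j + k) * q i k"
    and "\<And>i j k. 1 \<le> k \<Longrightarrow> k \<le> i \<Longrightarrow>
           a i j k \<le> C * rpow (real (i - k + 1)) \<alpha> * (rpow (real j) \<alpha> + rpow (real k) \<alpha>) * q i k"
    and "0 < T" and "cin \<in> X01_nonneg"
  shows "\<exists>c. mild_solution cs a T cin c \<and>
           (\<forall>d. mild_solution cs a T cin d \<longrightarrow> (\<forall>t\<in>{0..T}. d t = c t))"
proof -
  \<comment> \<open>The factor 2 arises when the sum of powers in the rate bound is replaced by a
    product.\<close>
  interpret dged_kernel a q \<alpha> "2 * C" \<Q> cs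
  proof
    fix p j k :: nat assume k: "1 \<le> k" "k \<le> p"
    show "0 \<le> a p j k" using assms(1) k by (auto simp: rate_coefficients_def)
    \<comment> \<open>At \<open>j = 0\<close> the convention for the zeroth power is covered because
      \<open>wgt \<alpha>\<close> equals 1 there.\<close>
    have rj: "rpow (real j) \<alpha> \<le> wgt \<alpha> j"
      using assms(2) by (auto simp: rpow_def wgt_def intro!: powr_mono2)
    have rk: "rpow (real k) \<alpha> = real k powr \<alpha>" "rpow (real (p - k + 1)) \<alpha> = real (p - k + 1) powr \<alpha>"
      using k by (auto simp: rpow_def)
    have ge: "1 \<le> wgt \<alpha> j" "1 \<le> real k powr \<alpha>"
      using assms(2) k by (auto simp: wgt_ge_one ge_one_powr_ge_zero)
    \<comment> \<open>Two numbers that are at least 1 are each bounded by their product.\<close>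
    have "wgt \<alpha> j + real k powr \<alpha> \<le> 2 * (wgt \<alpha> j * real k powr \<alpha>)"
      using mult_right_mono[OF ge(1), of "real k powr \<alpha>"] mult_left_mono[OF ge(2), of "wgt \<alpha> j"] ge
      by linarith
    then have le: "rpow (real j) \<alpha> + rpow (real k) \<alpha> \<le> 2 * (wgt \<alpha> j * real k powr \<alpha>)"
      using rj rk by simp
    have "a p j k \<le> C * rpow (real (p - k + 1)) \<alpha> * (rpow (real j) \<alpha> + rpow (real k) \<alpha>) * q p k"
      by (rule assms(9)[OF k])
    also have "\<dots> \<le> C * rpow (real (p - k + 1)) \<alpha> * (2 * (wgt \<alpha> j * real k powr \<alpha>)) * q p k"
    proof (intro mult_right_mono mult_left_mono le assms(6)[OF k])
      show "0 \<le> C * rpow (real (p - k + 1)) \<alpha>" unfolding rk using assms(4) by simp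
    qed
    also have "\<dots> = 2 * C * wgt \<alpha> j * (real k * real (p - k + 1)) powr \<alpha> * q p k"
      unfolding rk powr_mult by (simp only: mult_ac)
    finally show "a p j k \<le> 2 * C * wgt \<alpha> j * (real k * real (p - k + 1)) powr \<alpha> * q p k" .
  qed (use assms in auto)
  obtain c where "mild_solution cs a T cin c" using mild_solution_exists[OF assms(11,10)] by blast
  then show ?thesis using mild_solution_unique[OF _ _ assms(10)] by blast
qed

end
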